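(* Let $X$ be a compact Riemann surface equipped with an integrable metric $h_{X,\infty}$, and let $\mathcal{O}$ be the trivial line bundle with a constant hermitian metric $h_{\mathcal{O}}$. The operator $\Delta_{X,\infty}$ (initially defined on $A^{(0,0)}(X)$) admits a maximal selfadjoint extension with domain $\mathcal{H}_2(X)$. Denote this extension also by $\Delta_{X,\infty}$. Then $I+\Delta_{X,\infty}$ is invertible; more precisely, $$(I+\Delta_{X,\infty})(I+\Delta_{X,\infty})^{-1}=I\quad\text{on }\mathcal{H}_0(X),$$ $$(I+\Delta_{X,\infty})^{-1}(I+\Delta_{X,\infty})=I\quad\text{on }\mathcal{H}_2(X).$$
   Context: $A^{(0,0)}(X)$ is the space of smooth complex functions on $X$. A continuous hermitian metric $\|\cdot\|$ on a holomorphic line bundle $L$ is positive if the current $c_1(L,\|\cdot\|)$, locally $dd^c(-\log\|s\|^2)$ for a non-vanishing local holomorphic section $s$, is $\geq 0$; it is admissible if it is the uniform limit of a sequence of smooth positive hermitian metrics on $L$. Uniform convergence of metrics $h_n\to h$ means that the functions $h_n/h$ converge uniformly to $1$ on $X$. An integrable metric on $X$ is a hermitian metric $h_{X,\infty}$ on the holomorphic tangent bundle $TX$ of the form $h_{1,\infty}\otimes h_{2,\infty}^{-1}$, where $h_{1,\infty},h_{2,\infty}$ are admissible metrics on holomorphic line bundles $L_1,L_2$ with $TX\simeq L_1\otimes L_2^{-1}$. Fix sequences $(h_{1,n})_n,(h_{2,n})_n$ of smooth positive metrics on $L_1,L_2$ converging uniformly to $h_{1,\infty},h_{2,\infty}$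 and put $h_{X,n}=h_{1,n}\otimes h_{2,n}^{-1}$. Fix a smooth nondecreasing $\rho:\mathbb{R}\to[0,1]$ with $\rho=0$ on $(-\infty,0]$ and $\rho=1$ on $[1,\infty)$. For real $u\in[n,n+1]$, $n\ge1$ an integer, put $h_{X,u}=(1-\rho(u-n))h_{X,n}+\rho(u-n)h_{X,n+1}$; this is a smooth hermitian metric on $TX$, and $h_{X,u}\to h_{X,\infty}$ uniformly as $u\to\infty$. For $u\in[1,\infty]$: in a local coordinate $z$, $\omega_{X,u}=\frac{i}{2\pi}h_{X,u}(\frac{\partial}{\partial z},\frac{\partial}{\partial z})\,dz\wedge d\overline z$; $(\xi,\xi')_{L^2,u}=\int_X \xi\overline{\xi'}\,h_{\mathcal{O}}(1,1)\,\omega_{X,u}$, with norm $\|\cdot\|_{L^2,u}$; and $\Delta_{X,u}\xi=-h_{X,u}(\frac{\partial}{\partial z},\frac{\partial}{\partial z})^{-1}\frac{\partial^2\xi}{\partial z\,\partial\overline z}$ for $\xi\in A^{(0,0)}(X)$. $\mathcal{H}_0(X)$ is the completion of $A^{(0,0)}(X)$ for any of the (equivalent) norms $\|\cdot\|_{L^2,u}$. For $u<\infty$, $(I+\Delta_{X,u})^{-1}$ is the usual compact resolvent operator on $\mathcal{H}_0(X)$. The symbol $(I+\Delta_{X,\infty})^{-1}$ denotes, by definition, the operator on $\mathcal{H}_0(X)$ which is the limit, in operator norm, of $(I+\Delta_{X,u})^{-1}$ as $u\to\infty$ (this limit exists and is compact), and $\mathcal{H}_2(X):=(I+\Delta_{X,\infty})^{-1}\mathcal{H}_0(X)$.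 Selfadjointness is with respect to $(\cdot,\cdot)_{L^2,\infty}$. A selfadjoint extension $Q$ of an operator is called maximal if every selfadjoint operator $T$ with $\mathrm{Dom}(Q)\subseteq\mathrm{Dom}(T)$ and $T|_{\mathrm{Dom}(Q)}=Q$ satisfies $T=Q$. *)

theory Defs
  imports "HOL-Analysis.Analysis"
begin

section \<open>Smooth functions and Wirtinger derivatives\<close>

primrec Ck_on :: "nat \<Rightarrow> 'a::real_normed_vector set \<Rightarrow> ('a \<Rightarrow> 'b::real_normed_vector) \<Rightarrow> bool" where
  "Ck_on 0 S f \<longleftrightarrow> continuous_on S f"
| "Ck_on (Suc k) S f \<longleftrightarrow>
     (\<forall>x\<in>S. f differentiable (at x)) \<and> (\<forall>v. Ck_on k S (\<lambda>x. frechet_derivative f (at x) v))"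

(* Only used for open S. *)
definition smooth_on :: "'a::real_normed_vector set \<Rightarrow> ('a \<Rightarrow> 'b::real_normed_vector) \<Rightarrow> bool" where
  "smooth_on S f \<longleftrightarrow> (\<forall>k. Ck_on k S f)"

definition d_z :: "(complex \<Rightarrow> complex) \<Rightarrow> complex \<Rightarrow> complex" where
  "d_z f z = (frechet_derivative f (at z) 1 - \<i> * frechet_derivative f (at z) \<i>) / 2"

definition d_zbar :: "(complex \<Rightarrow> complex) \<Rightarrow> complex \<Rightarrow> complex" where
  "d_zbar f z = (frechet_derivative f (at z) 1 + \<i> * frechet_derivative f (at z) \<i>) / 2"

definition d_z_zbar :: "(complex \<Rightarrow> complex) \<Rightarrow> complex \<Rightarrow> complex" where
  "d_z_zbar f = d_z (d_zbar f)"


section \<open>Compact Riemann surfaces\<close>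

text \<open>The surface is the whole type; a chart is a pair of an open set and a coordinate on it.\<close>

type_synonym 'a chart = "'a set \<times> ('a \<Rightarrow> complex)"

definition param :: "'a chart \<Rightarrow> complex \<Rightarrow> 'a" where
  "param c = inv_into (fst c) (snd c)"

definition holomorphic_atlas :: "'a::t2_space chart set \<Rightarrow> bool" where
  "holomorphic_atlas A \<longleftrightarrow>
     (\<Union>c\<in>A. fst c) = UNIV \<and>
     (\<forall>c\<in>A. open (fst c) \<and> open (snd c ` fst c) \<and>
            homeomorphism (fst c) (snd c ` fst c) (snd c) (param c)) \<and>
     (\<forall>c\<in>A. \<forall>d\<in>A. (snd d \<circ> param c) holomorphic_on (snd c ` (fst c \<inter> fst d)))"

definition compact_riemann_surface :: "'a::t2_space chart set \<Rightarrow> bool" where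
  "compact_riemann_surface A \<longleftrightarrow>
     holomorphic_atlas A \<and> compact (UNIV :: 'a set) \<and> connected (UNIV :: 'a set)"

definition surface_holomorphic_on :: "'a chart set \<Rightarrow> 'a set \<Rightarrow> ('a \<Rightarrow> complex) \<Rightarrow> bool" where
  "surface_holomorphic_on A W f \<longleftrightarrow>
     (\<forall>c\<in>A. (f \<circ> param c) holomorphic_on (snd c ` (fst c \<inter> W)))"

definition surface_smooth_on ::
    "'a chart set \<Rightarrow> 'a set \<Rightarrow> ('a \<Rightarrow> 'b::real_normed_vector) \<Rightarrow> bool" where
  "surface_smooth_on A W f \<longleftrightarrow> (\<forall>c\<in>A. smooth_on (snd c ` (fst c \<inter> W)) (f \<circ> param c))"

definition smooth_functions :: "'a chart set \<Rightarrow> ('a \<Rightarrow> complex) set" where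
  "smooth_functions A = {\<xi>. surface_smooth_on A UNIV \<xi>}"


section \<open>Holomorphic line bundles\<close>

text \<open>
  A line bundle is given by a cocycle: over \<open>lb_dom L i\<close> there is a holomorphic frame \<open>e i\<close>,
  and \<open>e j = lb_trans L i j \<cdot> e i\<close> on overlaps.
\<close>

record ('a, 'i) line_bundle =
  lb_index :: "'i set"
  lb_dom :: "'i \<Rightarrow> 'a set"
  lb_trans :: "'i \<Rightarrow> 'i \<Rightarrow> 'a \<Rightarrow> complex"

definition holomorphic_line_bundle ::
    "'a::t2_space chart set \<Rightarrow> ('a, 'i) line_bundle \<Rightarrow> bool" where
  "holomorphic_line_bundle A L \<longleftrightarrow>
     (\<Union>i\<in>lb_index L. lb_dom L i) = UNIV \<and>
     (\<forall>i\<in>lb_index L. open (lb_dom L i)) \<and>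
     (\<forall>i\<in>lb_index L. \<forall>j\<in>lb_index L.
        surface_holomorphic_on A (lb_dom L i \<inter> lb_dom L j) (lb_trans L i j)) \<and>
     (\<forall>i\<in>lb_index L. \<forall>p\<in>lb_dom L i. lb_trans L i i p = 1) \<and>
     (\<forall>i\<in>lb_index L. \<forall>j\<in>lb_index L. \<forall>k\<in>lb_index L.
        \<forall>p\<in>lb_dom L i \<inter> lb_dom L j \<inter> lb_dom L k.
          lb_trans L i j p * lb_trans L j k p = lb_trans L i k p)"

(* The frame over the chart c is d/dz for the coordinate z = snd c. *)
definition tangent_bundle :: "'a chart set \<Rightarrow> ('a, 'a chart) line_bundle" where
  "tangent_bundle A =
     \<lparr> lb_index = A, lb_dom = fst,
       lb_trans = (\<lambda>c d p. deriv (snd c \<circ> param d) (snd d p)) \<rparr>"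

definition tensor_bundle ::
    "('a, 'i) line_bundle \<Rightarrow> ('a, 'j) line_bundle \<Rightarrow> ('a, 'i \<times> 'j) line_bundle" where
  "tensor_bundle L M =
     \<lparr> lb_index = lb_index L \<times> lb_index M,
       lb_dom = (\<lambda>(i, j). lb_dom L i \<inter> lb_dom M j),
       lb_trans = (\<lambda>(i, j) (k, l) p. lb_trans L i k p * lb_trans M j l p) \<rparr>"

definition dual_bundle :: "('a, 'i) line_bundle \<Rightarrow> ('a, 'i) line_bundle" where
  "dual_bundle L =
     \<lparr> lb_index = lb_index L, lb_dom = lb_dom L,
       lb_trans = (\<lambda>i j p. inverse (lb_trans L i j p)) \<rparr>"

(* The isomorphism F is given in the frames e of L and f of M by F (e i) = \<sigma> i j \<cdot> f j. *)
definition bundle_isomorphism ::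
    "'a::t2_space chart set \<Rightarrow> ('a, 'i) line_bundle \<Rightarrow> ('a, 'j) line_bundle
      \<Rightarrow> ('i \<Rightarrow> 'j \<Rightarrow> 'a \<Rightarrow> complex) \<Rightarrow> bool" where
  "bundle_isomorphism A L M \<sigma> \<longleftrightarrow>
     (\<forall>i\<in>lb_index L. \<forall>j\<in>lb_index M.
        surface_holomorphic_on A (lb_dom L i \<inter> lb_dom M j) (\<sigma> i j) \<and>
        (\<forall>p\<in>lb_dom L i \<inter> lb_dom M j. \<sigma> i j p \<noteq> 0)) \<and>
     (\<forall>i\<in>lb_index L. \<forall>k\<in>lb_index L. \<forall>j\<in>lb_index M.
        \<forall>p\<in>lb_dom L i \<inter> lb_dom L k \<inter> lb_dom M j. \<sigma> k j p = lb_trans L i k p * \<sigma> i j p) \<and>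
     (\<forall>i\<in>lb_index L. \<forall>j\<in>lb_index M. \<forall>l\<in>lb_index M.
        \<forall>p\<in>lb_dom L i \<inter> lb_dom M j \<inter> lb_dom M l. \<sigma> i j p = lb_trans M j l p * \<sigma> i l p)"


section \<open>Hermitian metrics\<close>

text \<open>A hermitian metric is recorded by its values \<open>h i p = h (e i, e i) p\<close> on the frames.\<close>

type_synonym ('a, 'i) metric = "'i \<Rightarrow> 'a \<Rightarrow> real"

definition hermitian_metric :: "('a, 'i) line_bundle \<Rightarrow> ('a, 'i) metric \<Rightarrow> bool" where
  "hermitian_metric L h \<longleftrightarrow>
     (\<forall>i\<in>lb_index L. \<forall>p\<in>lb_dom L i. h i p > 0) \<and>
     (\<forall>i\<in>lb_index L. \<forall>j\<in>lb_index L. \<forall>p\<in>lb_dom L i \<inter> lb_dom L j.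
        h j p = (cmod (lb_trans L i j p))\<^sup>2 * h i p)"

definition continuous_metric :: "('a::t2_space, 'i) line_bundle \<Rightarrow> ('a, 'i) metric \<Rightarrow> bool" where
  "continuous_metric L h \<longleftrightarrow>
     hermitian_metric L h \<and> (\<forall>i\<in>lb_index L. continuous_on (lb_dom L i) (h i))"

definition smooth_metric ::
    "'a::t2_space chart set \<Rightarrow> ('a, 'i) line_bundle \<Rightarrow> ('a, 'i) metric \<Rightarrow> bool" where
  "smooth_metric A L h \<longleftrightarrow>
     hermitian_metric L h \<and> (\<forall>i\<in>lb_index L. surface_smooth_on A (lb_dom L i) (h i))"

(* The current dd^c(-log h i) is tested against nonnegative test functions \<theta>, where
   dd^c \<theta> = (i / 2 pi) (d^2 \<theta> / dz dzbar) dz dzbar = (1 / pi) (d^2 \<theta> / dz dzbar) dx dy. *)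
definition positive_metric ::
    "'a::t2_space chart set \<Rightarrow> ('a, 'i) line_bundle \<Rightarrow> ('a, 'i) metric \<Rightarrow> bool" where
  "positive_metric A L h \<longleftrightarrow>
     continuous_metric L h \<and>
     (\<forall>c\<in>A. \<forall>i\<in>lb_index L. \<forall>\<theta>::complex \<Rightarrow> real.
        smooth_on UNIV \<theta> \<and> (\<forall>z. 0 \<le> \<theta> z) \<and>
        compact (closure {z. \<theta> z \<noteq> 0}) \<and>
        closure {z. \<theta> z \<noteq> 0} \<subseteq> snd c ` (fst c \<inter> lb_dom L i)
        \<longrightarrow> 0 \<le> set_lebesgue_integral lborel (snd c ` (fst c \<inter> lb_dom L i))
                 (\<lambda>z. - ln (h i (param c z)) *
                       (Re (d_z_zbar (\<lambda>w. complex_of_real (\<theta> w)) z) / pi)))"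

definition metrics_converge ::
    "('a, 'i) line_bundle \<Rightarrow> (nat \<Rightarrow> ('a, 'i) metric) \<Rightarrow> ('a, 'i) metric \<Rightarrow> bool" where
  "metrics_converge L hs h \<longleftrightarrow>
     uniform_limit (SIGMA i:lb_index L. lb_dom L i)
       (\<lambda>n (i, p). hs n i p / h i p) (\<lambda>_. 1) sequentially"

definition smooth_positive_approximation ::
    "'a::t2_space chart set \<Rightarrow> ('a, 'i) line_bundle \<Rightarrow> (nat \<Rightarrow> ('a, 'i) metric)
      \<Rightarrow> ('a, 'i) metric \<Rightarrow> bool" where
  "smooth_positive_approximation A L hs h \<longleftrightarrow>
     (\<forall>n. smooth_metric A L (hs n) \<and> positive_metric A L (hs n)) \<and> metrics_converge L hs h"

definition admissible_metric ::
    "'a::t2_space chart set \<Rightarrow> ('a, 'i) line_bundle \<Rightarrow> ('a, 'i) metric \<Rightarrow> bool" where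
  "admissible_metric A L h \<longleftrightarrow>
     hermitian_metric L h \<and> (\<exists>hs. smooth_positive_approximation A L hs h)"

definition tensor_metric ::
    "('a, 'i) metric \<Rightarrow> ('a, 'j) metric \<Rightarrow> ('a, 'i \<times> 'j) metric" where
  "tensor_metric h h' = (\<lambda>(i, j) p. h i p * h' j p)"

definition dual_metric :: "('a, 'i) metric \<Rightarrow> ('a, 'i) metric" where
  "dual_metric h = (\<lambda>i p. inverse (h i p))"

(* The result does not depend on the chosen frame j of M when \<sigma> is an isomorphism to M and
   h is a hermitian metric on M. *)
definition pullback_metric ::
    "('a, 'j) line_bundle \<Rightarrow> ('i \<Rightarrow> 'j \<Rightarrow> 'a \<Rightarrow> complex) \<Rightarrow> ('a, 'j) metric \<Rightarrow> ('a, 'i) metric" where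
  "pullback_metric M \<sigma> h i p =
     (let j = (SOME j. j \<in> lb_index M \<and> p \<in> lb_dom M j) in (cmod (\<sigma> i j p))\<^sup>2 * h j p)"

text \<open>The metric on the tangent bundle induced by \<open>h1 \<otimes> h2\<^sup>-\<^sup>1\<close> via \<open>\<sigma> : TX \<simeq> L1 \<otimes> L2\<^sup>-\<^sup>1\<close>.\<close>

definition quotient_metric ::
    "('a, 'i) line_bundle \<Rightarrow> ('a, 'j) line_bundle \<Rightarrow> ('a chart \<Rightarrow> 'i \<times> 'j \<Rightarrow> 'a \<Rightarrow> complex)
      \<Rightarrow> ('a, 'i) metric \<Rightarrow> ('a, 'j) metric \<Rightarrow> ('a, 'a chart) metric" where
  "quotient_metric L1 L2 \<sigma> h1 h2 =
     pullback_metric (tensor_bundle L1 (dual_bundle L2)) \<sigma> (tensor_metric h1 (dual_metric h2))"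

definition integrable_metric ::
    "'a::t2_space chart set \<Rightarrow> ('a, 'i) line_bundle \<Rightarrow> ('a, 'j) line_bundle
      \<Rightarrow> ('a chart \<Rightarrow> 'i \<times> 'j \<Rightarrow> 'a \<Rightarrow> complex)
      \<Rightarrow> ('a, 'i) metric \<Rightarrow> ('a, 'j) metric \<Rightarrow> ('a, 'a chart) metric \<Rightarrow> bool" where
  "integrable_metric A L1 L2 \<sigma> h1 h2 h \<longleftrightarrow>
     holomorphic_line_bundle A L1 \<and> holomorphic_line_bundle A L2 \<and>
     bundle_isomorphism A (tangent_bundle A) (tensor_bundle L1 (dual_bundle L2)) \<sigma> \<and>
     admissible_metric A L1 h1 \<and> admissible_metric A L2 h2 \<and>
     hermitian_metric (tangent_bundle A) h \<and>
     (\<forall>c\<in>A. \<forall>p\<in>fst c. h c p = quotient_metric L1 L2 \<sigma> h1 h2 c p)"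

definition cutoff_function :: "(real \<Rightarrow> real) \<Rightarrow> bool" where
  "cutoff_function \<rho> \<longleftrightarrow>
     smooth_on UNIV \<rho> \<and> mono \<rho> \<and> range \<rho> \<subseteq> {0..1} \<and> (\<forall>t\<le>0. \<rho> t = 0) \<and> (\<forall>t\<ge>1. \<rho> t = 1)"

(* At an integer u the formulas on [u - 1, u] and [u, u + 1] agree because \<rho> 0 = 0 and \<rho> 1 = 1. *)
definition interpolated_metric ::
    "(real \<Rightarrow> real) \<Rightarrow> (nat \<Rightarrow> ('a, 'i) metric) \<Rightarrow> real \<Rightarrow> ('a, 'i) metric" where
  "interpolated_metric \<rho> hs u = (\<lambda>i p. let n = nat \<lfloor>u\<rfloor>; t = \<rho> (u - real n) in
     (1 - t) * hs n i p + t * hs (n + 1) i p)"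


section \<open>Volume form, inner product and Laplacian\<close>

(* The Borel measure of the positive (1,1)-form (i / 2 pi) h(d/dz, d/dz) dz dzbar
   = (h(d/dz, d/dz) / pi) dx dy. *)
definition volume_measure ::
    "'a::t2_space chart set \<Rightarrow> ('a, 'a chart) metric \<Rightarrow> 'a measure" where
  "volume_measure A h = (THE \<mu>. sets \<mu> = sets borel \<and>
     (\<forall>c\<in>A. \<forall>B\<in>sets borel. B \<subseteq> fst c \<longrightarrow>
        emeasure \<mu> B =
          (\<integral>\<^sup>+ z. ennreal (h c (param c z) / pi) * indicator (snd c ` B) z \<partial>lborel)))"

(* hO is the constant value of the metric of the trivial bundle on its section 1. *)
definition L2_inner ::
    "'a::t2_space chart set \<Rightarrow> real \<Rightarrow> ('a, 'a chart) metric
      \<Rightarrow> ('a \<Rightarrow> complex) \<Rightarrow> ('a \<Rightarrow> complex) \<Rightarrow> complex" where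
  "L2_inner A hO h \<xi> \<eta> = (\<integral>p. \<xi> p * cnj (\<eta> p) * complex_of_real hO \<partial>(volume_measure A h))"

definition L2_norm ::
    "'a::t2_space chart set \<Rightarrow> real \<Rightarrow> ('a, 'a chart) metric \<Rightarrow> ('a \<Rightarrow> complex) \<Rightarrow> real" where
  "L2_norm A hO h \<xi> = sqrt (Re (L2_inner A hO h \<xi> \<xi>))"

(* Independent of the chosen chart, since h is a metric on the tangent bundle. *)
definition laplacian ::
    "'a chart set \<Rightarrow> ('a, 'a chart) metric \<Rightarrow> ('a \<Rightarrow> complex) \<Rightarrow> 'a \<Rightarrow> complex" where
  "laplacian A h \<xi> p =
     (let c = (SOME c. c \<in> A \<and> p \<in> fst c) in
        - inverse (complex_of_real (h c p)) * d_z_zbar (\<xi> \<circ> param c) (snd c p))"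


section \<open>Operators on a complex Hilbert space\<close>

locale complex_hilbert_space = vector_space scaleC
  for scaleC :: "complex \<Rightarrow> 'h::banach \<Rightarrow> 'h" +
  fixes ip :: "'h \<Rightarrow> 'h \<Rightarrow> complex"
  assumes scaleC_of_real: "scaleC (complex_of_real r) x = r *\<^sub>R x"
    and ip_add_left: "ip (x + y) z = ip x z + ip y z"
    and ip_scaleC_left: "ip (scaleC a x) y = a * ip x y"
    and ip_commute: "ip y x = cnj (ip x y)"
    and ip_norm: "ip x x = complex_of_real ((norm x)\<^sup>2)"

text \<open>\<open>H\<close> is the completion, via \<open>\<iota>\<close>, of the function space \<open>V\<close> with inner product \<open>s\<close>.\<close>

definition hilbert_completion ::
    "('a \<Rightarrow> complex) set \<Rightarrow> (('a \<Rightarrow> complex) \<Rightarrow> ('a \<Rightarrow> complex) \<Rightarrow> complex)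
      \<Rightarrow> (complex \<Rightarrow> 'h::banach \<Rightarrow> 'h) \<Rightarrow> ('h \<Rightarrow> 'h \<Rightarrow> complex) \<Rightarrow> (('a \<Rightarrow> complex) \<Rightarrow> 'h) \<Rightarrow> bool" where
  "hilbert_completion V s scaleC ip \<iota> \<longleftrightarrow>
     complex_hilbert_space scaleC ip \<and>
     (\<forall>\<xi>\<in>V. \<forall>\<eta>\<in>V. \<iota> (\<lambda>p. \<xi> p + \<eta> p) = \<iota> \<xi> + \<iota> \<eta>) \<and>
     (\<forall>a. \<forall>\<xi>\<in>V. \<iota> (\<lambda>p. a * \<xi> p) = scaleC a (\<iota> \<xi>)) \<and>
     (\<forall>\<xi>\<in>V. \<forall>\<eta>\<in>V. ip (\<iota> \<xi>) (\<iota> \<eta>) = s \<xi> \<eta>) \<and>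
     closure (\<iota> ` V) = UNIV"

(* The element of the completion of V represented by a function f that is a limit of elements
   of V. It is needed because the Laplacian of a non-smooth metric takes smooth functions to
   functions that are only continuous. For f in V it is \<iota> f. *)
definition completion_class ::
    "('a \<Rightarrow> complex) set \<Rightarrow> (('a \<Rightarrow> complex) \<Rightarrow> real) \<Rightarrow> (('a \<Rightarrow> complex) \<Rightarrow> 'h::banach)
      \<Rightarrow> ('a \<Rightarrow> complex) \<Rightarrow> 'h" where
  "completion_class V N \<iota> f = (THE x. \<exists>\<xi>. (\<forall>n. \<xi> n \<in> V) \<and>
     (\<lambda>n::nat. N (\<lambda>p. \<xi> n p - f p)) \<longlonglongrightarrow> 0 \<and> (\<lambda>n. \<iota> (\<xi> n)) \<longlonglongrightarrow> x)"

text \<open>An unbounded operator is given by its domain \<open>D\<close> and a map \<open>T\<close>, relevant only on \<open>D\<close>.\<close>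

definition op_graph :: "'h set \<Rightarrow> ('h \<Rightarrow> 'h) \<Rightarrow> ('h \<times> 'h) set" where
  "op_graph D T = (\<lambda>x. (x, T x)) ` D"

definition adjoint_graph ::
    "('h \<Rightarrow> 'h \<Rightarrow> complex) \<Rightarrow> 'h set \<Rightarrow> ('h \<Rightarrow> 'h) \<Rightarrow> ('h \<times> 'h) set" where
  "adjoint_graph ip D T = {(y, z). \<forall>x\<in>D. ip (T x) y = ip x z}"

definition selfadjoint ::
    "(complex \<Rightarrow> 'h::banach \<Rightarrow> 'h) \<Rightarrow> ('h \<Rightarrow> 'h \<Rightarrow> complex) \<Rightarrow> 'h set \<Rightarrow> ('h \<Rightarrow> 'h) \<Rightarrow> bool" where
  "selfadjoint scaleC ip D T \<longleftrightarrow>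
     module.subspace scaleC D \<and>
     (\<forall>x\<in>D. \<forall>y\<in>D. T (x + y) = T x + T y) \<and>
     (\<forall>a. \<forall>x\<in>D. T (scaleC a x) = scaleC a (T x)) \<and>
     closure D = UNIV \<and>
     adjoint_graph ip D T = op_graph D T"

definition maximal_selfadjoint ::
    "(complex \<Rightarrow> 'h::banach \<Rightarrow> 'h) \<Rightarrow> ('h \<Rightarrow> 'h \<Rightarrow> complex) \<Rightarrow> 'h set \<Rightarrow> ('h \<Rightarrow> 'h) \<Rightarrow> bool" where
  "maximal_selfadjoint scaleC ip D T \<longleftrightarrow>
     selfadjoint scaleC ip D T \<and>
     (\<forall>D' T'. selfadjoint scaleC ip D' T' \<and> D \<subseteq> D' \<and> (\<forall>x\<in>D. T' x = T x)
        \<longrightarrow> op_graph D' T' = op_graph D T)"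

(* The graph of the Laplacian with domain the smooth functions, inside the completion of the
   smooth functions for the norm N. *)
definition laplacian_graph ::
    "'a chart set \<Rightarrow> (('a \<Rightarrow> complex) \<Rightarrow> real) \<Rightarrow> (('a \<Rightarrow> complex) \<Rightarrow> 'h::banach)
      \<Rightarrow> ('a, 'a chart) metric \<Rightarrow> ('h \<times> 'h) set" where
  "laplacian_graph A N \<iota> h =
     (\<lambda>\<xi>. (\<iota> \<xi>, completion_class (smooth_functions A) N \<iota> (laplacian A h \<xi>))) ` smooth_functions A"

(* R is the bounded inverse of I + T, where T is the closure of the operator with graph G. For
   the Laplacian of a smooth metric on a compact surface T is the unique selfadjoint extension
   (with respect to the inner product of that metric). *)
definition is_resolvent :: "('h::banach \<times> 'h) set \<Rightarrow> ('h \<Rightarrow> 'h) \<Rightarrow> bool" where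
  "is_resolvent G R \<longleftrightarrow>
     bounded_linear R \<and>
     (\<exists>D T. op_graph D T = closure G \<and>
        (\<forall>f. R f \<in> D \<and> R f + T (R f) = f) \<and> (\<forall>x\<in>D. R (x + T x) = x))"

end

theory Submission
  imports Defs "HOL-Complex_Analysis.Complex_Analysis"
begin

text \<open>
  In any chart \<open>h * \<Delta>\<^sub>h \<xi>\<close> is minus the mixed Wirtinger derivative of \<open>\<xi>\<close>, whatever the metric \<open>h\<close>. Hence the
  Laplacians of the smooth metrics \<open>h\<^sub>n\<close> converge uniformly on smooth functions to that of the limit metric \<open>h\<close>, and
  integration by parts makes the latter symmetric for the inner product of \<open>h\<close>; only integer values of the
  parameter \<open>u\<close> are needed. The resolvents of the \<open>h\<^sub>n\<close> are therefore symmetric for the limit inner product up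
  to an error tending to \<open>0\<close>, so their limit \<open>S\<close> is a bounded selfadjoint operator, and it satisfies
  \<open>S (\<xi> + \<Delta> \<xi>) = \<xi>\<close> for smooth \<open>\<xi>\<close>. Its range is thus dense, \<open>S\<close> is injective, and
  \<open>S\<^sup>-\<^sup>1 - I\<close> is the required operator. A selfadjoint operator is always maximal.
\<close>

section \<open>Operators on a complex Hilbert space\<close>

text \<open>The obstacle is that the resolvents of the \<open>h_n\<close> belong to inner products
  that vary with \<open>n\<close>, while the limit must be symmetric for the inner product of
  \<open>h\<close>. The volumes are never compared. Instead, the two Laplacians of a smooth
  \<open>\<xi>\<close> differ pointwise by a factor uniformly close to 1, so the error made by
  replacing one with the other is small relative to the norm of the Laplacian of
  \<open>\<xi>\<close> for \<open>h_n\<close>. If \<open>f\<close> is the sum of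
  \<open>\<xi>\<close> and that Laplacian, this norm is the norm of \<open>f - R_n f\<close>, which
  stays bounded as \<open>n\<close> grows; hence the asymmetry of \<open>R_n\<close> tends to 0 for
  fixed arguments. Integration by parts survives for a merely continuous \<open>h\<close> because
  the volume density \<open>h / pi\<close> cancels the factor \<open>1 / h\<close> of the Laplacian,
  so the metric is never differentiated. It is done one chart at a time, with bump functions built
  from the same cutoff \<open>\<rho>\<close> that interpolates the metrics. The Laplacian for
  \<open>h\<close> of a smooth function is only continuous; its class in the completion is reached
  through the smooth Laplacians for \<open>h_n\<close>, which converge to it uniformly. Injectivity
  of \<open>S\<close> is the orthogonality of kernel and range of a symmetric operator.\<close>

context complex_hilbert_space
begin

lemma ip_add_right: "ip z (x + y) = ip z x + ip z y"
  by (subst (1 2 3) ip_commute) (simp add: ip_add_left)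

lemma ip_scaleC_right: "ip y (scaleC a x) = cnj a * ip y x"
  by (subst (1 2) ip_commute) (simp add: ip_scaleC_left)

lemma ip_minus_left: "ip (x - y) z = ip x z - ip y z"
  using ip_add_left[of "x - y" y z] by simp

lemma ip_minus_right: "ip z (x - y) = ip z x - ip z y"
  by (subst (1 2 3) ip_commute) (simp add: ip_minus_left)

lemma ip_zero_left [simp]: "ip 0 x = 0"
  using ip_minus_left[of x x x] by simp

lemma ip_zero_right [simp]: "ip x 0 = 0"
  using ip_minus_right[of x x x] by simp

lemma ip_cauchy_schwarz: "cmod (ip x y) \<le> norm x * norm y"
proof (cases "y = 0")
  case False
  \<comment> \<open>The coefficient of the orthogonal projection of \<open>x\<close> onto
    \<open>y\<close>; it makes the last bracket in the expansion below vanish.\<close>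
  define t where "t = ip x y / ip y y"
  have n0: "norm y \<noteq> 0" using False by simp
  have "ip (x - scaleC t y) (x - scaleC t y)
      = ip x x - cnj t * ip x y - t * (ip y x - cnj t * ip y y)"
    by (simp add: ip_minus_left ip_minus_right ip_scaleC_left ip_scaleC_right algebra_simps)
  also have "ip y x - cnj t * ip y y = 0"
    using n0 by (simp add: t_def ip_norm ip_commute[of x y])
  also have "cnj t * ip x y = complex_of_real ((cmod (ip x y))\<^sup>2 / (norm y)\<^sup>2)"
    by (simp add: t_def ip_norm complex_norm_square[symmetric] mult.commute)
  finally have "complex_of_real ((norm (x - scaleC t y))\<^sup>2)
      = complex_of_real ((norm x)\<^sup>2 - (cmod (ip x y))\<^sup>2 / (norm y)\<^sup>2)"
    by (simp add: ip_norm)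
  hence "(norm (x - scaleC t y))\<^sup>2 = (norm x)\<^sup>2 - (cmod (ip x y))\<^sup>2 / (norm y)\<^sup>2"
    using of_real_eq_iff by blast
  hence "(cmod (ip x y))\<^sup>2 / (norm y)\<^sup>2 \<le> (norm x)\<^sup>2"
    by (metis diff_ge_0_iff_ge zero_le_power2)
  hence "(cmod (ip x y))\<^sup>2 \<le> (norm x * norm y)\<^sup>2"
    using n0 by (simp add: field_simps power_mult_distrib)
  thus ?thesis by (rule power2_le_imp_le) simp
qed simp

lemma bounded_bilinear_ip: "bounded_bilinear ip"
proof
  show "ip (r *\<^sub>R a) b = r *\<^sub>R ip a b" for r a b
    by (simp flip: scaleC_of_real add: ip_scaleC_left scaleR_conv_of_real)
  show "ip a (r *\<^sub>R b) = r *\<^sub>R ip a b" for r a b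
    by (simp flip: scaleC_of_real add: ip_scaleC_right scaleR_conv_of_real)
  show "\<exists>K. \<forall>a b. cmod (ip a b) \<le> norm a * norm b * K"
    using ip_cauchy_schwarz by (intro exI[of _ 1]) simp
qed (simp_all add: ip_add_left ip_add_right)

lemmas tendsto_ip = bounded_bilinear.tendsto[OF bounded_bilinear_ip]

lemma ip_eqI:
  assumes "\<And>y. ip x y = ip x' y"
  shows "x = x'"
proof -
  have "ip (x - x') (x - x') = 0" using assms by (simp add: ip_minus_left)
  thus ?thesis by (simp add: ip_norm)
qed

lemma ip_eqI_right:
  assumes "\<And>x. ip x y = ip x y'"
  shows "y = y'"
  by (rule ip_eqI) (subst (1 2) ip_commute, simp add: assms)

text \<open>Enlarging an operator shrinks its adjoint. Since both operators equal their adjoints,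
  the two graphs contain each other.\<close>

lemma selfadjoint_imp_maximal:
  assumes "selfadjoint scaleC ip D T"
  shows "maximal_selfadjoint scaleC ip D T"
  unfolding maximal_selfadjoint_def
proof (intro conjI assms allI impI)
  fix D' T' assume *: "selfadjoint scaleC ip D' T' \<and> D \<subseteq> D' \<and> (\<forall>x\<in>D. T' x = T x)"
  have D: "adjoint_graph ip D T = op_graph D T"
    using assms by (simp add: selfadjoint_def)
  have D': "adjoint_graph ip D' T' = op_graph D' T'"
    using * by (simp add: selfadjoint_def)
  have "adjoint_graph ip D' T' \<subseteq> adjoint_graph ip D T"
    using * unfolding adjoint_graph_def by (clarsimp simp: subset_iff) metis
  moreover have "op_graph D T \<subseteq> op_graph D' T'"
    using * unfolding op_graph_def by force
  ultimately show "op_graph D' T' = op_graph D T" using D D' by simp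
qed

text \<open>\<open>R\<close> is defined everywhere, so testing the adjoint relation on all
  \<open>x = R f\<close> loses nothing: by symmetry of \<open>R\<close> it says exactly that
  \<open>y = R (y + z)\<close>, which puts \<open>y\<close> in the range and determines
  \<open>z\<close>.\<close>

lemma selfadjoint_inverse_minus_id:
  assumes sym: "\<And>f g. ip (R f) g = ip f (R g)"
    and add: "\<And>f g. R (f + g) = R f + R g"
    and dense: "closure (range R) = UNIV" and inj: "inj R"
  shows "selfadjoint scaleC ip (range R) (\<lambda>x. inv R x - x)"
proof -
  \<comment> \<open>Symmetry for a complex inner product forces complex homogeneity. This matters
    because \<open>bounded_linear\<close> only provides real linearity of the limit operator to
    which the lemma is applied.\<close>
  have hom: "R (scaleC a x) = scaleC a (R x)" for a x
    by (rule ip_eqI) (simp only: sym ip_scaleC_left)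
  have inv: "inv R (R f) = f" for f using inj by simp
  have "module.subspace scaleC (range R)"
    unfolding subspace_def
  proof (intro conjI ballI allI)
    have "R 0 = 0" using add[of 0 0] by simp
    thus "0 \<in> range R" by (metis rangeI)
    show "x + y \<in> range R" if "x \<in> range R" "y \<in> range R" for x y
      using that by (auto simp flip: add)
    show "scaleC c x \<in> range R" if "x \<in> range R" for c x
      using that by (auto simp flip: hom)
  qed
  moreover have "adjoint_graph ip (range R) (\<lambda>x. inv R x - x) = op_graph (range R) (\<lambda>x. inv R x - x)"
  proof (intro set_eqI iffI; clarify)
    fix y z assume "(y, z) \<in> adjoint_graph ip (range R) (\<lambda>x. inv R x - x)"
    hence "ip (inv R (R f) - R f) y = ip (R f) z" for f
      unfolding adjoint_graph_def by blast
    hence *: "ip f y - ip (R f) y = ip (R f) z" for f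
      by (simp only: inv ip_minus_left)
    have "ip f y = ip f (R (y + z))" for f
      using *[of f] by (simp add: ip_add_right algebra_simps flip: sym)
    hence y: "y = R (y + z)" by (rule ip_eqI_right)
    moreover have "inv R y - y = z" using inv[of "y + z"] by (simp flip: y)
    ultimately show "(y, z) \<in> op_graph (range R) (\<lambda>x. inv R x - x)"
      unfolding op_graph_def by (metis (no_types, lifting) image_eqI rangeI)
  next
    fix y z assume "(y, z) \<in> op_graph (range R) (\<lambda>x. inv R x - x)"
    then obtain g where "y = R g" "z = g - R g" by (auto simp: op_graph_def inv)
    thus "(y, z) \<in> adjoint_graph ip (range R) (\<lambda>x. inv R x - x)"
      by (auto simp: adjoint_graph_def inv ip_minus_left ip_minus_right simp flip: sym)
  qed
  moreover have "inv R (x + y) - (x + y) = inv R x - x + (inv R y - y)"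
    if "x \<in> range R" "y \<in> range R" for x y
  proof -
    from that obtain f g where "x = R f" "y = R g" by auto
    thus ?thesis using inv[of "f + g"] by (simp add: inv add)
  qed
  moreover have "inv R (scaleC a x) - scaleC a x = scaleC a (inv R x - x)"
    if "x \<in> range R" for a x
  proof -
    from that obtain f where "x = R f" by auto
    thus ?thesis using inv[of "scaleC a f"] by (simp add: inv hom scale_right_diff_distrib)
  qed
  ultimately show ?thesis
    unfolding selfadjoint_def using dense by blast
qed

end

lemma is_resolvent_graph:
  assumes "is_resolvent G R" "(x, y) \<in> G"
  shows "R (x + y) = x"
proof -
  obtain D T where DT: "op_graph D T = closure G" "\<And>x. x \<in> D \<Longrightarrow> R (x + T x) = x"
    using assms(1) unfolding is_resolvent_def by auto
  have "(x, y) \<in> op_graph D T" using assms(2) closure_subset DT(1) by auto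
  thus ?thesis using DT(2) by (auto simp: op_graph_def)
qed

text \<open>\<open>I + T\<close> is onto and the graph of \<open>T\<close> is the closure of
  \<open>G\<close>, so every \<open>f\<close> is a limit of sums \<open>x + y\<close> with
  \<open>(x, y)\<close> in \<open>G\<close> itself. Estimates for the resolvent can therefore be
  checked on smooth functions.\<close>

lemma is_resolvent_dense:
  assumes "is_resolvent G R"
  obtains x y where "\<And>k::nat. (x k, y k) \<in> G" "(\<lambda>k. x k + y k) \<longlonglongrightarrow> f"
proof -
  obtain D T where DT: "op_graph D T = closure G" "\<And>f. R f \<in> D \<and> R f + T (R f) = f"
    using assms unfolding is_resolvent_def by auto
  have "(R f, T (R f)) \<in> closure G" using DT by (auto simp: op_graph_def simp flip: DT(1))
  then obtain s where s: "\<And>k. s k \<in> G" "s \<longlonglongrightarrow> (R f, T (R f))"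
    unfolding closure_sequential by blast
  have "(\<lambda>k. fst (s k) + snd (s k)) \<longlonglongrightarrow> R f + T (R f)"
    using s(2) by (metis fst_conv snd_conv tendsto_add tendsto_fst tendsto_snd)
  with s(1) that[of "fst \<circ> s" "snd \<circ> s"] DT(2) show thesis by simp
qed

context complex_hilbert_space
begin

text \<open>For \<open>f = x + y\<close> with \<open>(x, y)\<close> in the graph,
  \<open>R f = x\<close> and \<open>f - R f = y\<close>. Thus an error that is small relative to
  \<open>norm y\<close> becomes a bound in terms of \<open>f\<close> and \<open>R f\<close> alone,
  and such a bound passes to limits of graph elements. Here \<open>b'\<close> is the operator whose
  resolvent is \<open>R\<close>, and \<open>b\<close> the nearby one that is symmetric.\<close>

lemma resolvent_almost_symmetric:
  assumes res: "is_resolvent ((\<lambda>\<xi>. (a \<xi>, b' \<xi>)) ` V) R"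
    and close: "\<And>\<xi>. \<xi> \<in> V \<Longrightarrow> norm (b' \<xi> - b \<xi>) \<le> \<epsilon> * norm (b' \<xi>)"
    and sym: "\<And>\<xi> \<eta>. \<xi> \<in> V \<Longrightarrow> \<eta> \<in> V \<Longrightarrow> ip (b \<xi>) (a \<eta>) = ip (a \<xi>) (b \<eta>)"
  shows "cmod (ip (R f) g - ip f (R g)) \<le> \<epsilon> * (norm (R f) * norm (g - R g) + norm (f - R f) * norm (R g))"
proof -
  let ?G = "(\<lambda>\<xi>. (a \<xi>, b' \<xi>)) ` V"
  have R: "bounded_linear R" using res by (simp add: is_resolvent_def)
  have core: "cmod (ip (R (x+y)) (x'+y') - ip (x+y) (R (x'+y')))
      \<le> \<epsilon> * (norm (R (x+y)) * norm ((x'+y') - R (x'+y')) + norm ((x+y) - R (x+y)) * norm (R (x'+y')))"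
    if G: "(x, y) \<in> ?G" "(x', y') \<in> ?G" for x y x' y'
  proof -
    obtain \<xi> \<eta> where *: "\<xi> \<in> V" "\<eta> \<in> V" "x = a \<xi>" "y = b' \<xi>" "x' = a \<eta>" "y' = b' \<eta>"
      using G by auto
    \<comment> \<open>The terms \<open>ip x x'\<close> cancel, and symmetry of \<open>b\<close>
      allows \<open>b \<eta>\<close> and \<open>b \<xi>\<close> to be subtracted at no cost.\<close>
    have "ip x (x' + y') - ip (x + y) x' = ip x (y' - b \<eta>) - ip (y - b \<xi>) x'"
      using sym[OF *(1,2)] by (simp add: * ip_add_left ip_add_right ip_minus_left ip_minus_right)
    also have "cmod \<dots> \<le> norm x * norm (y' - b \<eta>) + norm (y - b \<xi>) * norm x'"
      by (meson add_mono ip_cauchy_schwarz norm_triangle_ineq4 order_trans)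
    also have "\<dots> \<le> norm x * (\<epsilon> * norm y') + (\<epsilon> * norm y) * norm x'"
      by (intro add_mono mult_left_mono mult_right_mono) (auto simp: * close)
    finally show ?thesis
      using is_resolvent_graph[OF res G(1)] is_resolvent_graph[OF res G(2)]
      by (simp add: algebra_simps)
  qed
  obtain x y where xy: "\<And>k::nat. (x k, y k) \<in> ?G" "(\<lambda>k. x k + y k) \<longlonglongrightarrow> f"
    using is_resolvent_dense[OF res] by metis
  obtain x' y' where xy': "\<And>k::nat. (x' k, y' k) \<in> ?G" "(\<lambda>k. x' k + y' k) \<longlonglongrightarrow> g"
    using is_resolvent_dense[OF res] by metis
  note RL = bounded_linear.tendsto[OF R]
  show ?thesis
  proof (rule LIMSEQ_le)
    show "(\<lambda>k. cmod (ip (R (x k+y k)) (x' k+y' k) - ip (x k+y k) (R (x' k+y' k))))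
        \<longlonglongrightarrow> cmod (ip (R f) g - ip f (R g))"
      by (intro tendsto_norm tendsto_diff tendsto_ip RL xy(2) xy'(2))
    show "(\<lambda>k. \<epsilon> * (norm (R (x k+y k)) * norm ((x' k+y' k) - R (x' k+y' k))
        + norm ((x k+y k) - R (x k+y k)) * norm (R (x' k+y' k))))
      \<longlonglongrightarrow> \<epsilon> * (norm (R f) * norm (g - R g) + norm (f - R f) * norm (R g))"
      by (intro tendsto_mult tendsto_add tendsto_const tendsto_norm tendsto_diff RL xy(2) xy'(2))
  qed (use core[OF xy(1) xy'(1)] in blast)
qed

text \<open>The abstract core. In the application \<open>a\<close> embeds the smooth functions,
  \<open>b' n\<close> are the Laplacians of the approximating metrics and \<open>b\<close> is that
  of the limit metric. The bound \<open>close\<close>, uniform over \<open>V\<close>, yields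
  symmetry of \<open>S\<close>; the pointwise limit \<open>conv\<close> yields
  \<open>S (a \<xi> + b \<xi>) = a \<xi>\<close>.\<close>

theorem maximal_selfadjoint_resolvent_limit:
  assumes dense: "closure (a ` V) = UNIV"
    and res: "\<And>n::nat. is_resolvent ((\<lambda>\<xi>. (a \<xi>, b' n \<xi>)) ` V) (R n)"
    and close: "\<And>e. e > 0 \<Longrightarrow>
      \<forall>\<^sub>F n in sequentially. \<forall>\<xi>\<in>V. norm (b' n \<xi> - b \<xi>) \<le> e * norm (b' n \<xi>)"
    and conv: "\<And>\<xi>. \<xi> \<in> V \<Longrightarrow> (\<lambda>n. b' n \<xi>) \<longlonglongrightarrow> b \<xi>"
    and sym: "\<And>\<xi> \<eta>. \<xi> \<in> V \<Longrightarrow> \<eta> \<in> V \<Longrightarrow> ip (b \<xi>) (a \<eta>) = ip (a \<xi>) (b \<eta>)"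
    and S: "bounded_linear S" and lim: "(\<lambda>n. onorm (\<lambda>x. R n x - S x)) \<longlonglongrightarrow> 0"
  shows "\<exists>\<Delta>. (\<lambda>\<xi>. (a \<xi>, b \<xi>)) ` V \<subseteq> op_graph (range S) \<Delta> \<and>
    maximal_selfadjoint scaleC ip (range S) \<Delta> \<and>
    bij_betw (\<lambda>x. x + \<Delta> x) (range S) UNIV \<and>
    (\<forall>f. S f + \<Delta> (S f) = f) \<and> (\<forall>x\<in>range S. S (x + \<Delta> x) = x)"
proof -
  have diff: "norm (R n x - S x) \<le> onorm (\<lambda>x. R n x - S x) * norm x" for n x
    using onorm[OF bounded_linear_sub[OF _ S], of "R n" x] res by (simp add: is_resolvent_def)
  \<comment> \<open>Convergence in operator norm lets the argument move with \<open>n\<close>. This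
    is used for \<open>a \<xi> + b' n \<xi>\<close>, on which \<open>R n\<close> is known
    explicitly.\<close>
  have RS: "(\<lambda>n. R n (x n)) \<longlonglongrightarrow> S y" if x: "x \<longlonglongrightarrow> y" for x y
  proof -
    have "(\<lambda>n. onorm (\<lambda>x. R n x - S x) * norm (x n)) \<longlonglongrightarrow> 0 * norm y"
      by (intro tendsto_mult lim tendsto_norm x)
    hence "(\<lambda>n. R n (x n) - S (x n)) \<longlonglongrightarrow> 0"
      by (intro tendsto_0_le[where K=1 and g="\<lambda>n. R n (x n) - S (x n)"
            and f="\<lambda>n. onorm (\<lambda>x. R n x - S x) * norm (x n)"])
        (auto intro!: always_eventually order_trans[OF diff])
    from tendsto_add[OF this bounded_linear.tendsto[OF S x]] show ?thesis by simp
  qed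
  have symS: "ip (S f) g = ip f (S g)" for f g
  proof -
    \<comment> \<open>The limit in \<open>n\<close> of the factor of the error in the
      almost-symmetry bound. It does not depend on \<open>e\<close>, so \<open>e\<close> can be sent
      to 0 afterwards.\<close>
    define C where "C = norm (S f) * norm (g - S g) + norm (f - S f) * norm (S g)"
    have "cmod (ip (S f) g - ip f (S g)) \<le> e * C" if "e > 0" for e
    proof (rule tendsto_le[OF sequentially_bot])
      show "(\<lambda>n. cmod (ip (R n f) g - ip f (R n g))) \<longlonglongrightarrow> cmod (ip (S f) g - ip f (S g))"
        by (intro tendsto_norm tendsto_diff tendsto_ip RS tendsto_const)
      show "(\<lambda>n. e * (norm (R n f) * norm (g - R n g) + norm (f - R n f) * norm (R n g))) \<longlonglongrightarrow> e * C"
        unfolding C_def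
        by (intro tendsto_mult tendsto_add tendsto_const tendsto_norm tendsto_diff RS)
      show "\<forall>\<^sub>F n in sequentially. cmod (ip (R n f) g - ip f (R n g))
          \<le> e * (norm (R n f) * norm (g - R n g) + norm (f - R n f) * norm (R n g))"
        using close[OF that] by eventually_elim (rule resolvent_almost_symmetric[OF res _ sym], auto)
    qed
    from this[of "1 / real (Suc m)" for m]
    have "cmod (ip (S f) g - ip f (S g)) \<le> 1 / real (Suc m) * C" for m by (simp del: of_nat_Suc)
    moreover have "(\<lambda>m. 1 / real (Suc m) * C) \<longlonglongrightarrow> 0 * C"
      using LIMSEQ_inverse_real_of_nat by (intro tendsto_mult tendsto_const) (simp add: inverse_eq_divide)
    ultimately have "cmod (ip (S f) g - ip f (S g)) \<le> 0 * C"
      by (meson LIMSEQ_le_const)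
    thus ?thesis by simp
  qed
  have Sgraph: "S (a \<xi> + b \<xi>) = a \<xi>" if "\<xi> \<in> V" for \<xi>
  proof -
    have "(\<lambda>n. a \<xi> + b' n \<xi>) \<longlonglongrightarrow> a \<xi> + b \<xi>"
      by (intro tendsto_intros conv that)
    from RS[OF this] have "(\<lambda>n. R n (a \<xi> + b' n \<xi>)) \<longlonglongrightarrow> S (a \<xi> + b \<xi>)" .
    moreover have "R n (a \<xi> + b' n \<xi>) = a \<xi>" for n
      using is_resolvent_graph[OF res] that by auto
    ultimately show ?thesis by (simp add: LIMSEQ_const_iff)
  qed
  have "a ` V \<subseteq> range S" using Sgraph by (metis image_subset_iff rangeI)
  hence denseS: "closure (range S) = UNIV" using dense closure_mono by blast
  have add: "S (f + g) = S f + S g" for f g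
    using S by (simp add: bounded_linear.linear linear_add)
  \<comment> \<open>If \<open>S x = S y\<close>, symmetry makes \<open>x - y\<close> orthogonal to
    the range of \<open>S\<close>, which is dense.\<close>
  have inj: "inj S"
  proof (rule injI)
    fix x y assume "S x = S y"
    have "ip (x - y) g = 0" for g
    proof -
      obtain s where s: "\<And>k. s k \<in> range S" "s \<longlonglongrightarrow> g"
        using denseS unfolding closure_sequential[symmetric] by (metis UNIV_I closure_sequential)
      have "ip (x - y) (s k) = 0" for k
        using s(1)[of k] \<open>S x = S y\<close> by (auto simp: ip_minus_left simp flip: symS)
      moreover have "(\<lambda>k. ip (x - y) (s k)) \<longlonglongrightarrow> ip (x - y) g"
        by (intro tendsto_ip tendsto_const s)
      ultimately show ?thesis by (simp add: LIMSEQ_const_iff)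
    qed
    hence "x - y = 0" by (intro ip_eqI) simp
    thus "x = y" by simp
  qed
  have inv: "inv S (S f) = f" for f using inj by simp
  let ?D = "\<lambda>x. inv S x - x"
  have "selfadjoint scaleC ip (range S) ?D"
    by (rule selfadjoint_inverse_minus_id[OF symS add denseS inj])
  moreover have "(\<lambda>\<xi>. (a \<xi>, b \<xi>)) ` V \<subseteq> op_graph (range S) ?D"
  proof clarify
    fix \<xi> assume "\<xi> \<in> V"
    note * = Sgraph[OF this]
    have "?D (a \<xi>) = b \<xi>" using inv[of "a \<xi> + b \<xi>"] * by simp
    thus "(a \<xi>, b \<xi>) \<in> op_graph (range S) ?D"
      unfolding op_graph_def using * by (metis (no_types, lifting) image_eqI rangeI)
  qed
  moreover have "bij_betw (\<lambda>x. x + ?D x) (range S) UNIV"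
    using inj by (simp add: bij_betw_def inj_on_def inv image_image)
  ultimately show ?thesis
    using selfadjoint_imp_maximal by (intro exI[of _ ?D]) (auto simp: inv)
qed

end

section \<open>Calculus of smooth functions\<close>

lemma frechet_derivative_eqI:
  "(f has_derivative f') (at x) \<Longrightarrow> frechet_derivative f (at x) = f'"
  using frechet_derivative_at by metis

lemma frechet_derivative_cong_open:
  assumes "open S" "x \<in> S" "\<And>y. y \<in> S \<Longrightarrow> f y = g y"
  shows "frechet_derivative f (at x) = frechet_derivative g (at x)"
proof -
  have "(f has_derivative D) (at x) \<longleftrightarrow> (g has_derivative D) (at x)" for D
    using assms has_derivative_transform_within_open[of f D x UNIV S g]
      has_derivative_transform_within_open[of g D x UNIV S f] by metis
  thus ?thesis by (simp add: frechet_derivative_def)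
qed

lemma differentiable_cong_open:
  assumes "open S" "x \<in> S" "\<And>y. y \<in> S \<Longrightarrow> f y = g y"
  shows "f differentiable (at x) \<longleftrightarrow> g differentiable (at x)"
  using assms has_derivative_transform_within_open[of f _ x UNIV S g]
      has_derivative_transform_within_open[of g _ x UNIV S f] unfolding differentiable_def by metis

lemma Ck_on_cong_open:
  assumes "open S" "\<And>x. x \<in> S \<Longrightarrow> f x = g x"
  shows "Ck_on k S f \<longleftrightarrow> Ck_on k S g"
  using assms(2)
proof (induction k arbitrary: f g)
  case 0 thus ?case using continuous_on_cong[OF refl, of S f g] by simp
next
  case (Suc k)
  have "Ck_on k S (\<lambda>x. frechet_derivative f (at x) v) = Ck_on k S (\<lambda>x. frechet_derivative g (at x) v)" for v
  proof (rule Suc.IH)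
    show "frechet_derivative f (at x) v = frechet_derivative g (at x) v" if "x \<in> S" for x
      using frechet_derivative_cong_open[OF assms(1) that, of f g] Suc.prems by simp
  qed
  moreover have "f differentiable (at x) \<longleftrightarrow> g differentiable (at x)" if "x \<in> S" for x
    using differentiable_cong_open[OF assms(1) that, of f g] Suc.prems by blast
  ultimately show ?case by simp
qed

text \<open>\<open>Ck_on\<close> is phrased with \<open>frechet_derivative\<close>, a choice of
  derivative. On an open set any pointwise derivative may be used instead, which supplies the
  induction step of the closure rules below.\<close>

lemma Ck_on_SucI:
  assumes "open S" "\<And>x. x \<in> S \<Longrightarrow> (f has_derivative f' x) (at x)" "\<And>v. Ck_on k S (\<lambda>x. f' x v)"
  shows "Ck_on (Suc k) S f"
proof -
  have "Ck_on k S (\<lambda>x. frechet_derivative f (at x) v)" for v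
    using Ck_on_cong_open[OF assms(1), of "\<lambda>x. frechet_derivative f (at x) v" "\<lambda>x. f' x v"]
      assms(3) frechet_derivative_eqI[OF assms(2)] by simp
  thus ?thesis using assms(2) by (auto simp: differentiable_def)
qed

lemma Ck_on_Suc_has_derivative:
  "Ck_on (Suc k) S f \<Longrightarrow> x \<in> S \<Longrightarrow> (f has_derivative frechet_derivative f (at x)) (at x)"
  by (simp add: frechet_derivative_works)

lemma Ck_on_SucD: "Ck_on (Suc k) S f \<Longrightarrow> Ck_on k S f"
proof (induction k arbitrary: f)
  case 0 thus ?case
    by (auto intro!: continuous_at_imp_continuous_on differentiable_imp_continuous_within)
qed auto

lemma Ck_on_imp_continuous_on: "Ck_on k S f \<Longrightarrow> continuous_on S f"
  by (induction k) (simp, metis Ck_on_SucD)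

lemma Ck_on_subset: "Ck_on k S f \<Longrightarrow> T \<subseteq> S \<Longrightarrow> Ck_on k T f"
  by (induction k arbitrary: f) (auto intro: continuous_on_subset)

lemma Ck_on_local:
  assumes "\<And>x. x \<in> S \<Longrightarrow> \<exists>T. open T \<and> x \<in> T \<and> Ck_on k T f"
  shows "Ck_on k S f"
  using assms
proof (induction k arbitrary: f)
  case 0
  show ?case using 0
    by (auto intro!: continuous_at_imp_continuous_on) (meson continuous_on_eq_continuous_at)
next
  case (Suc k)
  show ?case unfolding Ck_on.simps
  proof (intro conjI ballI allI)
    fix v show "Ck_on k S (\<lambda>x. frechet_derivative f (at x) v)"
      by (rule Suc.IH) (use Suc.prems in fastforce)
  qed (use Suc.prems in fastforce)
qed

lemma Ck_on_const: "Ck_on k S (\<lambda>_. c)"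
  by (induction k arbitrary: c) (auto simp: frechet_derivative_const)

lemma Ck_on_linear:
  assumes L: "bounded_linear L" and S: "open S" and f: "Ck_on k S f"
  shows "Ck_on k S (\<lambda>x. L (f x))"
  using f
proof (induction k arbitrary: f)
  case 0 thus ?case using bounded_linear.continuous_on[OF L] by simp
next
  case (Suc k)
  show ?case
    by (rule Ck_on_SucI[OF S bounded_linear.has_derivative[OF L Ck_on_Suc_has_derivative]])
      (use Suc in auto)
qed

lemma Ck_on_add:
  assumes S: "open S" and "Ck_on k S f" "Ck_on k S g"
  shows "Ck_on k S (\<lambda>x. f x + g x)"
  using assms(2,3)
proof (induction k arbitrary: f g)
  case 0 thus ?case by (simp add: continuous_on_add)
next
  case (Suc k)
  show ?case
    by (rule Ck_on_SucI[OF S has_derivative_add[OF Ck_on_Suc_has_derivative Ck_on_Suc_has_derivative]])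
      (use Suc in auto)
qed

lemma Ck_on_bilinear:
  assumes B: "bounded_bilinear B" and S: "open S" and f: "Ck_on k S f" and g: "Ck_on k S g"
  shows "Ck_on k S (\<lambda>x. B (f x) (g x))"
  using f g
proof (induction k arbitrary: f g)
  case 0 thus ?case using bounded_bilinear.continuous_on[OF B] by simp
next
  case (Suc k)
  show ?case
    by (rule Ck_on_SucI[OF S bounded_bilinear.FDERIV[OF B Ck_on_Suc_has_derivative Ck_on_Suc_has_derivative]])
      (use Suc Ck_on_SucD[OF Suc.prems(1)] Ck_on_SucD[OF Suc.prems(2)] in \<open>auto intro!: Ck_on_add[OF S] Suc.IH\<close>)
qed

lemma Ck_on_inverse:
  fixes f :: "'a::real_normed_vector \<Rightarrow> 'b::real_normed_div_algebra"
  assumes S: "open S" and f: "Ck_on k S f" and nz: "\<And>x. x \<in> S \<Longrightarrow> f x \<noteq> 0"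
  shows "Ck_on k S (\<lambda>x. inverse (f x))"
  using f
proof (induction k)
  case 0 thus ?case using nz by (auto intro!: continuous_on_inverse)
next
  case (Suc k)
  note inv = Suc.IH[OF Ck_on_SucD[OF Suc.prems]]
  have "Ck_on k S (\<lambda>x. - (inverse (f x) * frechet_derivative f (at x) v * inverse (f x)))" for v
    by (intro Ck_on_linear[OF bounded_linear_minus[OF bounded_linear_ident] S]
        Ck_on_bilinear[OF bounded_bilinear_mult S] inv) (use Suc.prems in auto)
  thus ?case
    using Ck_on_SucI[OF S Deriv.has_derivative_inverse[OF nz Ck_on_Suc_has_derivative[OF Suc.prems]]] by blast
qed

text \<open>With a real inner function the derivative of \<open>\<rho>\<close> is determined by its
  value at 1, so the chain rule is a \<open>scaleR\<close> product and the induction closes with the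
  bilinear rule.\<close>

lemma Ck_on_compose_real:
  fixes g :: "'a::real_normed_vector \<Rightarrow> real" and \<rho> :: "real \<Rightarrow> 'b::real_normed_vector"
  assumes S: "open S" and g: "Ck_on k S g" and \<rho>: "Ck_on k T \<rho>" and T: "g ` S \<subseteq> T"
  shows "Ck_on k S (\<lambda>x. \<rho> (g x))"
  using g \<rho>
proof (induction k arbitrary: \<rho>)
  case 0 thus ?case using T by (auto intro!: continuous_on_compose2[of T \<rho> S g])
next
  case (Suc k)
  have der: "((\<lambda>x. \<rho> (g x)) has_derivative
      (\<lambda>v. frechet_derivative g (at x) v *\<^sub>R frechet_derivative \<rho> (at (g x)) 1)) (at x)" if "x \<in> S" for x
  proof -
    have "g x \<in> T" using that T by auto
    note D = Ck_on_Suc_has_derivative[OF Suc.prems(2) this]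
    have "linear (frechet_derivative \<rho> (at (g x)))" using D has_derivative_linear by blast
    hence "frechet_derivative \<rho> (at (g x)) t = t *\<^sub>R frechet_derivative \<rho> (at (g x)) 1" for t
      using linear_cmul[of "frechet_derivative \<rho> (at (g x))" t 1] by simp
    hence "(\<lambda>v. frechet_derivative g (at x) v *\<^sub>R frechet_derivative \<rho> (at (g x)) 1)
        = (\<lambda>v. frechet_derivative \<rho> (at (g x)) (frechet_derivative g (at x) v))" by metis
    thus ?thesis
      using has_derivative_compose[OF Ck_on_Suc_has_derivative[OF Suc.prems(1) that] D] by (simp only:)
  qed
  show ?case
    by (rule Ck_on_SucI[OF S der])
      (use Suc.IH[OF Ck_on_SucD[OF Suc.prems(1)], of "\<lambda>t. frechet_derivative \<rho> (at t) 1"] Suc.prems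
        in \<open>auto intro!: Ck_on_bilinear[OF bounded_bilinear_scaleR S]\<close>)
qed

text \<open>The derivative in direction \<open>v\<close> is \<open>deriv f x * v\<close>, which is
  again holomorphic in \<open>x\<close>.\<close>

lemma holomorphic_imp_Ck_on:
  assumes S: "open S" and f: "f holomorphic_on S"
  shows "Ck_on k S f"
  using f
proof (induction k arbitrary: f)
  case 0 thus ?case by (simp add: holomorphic_on_imp_continuous_on)
next
  case (Suc k)
  have "(f has_derivative (\<lambda>v. deriv f x * v)) (at x)" if "x \<in> S" for x
    using holomorphic_derivI[OF Suc.prems S that] has_field_derivative_imp_has_derivative by blast
  thus ?case
    by (rule Ck_on_SucI[OF S]) (auto intro!: Suc.IH holomorphic_intros Suc.prems S)
qed

text \<open>The gluing principle behind extension by zero, bump functions, and metrics whose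
  definition involves a frame chosen separately at each point.\<close>

lemma smooth_on_local:
  "(\<And>x. x \<in> S \<Longrightarrow> \<exists>T. open T \<and> x \<in> T \<and> smooth_on T f) \<Longrightarrow> smooth_on S f"
  unfolding smooth_on_def by (metis Ck_on_local)

lemma smooth_on_subset: "smooth_on S f \<Longrightarrow> T \<subseteq> S \<Longrightarrow> smooth_on T f"
  unfolding smooth_on_def by (metis Ck_on_subset)

lemma smooth_on_cong_open:
  "open S \<Longrightarrow> (\<And>x. x \<in> S \<Longrightarrow> f x = g x) \<Longrightarrow> smooth_on S f \<longleftrightarrow> smooth_on S g"
  unfolding smooth_on_def by (metis Ck_on_cong_open)

lemma smooth_on_const: "smooth_on S (\<lambda>_. c)"
  by (simp add: smooth_on_def Ck_on_const)

lemma smooth_on_linear: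
  "bounded_linear L \<Longrightarrow> open S \<Longrightarrow> smooth_on S f \<Longrightarrow> smooth_on S (\<lambda>x. L (f x))"
  by (simp add: smooth_on_def Ck_on_linear)

lemma smooth_on_add:
  "open S \<Longrightarrow> smooth_on S f \<Longrightarrow> smooth_on S g \<Longrightarrow> smooth_on S (\<lambda>x. f x + g x)"
  by (simp add: smooth_on_def Ck_on_add)

lemma smooth_on_mult:
  fixes f g :: "'a::real_normed_vector \<Rightarrow> 'b::real_normed_algebra"
  shows "open S \<Longrightarrow> smooth_on S f \<Longrightarrow> smooth_on S g \<Longrightarrow> smooth_on S (\<lambda>x. f x * g x)"
  by (simp add: smooth_on_def Ck_on_bilinear bounded_bilinear_mult)

lemma smooth_on_minus:
  "open S \<Longrightarrow> smooth_on S f \<Longrightarrow> smooth_on S (\<lambda>x. - f x)"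
  by (rule smooth_on_linear[OF bounded_linear_minus[OF bounded_linear_ident]])

lemma smooth_on_diff:
  "open S \<Longrightarrow> smooth_on S f \<Longrightarrow> smooth_on S g \<Longrightarrow> smooth_on S (\<lambda>x. f x - g x)"
  using smooth_on_add[OF _ _ smooth_on_minus, of S f g] by simp

lemma smooth_on_inverse:
  fixes f :: "'a::real_normed_vector \<Rightarrow> 'b::real_normed_div_algebra"
  shows "open S \<Longrightarrow> smooth_on S f \<Longrightarrow> (\<And>x. x \<in> S \<Longrightarrow> f x \<noteq> 0) \<Longrightarrow> smooth_on S (\<lambda>x. inverse (f x))"
  by (simp add: smooth_on_def Ck_on_inverse)

lemma smooth_on_compose_real:
  fixes g :: "'a::real_normed_vector \<Rightarrow> real"
  shows "open S \<Longrightarrow> smooth_on S g \<Longrightarrow> smooth_on UNIV \<rho> \<Longrightarrow> smooth_on S (\<lambda>x. \<rho> (g x))"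
  by (simp add: smooth_on_def Ck_on_compose_real[where T=UNIV])

lemma holomorphic_imp_smooth_on: "open S \<Longrightarrow> f holomorphic_on S \<Longrightarrow> smooth_on S f"
  by (simp add: smooth_on_def holomorphic_imp_Ck_on)

lemma smooth_on_cmod_power2:
  assumes "open S" "smooth_on S f"
  shows "smooth_on S (\<lambda>x. (cmod (f x))\<^sup>2)"
  unfolding cmod_power2 unfolding power2_eq_square
  by (intro smooth_on_add smooth_on_mult smooth_on_linear[OF bounded_linear_Re]
      smooth_on_linear[OF bounded_linear_Im] assms)

lemma smooth_on_derivative:
  "smooth_on S f \<Longrightarrow> smooth_on S (\<lambda>x. frechet_derivative f (at x) v)"
  unfolding smooth_on_def by (metis Ck_on.simps(2))

lemma smooth_on_has_derivative:
  "smooth_on S f \<Longrightarrow> x \<in> S \<Longrightarrow> (f has_derivative frechet_derivative f (at x)) (at x)"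
  unfolding smooth_on_def by (metis Ck_on_Suc_has_derivative)

lemma smooth_on_imp_continuous_on: "smooth_on S f \<Longrightarrow> continuous_on S f"
  unfolding smooth_on_def by (metis Ck_on.simps(1))

lemma smooth_on_d_zbar: "open S \<Longrightarrow> smooth_on S f \<Longrightarrow> smooth_on S (d_zbar f)"
  unfolding d_zbar_def[abs_def] divide_inverse
  by (intro smooth_on_mult smooth_on_add smooth_on_const smooth_on_derivative)

lemma smooth_on_d_z: "open S \<Longrightarrow> smooth_on S f \<Longrightarrow> smooth_on S (d_z f)"
  unfolding d_z_def[abs_def] divide_inverse
  by (intro smooth_on_mult smooth_on_diff smooth_on_const smooth_on_derivative)

lemma smooth_on_d_z_zbar: "open S \<Longrightarrow> smooth_on S f \<Longrightarrow> smooth_on S (d_z_zbar f)"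
  unfolding d_z_zbar_def by (intro smooth_on_d_z smooth_on_d_zbar)

section \<open>Wirtinger derivatives\<close>

lemma differentiable_wirtinger:
  assumes "f differentiable (at z)"
  shows "(f has_derivative (\<lambda>h. d_z f z * h + d_zbar f z * cnj h)) (at z)"
proof -
  let ?D = "frechet_derivative f (at z)"
  have D: "(f has_derivative ?D) (at z)" using assms by (simp add: frechet_derivative_works)
  have lin: "linear ?D" using D has_derivative_linear by blast
  have "?D h = d_z f z * h + d_zbar f z * cnj h" for h
  proof -
    have "?D h = ?D (Re h *\<^sub>R 1 + Im h *\<^sub>R \<i>)"
      by (rule arg_cong[of _ _ ?D]) (simp add: complex_eq_iff)
    also have "\<dots> = Re h *\<^sub>R ?D 1 + Im h *\<^sub>R ?D \<i>"
      by (simp only: linear_add[OF lin] linear_cmul[OF lin])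
    also have "\<dots> = d_z f z * h + d_zbar f z * cnj h"
      unfolding d_z_def d_zbar_def by (simp add: complex_eq_iff algebra_simps) (simp add: field_simps)
    finally show ?thesis .
  qed
  hence "?D = (\<lambda>h. d_z f z * h + d_zbar f z * cnj h)" by blast
  with D show ?thesis by metis
qed

text \<open>The coefficients of \<open>h\<close> and \<open>cnj h\<close> in a real-linear map are
  unique. Each rule below brings the derivative into this form and reads them off.\<close>

lemma wirtinger_eqI:
  assumes "(f has_derivative (\<lambda>h. a * h + b * cnj h)) (at z)"
  shows "d_z f z = a" "d_zbar f z = b"
  unfolding d_z_def d_zbar_def frechet_derivative_eqI[OF assms] by (simp_all add: algebra_simps)

lemma wirtinger_cong_open:
  assumes "open S" "z \<in> S" "\<And>y. y \<in> S \<Longrightarrow> f y = g y"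
  shows "d_z f z = d_z g z" "d_zbar f z = d_zbar g z"
  unfolding d_z_def d_zbar_def using frechet_derivative_cong_open[OF assms] by simp_all

lemma d_z_zbar_cong_open:
  assumes "open S" "z \<in> S" "\<And>y. y \<in> S \<Longrightarrow> f y = g y"
  shows "d_z_zbar f z = d_z_zbar g z"
  unfolding d_z_zbar_def
  by (rule wirtinger_cong_open(1)[OF assms(1,2)]) (rule wirtinger_cong_open(2)[OF assms(1) _ assms(3)])

lemma wirtinger_mult:
  assumes "f differentiable (at z)" "g differentiable (at z)"
  shows "d_z (\<lambda>w. f w * g w) z = d_z f z * g z + f z * d_z g z"
    and "d_zbar (\<lambda>w. f w * g w) z = d_zbar f z * g z + f z * d_zbar g z"
proof -
  have "((\<lambda>w. f w * g w) has_derivative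
      (\<lambda>h. (d_z f z * g z + f z * d_z g z) * h + (d_zbar f z * g z + f z * d_zbar g z) * cnj h)) (at z)"
    by (rule has_derivative_eq_rhs[OF has_derivative_mult[OF assms[THEN differentiable_wirtinger]]])
      (simp add: fun_eq_iff algebra_simps)
  from wirtinger_eqI[OF this]
  show "d_z (\<lambda>w. f w * g w) z = d_z f z * g z + f z * d_z g z"
    and "d_zbar (\<lambda>w. f w * g w) z = d_zbar f z * g z + f z * d_zbar g z" by blast+
qed

lemma wirtinger_cnj:
  assumes "f differentiable (at z)"
  shows "d_z (\<lambda>w. cnj (f w)) z = cnj (d_zbar f z)" "d_zbar (\<lambda>w. cnj (f w)) z = cnj (d_z f z)"
proof -
  have "((\<lambda>w. cnj (f w)) has_derivative (\<lambda>h. cnj (d_zbar f z) * h + cnj (d_z f z) * cnj h)) (at z)"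
    by (rule has_derivative_eq_rhs[OF bounded_linear.has_derivative[OF bounded_linear_cnj
        differentiable_wirtinger[OF assms]]]) (simp add: fun_eq_iff algebra_simps)
  from wirtinger_eqI[OF this]
  show "d_z (\<lambda>w. cnj (f w)) z = cnj (d_zbar f z)" "d_zbar (\<lambda>w. cnj (f w)) z = cnj (d_z f z)" by blast+
qed

lemma wirtinger_holomorphic:
  assumes "(f has_field_derivative f') (at z)"
  shows "d_z f z = f'" "d_zbar f z = 0"
  using wirtinger_eqI[of f f' 0 z] assms by (simp_all add: has_field_derivative_def)

lemma wirtinger_compose_holomorphic:
  assumes "f differentiable (at (\<phi> z))" "(\<phi> has_field_derivative \<phi>') (at z)"
  shows "d_z (\<lambda>w. f (\<phi> w)) z = d_z f (\<phi> z) * \<phi>'" "d_zbar (\<lambda>w. f (\<phi> w)) z = d_zbar f (\<phi> z) * cnj \<phi>'"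
proof -
  have "((\<lambda>w. f (\<phi> w)) has_derivative (\<lambda>h. (d_z f (\<phi> z) * \<phi>') * h + (d_zbar f (\<phi> z) * cnj \<phi>') * cnj h)) (at z)"
    by (rule has_derivative_eq_rhs[OF has_derivative_compose[OF
            assms(2)[THEN has_field_derivative_imp_has_derivative] differentiable_wirtinger[OF assms(1)]]])
      (simp add: fun_eq_iff algebra_simps)
  from wirtinger_eqI[OF this]
  show "d_z (\<lambda>w. f (\<phi> w)) z = d_z f (\<phi> z) * \<phi>'" "d_zbar (\<lambda>w. f (\<phi> w)) z = d_zbar f (\<phi> z) * cnj \<phi>'"
    by blast+
qed

lemma smooth_on_differentiable: "smooth_on S f \<Longrightarrow> x \<in> S \<Longrightarrow> f differentiable (at x)"
  using smooth_on_has_derivative differentiable_def by blast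

lemma wirtinger_add:
  assumes "f differentiable (at z)" "g differentiable (at z)"
  shows "d_z (\<lambda>w. f w + g w) z = d_z f z + d_z g z"
    and "d_zbar (\<lambda>w. f w + g w) z = d_zbar f z + d_zbar g z"
proof -
  have "((\<lambda>w. f w + g w) has_derivative
      (\<lambda>h. (d_z f z + d_z g z) * h + (d_zbar f z + d_zbar g z) * cnj h)) (at z)"
    by (rule has_derivative_eq_rhs[OF has_derivative_add[OF assms[THEN differentiable_wirtinger]]])
      (simp add: fun_eq_iff algebra_simps)
  from wirtinger_eqI[OF this]
  show "d_z (\<lambda>w. f w + g w) z = d_z f z + d_z g z"
    and "d_zbar (\<lambda>w. f w + g w) z = d_zbar f z + d_zbar g z" by blast+
qed

lemma d_z_zbar_add:
  assumes S: "open S" "z \<in> S" and f: "smooth_on S f" and g: "smooth_on S g"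
  shows "d_z_zbar (\<lambda>w. f w + g w) z = d_z_zbar f z + d_z_zbar g z"
proof -
  have "d_z_zbar (\<lambda>w. f w + g w) z = d_z (\<lambda>w. d_zbar f w + d_zbar g w) z"
    unfolding d_z_zbar_def
    by (rule wirtinger_cong_open(1)[OF S], rule wirtinger_add(2)) (auto intro: smooth_on_differentiable f g)
  also have "\<dots> = d_z_zbar f z + d_z_zbar g z"
    unfolding d_z_zbar_def
    by (rule wirtinger_add(1)) (auto intro!: smooth_on_differentiable[OF smooth_on_d_zbar[OF S(1)] S(2)] f g)
  finally show ?thesis .
qed

text \<open>\<open>d_zbar\<close> produces the factor \<open>cnj (deriv \<phi>)\<close>, which
  \<open>d_z\<close> treats as a constant, and \<open>d_z\<close> itself contributes
  \<open>deriv \<phi>\<close>. The product \<open>(cmod (deriv \<phi> z))\<^sup>2\<close> is also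
  the factor by which a metric on the tangent bundle changes, which makes the Laplacian independent
  of the chart.\<close>

lemma d_z_zbar_compose_holomorphic:
  assumes S: "open S" "smooth_on S f" and T: "open T" "\<phi> holomorphic_on T" "\<phi> ` T \<subseteq> S" and z: "z \<in> T"
  shows "d_z_zbar (\<lambda>w. f (\<phi> w)) z = complex_of_real ((cmod (deriv \<phi> z))\<^sup>2) * d_z_zbar f (\<phi> z)"
proof -
  have \<phi>: "(\<phi> has_field_derivative deriv \<phi> w) (at w)" if "w \<in> T" for w
    using holomorphic_derivI[OF T(2,1) that] .
  have \<phi>S: "\<phi> w \<in> S" if "w \<in> T" for w using T(3) that by blast
  have d\<phi>: "(deriv \<phi> has_field_derivative deriv (deriv \<phi>) z) (at z)"
    using holomorphic_derivI[OF holomorphic_deriv[OF T(2,1)] T(1) z] .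
  have df: "d_zbar f differentiable (at (\<phi> z))"
    using smooth_on_differentiable[OF smooth_on_d_zbar[OF S] \<phi>S[OF z]] .
  have diff\<phi>: "deriv \<phi> differentiable (at z)"
    using d\<phi> unfolding differentiable_def has_field_derivative_def by blast
  have "d_z_zbar (\<lambda>w. f (\<phi> w)) z = d_z (\<lambda>w. d_zbar f (\<phi> w) * cnj (deriv \<phi> w)) z"
    unfolding d_z_zbar_def
    by (rule wirtinger_cong_open(1)[OF T(1) z], rule wirtinger_compose_holomorphic(2))
      (use \<phi> \<phi>S smooth_on_differentiable[OF S(2)] in auto)
  also have "\<dots> = d_z (\<lambda>w. d_zbar f (\<phi> w)) z * cnj (deriv \<phi> z)"
  proof (subst wirtinger_mult)
    show "(\<lambda>w. d_zbar f (\<phi> w)) differentiable (at z)"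
      using differentiable_wirtinger[OF df] \<phi>[OF z] unfolding has_field_derivative_def
      unfolding differentiable_def by (blast intro: has_derivative_compose)
    show "(\<lambda>w. cnj (deriv \<phi> w)) differentiable (at z)"
      using diff\<phi> unfolding differentiable_def
      using bounded_linear.has_derivative[OF bounded_linear_cnj] by blast
    show "d_z (\<lambda>w. d_zbar f (\<phi> w)) z * cnj (deriv \<phi> z) + d_zbar f (\<phi> z) * d_z (\<lambda>w. cnj (deriv \<phi> w)) z =
      d_z (\<lambda>w. d_zbar f (\<phi> w)) z * cnj (deriv \<phi> z)"
      by (simp add: wirtinger_cnj[OF diff\<phi>] wirtinger_holomorphic[OF d\<phi>])
  qed
  also have "d_z (\<lambda>w. d_zbar f (\<phi> w)) z = d_z_zbar f (\<phi> z) * deriv \<phi> z"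
    unfolding d_z_zbar_def by (rule wirtinger_compose_holomorphic(1)[OF df \<phi>[OF z]])
  finally show ?thesis by (simp only: complex_norm_square mult_ac)
qed

section \<open>Integration by parts in the plane for compactly supported functions\<close>

lemma integrable_compact_support:
  fixes f :: "'a::euclidean_space \<Rightarrow> 'b::{banach, second_countable_topology}"
  assumes "continuous_on UNIV f" "compact K" "\<And>x. x \<notin> K \<Longrightarrow> f x = 0"
  shows "integrable lborel f"
proof -
  have "set_integrable lborel K f"
    unfolding set_integrable_def
    by (rule borel_integrable_compact[OF assms(2)]) (rule continuous_on_subset[OF assms(1)], simp)
  moreover have "(\<lambda>x. indicator K x *\<^sub>R f x) = f" using assms(3) by (auto simp: fun_eq_iff indicator_def)
  ultimately show ?thesis by (simp add: set_integrable_def)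
qed

text \<open>The difference quotients of \<open>f\<close> in direction \<open>v\<close> have integral
  0 by translation invariance, and dominated convergence carries this to the derivative.\<close>

lemma integral_directional_derivative_zero:
  fixes f :: "'a::euclidean_space \<Rightarrow> 'b::{banach, second_countable_topology}"
  assumes f: "Ck_on 1 UNIV f" and K: "compact K" and zero: "\<And>x. x \<notin> K \<Longrightarrow> f x = 0"
  shows "integrable lborel (\<lambda>x. frechet_derivative f (at x) v)"
    and "(\<integral>x. frechet_derivative f (at x) v \<partial>lborel) = 0"
proof -
  let ?D = "\<lambda>x. frechet_derivative f (at x)"
  have D: "(f has_derivative ?D x) (at x)" for x
    using f Ck_on_Suc_has_derivative[of 0 UNIV f x] by simp
  have cD: "continuous_on UNIV (\<lambda>x. ?D x v)" using f by simp
  have cf: "continuous_on UNIV f" using Ck_on_imp_continuous_on[OF f] .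
  have D0: "?D x v = 0" if "x \<notin> K" for x
  proof -
    have "?D x = frechet_derivative (\<lambda>_. 0) (at x)"
      by (rule frechet_derivative_cong_open[of "- K"]) (use K that zero in \<open>auto simp: compact_imp_closed\<close>)
    thus ?thesis by simp
  qed
  obtain M where M: "\<And>x. norm (?D x v) \<le> M"
  proof -
    have "bounded ((\<lambda>x. ?D x v) ` K)"
      by (intro compact_imp_bounded compact_continuous_image continuous_on_subset[OF cD] K) simp
    then obtain B where "\<And>x. x \<in> K \<Longrightarrow> norm (?D x v) \<le> B" by (auto simp: bounded_iff)
    hence "norm (?D x v) \<le> max B 0" for x using D0[of x] by (cases "x \<in> K") (auto simp: le_max_iff_disj)
    thus thesis by (rule that)
  qed
  have M0: "M \<ge> 0" using M[of 0] norm_ge_zero order_trans by blast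
  have lip: "norm (f (x + t *\<^sub>R v) - f x) \<le> M * t" if "t \<ge> 0" for x t
  proof -
    have "norm (f (x + t *\<^sub>R v) - f (x + 0 *\<^sub>R v)) \<le> M * norm (t - 0)"
    proof (rule differentiable_bound[of "{0..t}" "\<lambda>s. f (x + s *\<^sub>R v)" "\<lambda>s r. ?D (x + s *\<^sub>R v) (r *\<^sub>R v)"])
      show "((\<lambda>s. f (x + s *\<^sub>R v)) has_derivative (\<lambda>r. ?D (x + s *\<^sub>R v) (r *\<^sub>R v))) (at s within {0..t})" for s
        by (rule has_derivative_compose[OF _ D]) (auto intro!: derivative_eq_intros)
      show "onorm (\<lambda>r. ?D (x + s *\<^sub>R v) (r *\<^sub>R v)) \<le> M" for s
        by (rule onorm_le) (use M has_derivative_linear[OF D] in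
            \<open>simp add: linear_cmul mult.commute[of M] mult_left_mono\<close>)
    qed (use that in auto)
    thus ?thesis using that by simp
  qed
  define g where "g n x = real (Suc n) *\<^sub>R (f (x + (1 / real (Suc n)) *\<^sub>R v) - f x)" for n x
  obtain r where r: "K \<subseteq> ball 0 r" using compact_imp_bounded[OF K] bounded_subset_ballD by metis
  \<comment> \<open>The majorant. All shifts have length at most \<open>norm v\<close>, so if
    \<open>norm x > r + norm v\<close>, both \<open>x\<close> and the shifted point lie outside
    \<open>ball 0 r\<close>, hence outside \<open>K\<close>, and the quotient vanishes.\<close>
  define w where "w x = M * indicator (cball (0::'a) (r + norm v)) x" for x
  have intf: "integrable lborel f" by (rule integrable_compact_support[OF cf K zero])
  have dist: "distr lborel borel ((+) a) = (lborel :: 'a measure)" for a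
    by (rule lborel_distr_plus)
  have trans: "integrable lborel (\<lambda>x. f (a + x))" "(\<integral>x. f (a + x) \<partial>lborel) = integral\<^sup>L lborel f" for a
    using intf integrable_distr[of "(+) a" lborel borel f] integral_distr[of "(+) a" lborel borel f] dist[of a]
      borel_measurable_continuous_onI[OF cf] by auto
  have gint: "(\<integral>x. g n x \<partial>lborel) = 0" for n
    unfolding g_def using trans[of "(1 / real (Suc n)) *\<^sub>R v"] intf
    by (subst integral_scaleR_right, subst Bochner_Integration.integral_diff) (simp_all add: add.commute)
  have lim: "(\<lambda>n. g n x) \<longlonglongrightarrow> ?D x v" for x
  \<comment> \<open>For \<open>v = 0\<close> the shifted points stay at \<open>x\<close>, which the
    punctured filter \<open>at x\<close> excludes; the quotients are then 0 anyway.\<close>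
  proof (cases "v = 0")
    case True thus ?thesis using linear_0[OF has_derivative_linear[OF D]] by (simp add: g_def)
  next
    case False
    let ?y = "\<lambda>n. x + (1 / real (Suc n)) *\<^sub>R v"
    have "filterlim ?y (at x) sequentially"
      unfolding filterlim_at
    proof (intro conjI always_eventually allI)
      have "(\<lambda>n. x + (1 / real (Suc n)) *\<^sub>R v) \<longlonglongrightarrow> x + 0 *\<^sub>R v"
        using LIMSEQ_inverse_real_of_nat by (intro tendsto_intros) (simp add: inverse_eq_divide)
      thus "?y \<longlonglongrightarrow> x" by simp
    qed (use False in auto)
    from filterlim_compose[OF _ this]
    have "(\<lambda>n. norm (f (?y n) - f x - ?D x (?y n - x)) / norm (?y n - x)) \<longlonglongrightarrow> 0"
      using D[of x] unfolding has_derivative_iff_norm by blast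
    hence "(\<lambda>n. norm (f (?y n) - f x - ?D x (?y n - x)) / norm (?y n - x) * norm v) \<longlonglongrightarrow> 0 * norm v"
      by (intro tendsto_intros)
    moreover have "norm (f (?y n) - f x - ?D x (?y n - x)) / norm (?y n - x) * norm v = norm (g n x - ?D x v)" for n
    proof -
      have "norm (g n x - ?D x v) = norm (real (Suc n) *\<^sub>R (f (?y n) - f x - ?D x (?y n - x)))"
        by (simp add: g_def linear_cmul[OF has_derivative_linear[OF D]] scaleR_diff_right del: of_nat_Suc)
      also have "\<dots> = real (Suc n) * norm (f (?y n) - f x - ?D x (?y n - x))"
        by (simp del: of_nat_Suc)
      finally show ?thesis using False by (simp add: field_simps del: of_nat_Suc)
    qed
    ultimately have "(\<lambda>n. norm (g n x - ?D x v)) \<longlonglongrightarrow> 0" by simp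
    thus ?thesis by (simp add: tendsto_norm_zero_iff LIM_zero_iff)
  qed
  have bound: "norm (g n x) \<le> w x" for n x
  proof (cases "norm x \<le> r + norm v")
    case True
    have "norm (g n x) \<le> real (Suc n) * (M * (1 / real (Suc n)))"
      unfolding g_def norm_scaleR using lip[of "1 / real (Suc n)" x]
      by (simp add: field_simps del: of_nat_Suc)
    thus ?thesis using True by (simp add: w_def del: of_nat_Suc)
  next
    case False
    have "norm ((1 / real (Suc n)) *\<^sub>R v) \<le> norm v"
      by (simp add: divide_le_eq mult_left_le field_simps)
    moreover have "norm x \<le> norm (x + (1 / real (Suc n)) *\<^sub>R v) + norm ((1 / real (Suc n)) *\<^sub>R v)"
      by (metis norm_add_leD norm_diff_ineq add.commute le_diff_eq diff_le_eq)
    ultimately have "\<not> norm x < r" "\<not> norm (x + (1 / real (Suc n)) *\<^sub>R v) < r"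
      using False norm_ge_zero[of v] by linarith+
    hence "x \<notin> K" "x + (1 / real (Suc n)) *\<^sub>R v \<notin> K"
      using r by (auto simp: subset_iff simp del: of_nat_Suc)
    thus ?thesis using zero M0 by (simp add: g_def w_def del: of_nat_Suc)
  qed
  have wint: "integrable lborel w"
    unfolding w_def by (intro integrable_mult_right integrable_real_indicator) (auto intro!: emeasure_bounded_finite[unfolded infinity_ennreal_def])
  have meas: "g n \<in> borel_measurable lborel" for n
    unfolding g_def by (simp, intro borel_measurable_continuous_onI continuous_intros continuous_on_compose2[OF cf]) auto
  note dc = integral_dominated_convergence[of "\<lambda>x. ?D x v" lborel g w]
    integrable_dominated_convergence[of "\<lambda>x. ?D x v" lborel g w]
  have mD: "(\<lambda>x. ?D x v) \<in> borel_measurable lborel"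
    using borel_measurable_continuous_onI[OF cD] by simp
  show "integrable lborel (\<lambda>x. ?D x v)"
    by (rule dc(2)[OF mD meas wint]) (use lim bound in auto)
  have "(\<lambda>n. integral\<^sup>L lborel (g n)) \<longlonglongrightarrow> (\<integral>x. ?D x v \<partial>lborel)"
    by (rule dc(1)[OF mD meas wint]) (use lim bound in auto)
  thus "(\<integral>x. ?D x v \<partial>lborel) = 0" by (simp add: gint LIMSEQ_const_iff)
qed

text \<open>The open sets \<open>S\<close> and \<open>- K\<close> cover the space because
  \<open>K\<close> lies in \<open>S\<close>; on the second the extension is identically 0.\<close>

lemma smooth_on_extend_by_zero:
  assumes "open S" "closed K" "K \<subseteq> S" "smooth_on S f" "\<And>z. z \<in> S \<Longrightarrow> z \<notin> K \<Longrightarrow> f z = 0"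
  shows "smooth_on UNIV (\<lambda>z. if z \<in> S then f z else 0)"
proof (rule smooth_on_local)
  fix x
  show "\<exists>T. open T \<and> x \<in> T \<and> smooth_on T (\<lambda>z. if z \<in> S then f z else 0)"
  proof (cases "x \<in> S")
    case True
    have "smooth_on S (\<lambda>z. if z \<in> S then f z else 0)"
      using smooth_on_cong_open[OF assms(1), of f "\<lambda>z. if z \<in> S then f z else 0"] assms(4) by simp
    with True assms(1) show ?thesis by blast
  next
    case False
    have "smooth_on (- K) (\<lambda>z. if z \<in> S then f z else 0)"
      using smooth_on_cong_open[of "- K" "\<lambda>_. 0" "\<lambda>z. if z \<in> S then f z else 0"] assms
      by (simp add: open_Compl smooth_on_const)
    moreover have "open (- K)" "x \<in> - K" using False assms by auto
    ultimately show ?thesis by blast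
  qed
qed

lemma integral_wirtinger_zero:
  assumes "smooth_on UNIV P" "compact K" "\<And>z. z \<notin> K \<Longrightarrow> P z = 0"
  shows "integrable lborel (d_z P)" "integral\<^sup>L lborel (d_z P) = 0"
    and "integrable lborel (d_zbar P)" "integral\<^sup>L lborel (d_zbar P) = 0"
proof -
  have "Ck_on 1 UNIV P" using assms(1) smooth_on_def by blast
  note I = integral_directional_derivative_zero[OF this assms(2,3)]
  show "integrable lborel (d_z P)" "integrable lborel (d_zbar P)"
    "integral\<^sup>L lborel (d_z P) = 0" "integral\<^sup>L lborel (d_zbar P) = 0"
    unfolding d_z_def[abs_def] d_zbar_def[abs_def] using I[of 1] I[of \<i>] by simp_all
qed

text \<open>The difference of the integrands is \<open>d_z (d_zbar F * cnj G) - d_zbar (F * d_z (cnj G))\<close>, so the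
  order of the mixed derivatives never has to be exchanged.\<close>

lemma d_z_zbar_by_parts:
  assumes S: "open S" and F: "smooth_on S F" and G: "smooth_on S G"
    and K: "compact K" "K \<subseteq> S" "\<And>z. z \<in> S \<Longrightarrow> z \<notin> K \<Longrightarrow> G z = 0"
  shows "(\<integral>z. indicator S z *\<^sub>R (d_z_zbar F z * cnj (G z)) \<partial>lborel)
       = (\<integral>z. indicator S z *\<^sub>R (F z * cnj (d_z_zbar G z)) \<partial>lborel)"
proof -
  define H where "H = (\<lambda>z. cnj (G z))"
  have H: "smooth_on S H" unfolding H_def by (rule smooth_on_linear[OF bounded_linear_cnj S G])
  have H0: "H z = 0" "d_z H z = 0" "d_zbar (d_z H) z = 0" if "z \<in> S" "z \<notin> K" for z
  proof -
    have o: "open (S - K)" and z: "z \<in> S - K" using S K(1) that by (auto simp: open_Diff compact_imp_closed)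
    have Hz: "H y = 0" if "y \<in> S - K" for y using that K(3) by (simp add: H_def)
    have dz: "d_z H y = 0" if "y \<in> S - K" for y
      using wirtinger_cong_open(1)[OF o that, of H "\<lambda>_. 0"] Hz by (simp add: d_z_def)
    show "H z = 0" "d_z H z = 0" using Hz dz z by auto
    show "d_zbar (d_z H) z = 0"
      using wirtinger_cong_open(2)[OF o z, of "d_z H" "\<lambda>_. 0"] dz by (simp add: d_zbar_def)
  qed
  have cl: "closed K" using K(1) compact_imp_closed by blast
  note ext = smooth_on_extend_by_zero[OF S cl K(2)]
  note mult = smooth_on_mult[OF S] and d = smooth_on_d_z[OF S] smooth_on_d_zbar[OF S]
  \<comment> \<open>\<open>F\<close> need not extend beyond \<open>S\<close>, but its products with
    \<open>H\<close> and \<open>d_z H\<close> vanish off \<open>K\<close> and do extend by zero.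
    \<open>P\<close> and \<open>Q\<close> are the functions whose derivatives integrate to
    0.\<close>
  define P where "P = (\<lambda>z. if z \<in> S then d_zbar F z * H z else 0)"
  define Q where "Q = (\<lambda>z. if z \<in> S then F z * d_z H z else 0)"
  have P: "smooth_on UNIV P" unfolding P_def by (rule ext[OF mult]) (use d F H H0 in auto)
  have Q: "smooth_on UNIV Q" unfolding Q_def by (rule ext[OF mult]) (use d F H H0 in auto)
  have out: "P z = 0" "Q z = 0" if "z \<notin> K" for z using that H0 by (auto simp: P_def Q_def)
  note IP = integral_wirtinger_zero[OF P K(1) out(1)] and IQ = integral_wirtinger_zero[OF Q K(1) out(2)]
  define A where "A = (\<lambda>z. if z \<in> S then d_z_zbar F z * H z else 0)"
  define B where "B = (\<lambda>z. if z \<in> S then F z * d_zbar (d_z H) z else 0)"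
  have A: "smooth_on UNIV A" unfolding A_def d_z_zbar_def by (rule ext[OF mult]) (use d F H H0 in auto)
  have B: "smooth_on UNIV B" unfolding B_def by (rule ext[OF mult]) (use d F H H0 in auto)
  have IA: "integrable lborel A"
    by (rule integrable_compact_support[OF smooth_on_imp_continuous_on[OF A] K(1)]) (auto simp: A_def H0)
  have IB: "integrable lborel B"
    by (rule integrable_compact_support[OF smooth_on_imp_continuous_on[OF B] K(1)]) (auto simp: B_def H0)
  have eq: "A z - B z = d_z P z - d_zbar Q z" for z
  proof (cases "z \<in> S")
    case True
    note df = smooth_on_differentiable[OF _ True]
    have "d_z P z = d_z_zbar F z * H z + d_zbar F z * d_z H z"
      using wirtinger_cong_open(1)[OF S True, of P "\<lambda>z. d_zbar F z * H z"]
        wirtinger_mult(1)[OF df[OF d(2)[OF F]] df[OF H]] by (simp add: P_def d_z_zbar_def)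
    moreover have "d_zbar Q z = d_zbar F z * d_z H z + F z * d_zbar (d_z H) z"
      using wirtinger_cong_open(2)[OF S True, of Q "\<lambda>z. F z * d_z H z"]
        wirtinger_mult(2)[OF df[OF F] df[OF d(1)[OF H]]] by (simp add: Q_def)
    ultimately show ?thesis using True by (simp add: A_def B_def)
  next
    case False
    hence "z \<in> - K" "open (- K)" using K(2) cl by auto
    hence "d_z P z = 0" "d_zbar Q z = 0"
      using wirtinger_cong_open(1)[of "- K" z P "\<lambda>_. 0"] wirtinger_cong_open(2)[of "- K" z Q "\<lambda>_. 0"] out
      by (simp_all add: d_z_def d_zbar_def)
    thus ?thesis using False by (simp add: A_def B_def)
  qed
  have "integral\<^sup>L lborel A - integral\<^sup>L lborel B = (\<integral>z. A z - B z \<partial>lborel)" using IA IB by simp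
  also have "\<dots> = (\<integral>z. d_z P z - d_zbar Q z \<partial>lborel)" by (simp only: eq)
  also have "\<dots> = 0" using IP IQ by simp
  finally have "integral\<^sup>L lborel A = integral\<^sup>L lborel B" by simp
  moreover have "A = (\<lambda>z. indicator S z *\<^sub>R (d_z_zbar F z * cnj (G z)))"
    by (auto simp: A_def H_def fun_eq_iff)
  moreover have "B = (\<lambda>z. indicator S z *\<^sub>R (F z * cnj (d_z_zbar G z)))"
  proof
    fix z show "B z = indicator S z *\<^sub>R (F z * cnj (d_z_zbar G z))"
    proof (cases "z \<in> S")
      case True
      \<comment> \<open>Conjugation exchanges the two Wirtinger operators, so \<open>d_zbar\<close>
        after \<open>d_z\<close> on \<open>cnj G\<close> is the conjugate of \<open>d_z\<close>
        after \<open>d_zbar\<close> on \<open>G\<close>, the very order in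
        \<open>d_z_zbar\<close>.\<close>
      have "d_zbar (d_z H) z = d_zbar (\<lambda>w. cnj (d_zbar G w)) z"
        by (rule wirtinger_cong_open(2)[OF S True])
          (auto simp: H_def intro!: wirtinger_cnj smooth_on_differentiable[OF G])
      also have "\<dots> = cnj (d_z_zbar G z)"
        unfolding d_z_zbar_def by (rule wirtinger_cnj(2)[OF smooth_on_differentiable[OF d(2)[OF G] True]])
      finally show ?thesis using True by (simp add: B_def)
    qed (simp add: B_def)
  qed
  ultimately show ?thesis by simp
qed

section \<open>Change of variables for holomorphic maps\<close>

text \<open>The change of variables theorem applied below concerns maps of \<open>real^2\<close> and
  their matrices; this isometry and its inverse carry it over to \<open>complex\<close>.\<close>

definition complex_of_vec :: "real^2 \<Rightarrow> complex" where
  "complex_of_vec v = Complex (v $ 1) (v $ 2)"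

definition vec_of_complex :: "complex \<Rightarrow> real^2" where
  "vec_of_complex z = (\<chi> i. if i = 1 then Re z else Im z)"

lemma complex_of_vec_inverse [simp]:
  "complex_of_vec (vec_of_complex z) = z" "vec_of_complex (complex_of_vec v) = v"
  by (auto simp: complex_of_vec_def vec_of_complex_def vec_eq_iff forall_2)

lemma bounded_linear_complex_of_vec: "bounded_linear complex_of_vec"
  by (simp add: linear_conv_bounded_linear[symmetric] complex_of_vec_def linear_iff complex_eq_iff)

lemma bounded_linear_vec_of_complex: "bounded_linear vec_of_complex"
  by (simp add: linear_conv_bounded_linear[symmetric] vec_of_complex_def linear_iff vec_eq_iff)

lemma measurable_complex_of_vec [measurable]: "complex_of_vec \<in> borel \<rightarrow>\<^sub>M borel"
  by (intro borel_measurable_continuous_onI linear_continuous_on bounded_linear_complex_of_vec)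

lemma lborel_complex_eq: "(lborel :: complex measure) = distr lborel borel complex_of_vec"
proof (rule lborel_eqI)
  fix l u :: complex assume le: "\<And>b. b \<in> Basis \<Longrightarrow> l \<bullet> b \<le> u \<bullet> b"
  have Bv: "(Basis :: (real^2) set) = {axis 1 1, axis 2 1}"
    by (auto simp: Basis_vec_def UNIV_2)
  have "complex_of_vec -` box l u \<inter> space lborel = box (vec_of_complex l) (vec_of_complex u)"
    by (auto simp: complex_of_vec_def vec_of_complex_def mem_box Basis_complex_def Bv inner_axis)
  moreover have "(axis 1 1 :: real^2) \<noteq> axis 2 1" by (simp add: axis_eq_axis)
  ultimately show "emeasure (distr lborel borel complex_of_vec) (box l u) = (\<Prod>b\<in>Basis. (u - l) \<bullet> b)"
    using le[of 1] le[of \<i>] by (simp add: emeasure_distr emeasure_lborel_box_eq Bv inner_axis vec_of_complex_def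
        Basis_complex_def complex_eq_iff)
qed simp

text \<open>In real coordinates multiplication by \<open>a\<close> has the matrix with rows
  \<open>(Re a, - Im a)\<close> and \<open>(Im a, Re a)\<close>.\<close>

lemma det_complex_mult:
  "det (matrix (\<lambda>h. vec_of_complex (a * complex_of_vec h))) = (cmod a)\<^sup>2"
  by (simp add: det_2 matrix_def vec_of_complex_def complex_of_vec_def axis_def cmod_power2)
    (simp add: power2_eq_square)

text \<open>By the Cauchy-Riemann equations the real Jacobian determinant of a holomorphic map is
  the squared modulus of its derivative; the rest transports the real change of variables theorem to
  \<open>complex\<close> and to values in \<open>ennreal\<close>.\<close>

lemma emeasure_holomorphic_image:
  assumes S: "open S" and \<phi>: "\<phi> holomorphic_on S" and inj: "inj_on \<phi> S"
    and E: "E \<in> sets borel" "E \<subseteq> S" and img: "\<phi> ` E \<in> sets borel"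
  shows "emeasure lborel (\<phi> ` E) = (\<integral>\<^sup>+z. ennreal ((cmod (deriv \<phi> z))\<^sup>2) * indicator E z \<partial>lborel)"
proof -
  define E' where "E' = complex_of_vec -` E"
  define g where "g = (\<lambda>x. vec_of_complex (\<phi> (complex_of_vec x)))"
  define d where "d = (\<lambda>x. (cmod (deriv \<phi> (complex_of_vec x)))\<^sup>2)"
  have E': "E' \<in> sets borel" unfolding E'_def using measurable_sets[OF measurable_complex_of_vec E(1)] by simp
  have gE: "g ` E' = complex_of_vec -` (\<phi> ` E)"
  proof (intro set_eqI iffI)
    fix y assume "y \<in> complex_of_vec -` (\<phi> ` E)"
    then obtain z where z: "z \<in> E" "complex_of_vec y = \<phi> z" by auto
    hence "y = g (vec_of_complex z)" unfolding g_def by (metis complex_of_vec_inverse)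
    thus "y \<in> g ` E'" using z by (auto simp: E'_def)
  qed (auto simp: E'_def g_def)
  have gEb: "g ` E' \<in> sets borel"
    unfolding gE using measurable_sets[OF measurable_complex_of_vec img] by simp
  have em: "emeasure lborel (\<phi> ` E) = emeasure lborel (g ` E')"
    by (subst lborel_complex_eq) (simp add: emeasure_distr img gE)
  have dB: "continuous_on S (\<lambda>z. (cmod (deriv \<phi> z))\<^sup>2)"
    by (intro continuous_intros holomorphic_on_imp_continuous_on holomorphic_deriv \<phi> S)
  have meas: "(\<lambda>z. (cmod (deriv \<phi> z))\<^sup>2 * indicator E z) \<in> borel_measurable borel"
  proof -
    have "(\<lambda>z. indicator E z *\<^sub>R (cmod (deriv \<phi> z))\<^sup>2) \<in> borel_measurable borel"
      using borel_measurable_continuous_on_indicator[OF E(1) continuous_on_subset[OF dB E(2)]] .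
    thus ?thesis by (simp add: mult.commute)
  qed
  have rhs: "(\<integral>\<^sup>+z. ennreal ((cmod (deriv \<phi> z))\<^sup>2) * indicator E z \<partial>lborel)
      = (\<integral>\<^sup>+x. ennreal (d x * indicator E' x) \<partial>lborel)"
  proof -
    have "(\<integral>\<^sup>+z. ennreal ((cmod (deriv \<phi> z))\<^sup>2) * indicator E z \<partial>lborel)
        = (\<integral>\<^sup>+z. ennreal ((cmod (deriv \<phi> z))\<^sup>2 * indicator E z) \<partial>lborel)"
      by (intro nn_integral_cong) (simp add: indicator_def)
    also have "\<dots> = (\<integral>\<^sup>+x. ennreal ((cmod (deriv \<phi> (complex_of_vec x)))\<^sup>2 * indicator E (complex_of_vec x)) \<partial>lborel)"
      unfolding lborel_complex_eq using meas by (subst nn_integral_distr) auto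
    finally show ?thesis by (simp add: d_def E'_def indicator_def)
  qed
  have dmeas: "(\<lambda>x. d x * indicator E' x) \<in> borel_measurable borel"
    using measurable_compose[OF measurable_complex_of_vec meas] by (simp add: d_def E'_def indicator_def vimage_def)
  have der: "(g has_derivative (\<lambda>h. vec_of_complex (deriv \<phi> (complex_of_vec x) * complex_of_vec h))) (at x within E')"
    if "x \<in> E'" for x
  proof -
    have "complex_of_vec x \<in> S" using that E(2) by (auto simp: E'_def)
    hence "(\<phi> has_derivative (\<lambda>h. deriv \<phi> (complex_of_vec x) * h)) (at (complex_of_vec x))"
      using holomorphic_derivI[OF \<phi> S] has_field_derivative_imp_has_derivative by blast
    from has_derivative_compose[OF bounded_linear_imp_has_derivative[OF bounded_linear_complex_of_vec] this]
    show ?thesis unfolding g_def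
      by (rule bounded_linear.has_derivative[OF bounded_linear_vec_of_complex])
  qed
  have injg: "inj_on g E'"
  proof (rule inj_onI)
    fix x y assume *: "x \<in> E'" "y \<in> E'" "g x = g y"
    hence "\<phi> (complex_of_vec x) = \<phi> (complex_of_vec y)" unfolding g_def by (metis complex_of_vec_inverse(1))
    hence "complex_of_vec x = complex_of_vec y"
      using inj_onD[OF inj] * E(2) by (auto simp: E'_def)
    thus "x = y" by (metis complex_of_vec_inverse(2))
  qed
  have E'L: "E' \<in> sets lebesgue" using E' by auto
  \<comment> \<open>This equivalence speaks of finite values only. If the image has infinite
    measure, a finite integral would make it \<open>lmeasurable\<close>, so both sides are infinite
    together.\<close>
  have iff: "g ` E' \<in> lmeasurable \<and> measure lebesgue (g ` E') = m \<longleftrightarrow> (d has_integral m) E'" for m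
    using has_measure_differentiable_image[OF E'L der injg, of m]
    by (simp add: det_complex_mult d_def)
  have "emeasure lborel (g ` E') = (\<integral>\<^sup>+x. ennreal (d x * indicator E' x) \<partial>lborel)"
  proof (cases "emeasure lborel (g ` E') < \<infinity>")
    case True
    hence "g ` E' \<in> lmeasurable" using gEb by (auto simp: fmeasurable_def)
    hence "(d has_integral measure lebesgue (g ` E')) E'" using iff by blast
    hence "(\<integral>\<^sup>+x. ennreal (d x * indicator E' x) \<partial>lborel) = ennreal (measure lebesgue (g ` E'))"
      using nn_integral_has_integral_lebesgue[of E' d] by (simp add: d_def mult.commute)
    thus ?thesis using True gEb by (simp add: emeasure_eq_ennreal_measure)
  next
    case False
    have "(\<integral>\<^sup>+x. ennreal (d x * indicator E' x) \<partial>lborel) = \<infinity>"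
    proof (rule ccontr)
      assume "(\<integral>\<^sup>+x. ennreal (d x * indicator E' x) \<partial>lborel) \<noteq> \<infinity>"
      then obtain r where r: "(\<integral>\<^sup>+x. ennreal (d x * indicator E' x) \<partial>lborel) = ennreal r" "r \<ge> 0"
        by (metis ennreal_cases infinity_ennreal_def)
      have "((\<lambda>x. d x * indicator E' x) has_integral r) UNIV"
        by (rule nn_integral_has_integral[OF dmeas _ r]) (simp add: d_def)
      hence "(d has_integral r) E'"
        by (subst has_integral_restrict_UNIV[symmetric]) (simp add: indicator_times_eq_if)
      hence "g ` E' \<in> lmeasurable" using iff by blast
      thus False using False gEb by (auto simp: fmeasurable_def)
    qed
    thus ?thesis using False by (simp add: less_top[symmetric])
  qed
  thus ?thesis using em rhs by simp
qed

text \<open>The push-forward under \<open>\<phi>\<close> of Lebesgue measure weighted by the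
  Jacobian agrees on Borel sets with Lebesgue measure restricted to the image; integrating
  \<open>w\<close> against both gives the formula.\<close>

lemma nn_integral_holomorphic_substitution:
  fixes w :: "complex \<Rightarrow> ennreal"
  assumes S: "open S" and \<phi>: "\<phi> holomorphic_on S" and inj: "inj_on \<phi> S"
    and w: "w \<in> borel_measurable borel"
  shows "(\<integral>\<^sup>+y. w y * indicator (\<phi> ` S) y \<partial>lborel)
      = (\<integral>\<^sup>+z. ennreal ((cmod (deriv \<phi> z))\<^sup>2) * w (\<phi> z) * indicator S z \<partial>lborel)"
proof -
  \<comment> \<open>A total Borel map is required for the push-forward. The value 0 off
    \<open>S\<close> is harmless because the density of \<open>M\<close> vanishes there.\<close>
  define \<psi> where "\<psi> = (\<lambda>z. if z \<in> S then \<phi> z else 0)"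
  define M where "M = density lborel (\<lambda>z. ennreal ((cmod (deriv \<phi> z))\<^sup>2) * indicator S z)"
  have cont: "continuous_on S \<phi>" "continuous_on S (\<lambda>z. (cmod (deriv \<phi> z))\<^sup>2)"
    by (intro continuous_intros holomorphic_on_imp_continuous_on holomorphic_deriv \<phi> S)+
  have Sb: "S \<in> sets borel" using S by simp
  have \<psi>: "\<psi> \<in> borel \<rightarrow>\<^sub>M borel"
  proof -
    have "\<psi> = (\<lambda>z. indicator S z *\<^sub>R \<phi> z)" by (auto simp: \<psi>_def)
    thus ?thesis using borel_measurable_continuous_on_indicator[OF Sb cont(1)] by simp
  qed
  have dens: "(\<lambda>z. ennreal ((cmod (deriv \<phi> z))\<^sup>2) * indicator S z) \<in> borel_measurable borel"
  proof -
    have "(\<lambda>z. ennreal (indicator S z *\<^sub>R (cmod (deriv \<phi> z))\<^sup>2)) \<in> borel_measurable borel"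
      using borel_measurable_continuous_on_indicator[OF Sb cont(2)] by measurable
    also have "(\<lambda>z. ennreal (indicator S z *\<^sub>R (cmod (deriv \<phi> z))\<^sup>2))
        = (\<lambda>z. ennreal ((cmod (deriv \<phi> z))\<^sup>2) * indicator S z)"
      by (auto simp: indicator_def)
    finally show ?thesis .
  qed
  have im: "open (\<phi> ` S)" by (rule open_mapping_thm3[OF \<phi> S inj])
  have "distr M borel \<psi> = density lborel (indicator (\<phi> ` S))"
  proof (rule measure_eqI)
    fix B assume "B \<in> sets (distr M borel \<psi>)"
    hence B: "B \<in> sets borel" by simp
    define E where "E = \<psi> -` B \<inter> S"
    have E: "E \<in> sets borel" unfolding E_def using measurable_sets[OF \<psi> B] Sb by auto
    have img: "\<phi> ` E = B \<inter> \<phi> ` S" by (auto simp: E_def \<psi>_def)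
    have "emeasure (distr M borel \<psi>) B = emeasure M (\<psi> -` B)"
      using \<psi> B by (subst emeasure_distr) (auto simp: M_def)
    also have "\<dots> = (\<integral>\<^sup>+z. ennreal ((cmod (deriv \<phi> z))\<^sup>2) * indicator S z * indicator (\<psi> -` B) z \<partial>lborel)"
      unfolding M_def using measurable_sets[OF \<psi> B] dens by (intro emeasure_density) auto
    also have "\<dots> = (\<integral>\<^sup>+z. ennreal ((cmod (deriv \<phi> z))\<^sup>2) * indicator E z \<partial>lborel)"
      by (intro nn_integral_cong) (auto simp: E_def indicator_def)
    also have "\<dots> = emeasure lborel (\<phi> ` E)"
    proof (rule emeasure_holomorphic_image[OF S \<phi> inj E, symmetric])
      show "\<phi> ` E \<in> sets borel" unfolding img using B im by auto
    qed (simp add: E_def)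
    also have "\<dots> = emeasure (density lborel (indicator (\<phi> ` S))) B"
      unfolding img using B im
      by (subst emeasure_density) (auto simp: indicator_inter_arith[symmetric] Int_commute)
    finally show "emeasure (distr M borel \<psi>) B = emeasure (density lborel (indicator (\<phi> ` S))) B" .
  qed simp
  hence "(\<integral>\<^sup>+y. w y \<partial>distr M borel \<psi>) = (\<integral>\<^sup>+y. w y \<partial>density lborel (indicator (\<phi> ` S)))" by simp
  also have "\<dots> = (\<integral>\<^sup>+y. indicator (\<phi> ` S) y * w y \<partial>lborel)"
    using im w by (subst nn_integral_density) auto
  also have "(\<integral>\<^sup>+y. w y \<partial>distr M borel \<psi>) = (\<integral>\<^sup>+z. w (\<psi> z) \<partial>M)"
    using \<psi> w by (subst nn_integral_distr) (auto simp: M_def)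
  also have "\<dots> = (\<integral>\<^sup>+z. ennreal ((cmod (deriv \<phi> z))\<^sup>2) * indicator S z * w (\<psi> z) \<partial>lborel)"
    unfolding M_def using dens measurable_compose[OF \<psi> w] by (subst nn_integral_density) auto
  also have "\<dots> = (\<integral>\<^sup>+z. ennreal ((cmod (deriv \<phi> z))\<^sup>2) * w (\<phi> z) * indicator S z \<partial>lborel)"
    by (intro nn_integral_cong) (auto simp: \<psi>_def indicator_def)
  finally show ?thesis by (simp add: mult.commute)
qed

section \<open>The volume measure\<close>

lemma tangent_bundle_sel:
  "lb_index (tangent_bundle A) = A" "lb_dom (tangent_bundle A) = fst"
  "lb_trans (tangent_bundle A) = (\<lambda>c d p. deriv (snd c \<circ> param d) (snd d p))"
  by (simp_all add: tangent_bundle_def)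

locale riemann_surface =
  fixes A :: "'a::t2_space chart set"
  assumes surface: "compact_riemann_surface A"
begin

lemma chart:
  assumes "c \<in> A"
  shows open_chart: "open (fst c)" and open_coord: "open (snd c ` fst c)"
    and chart_homeo: "homeomorphism (fst c) (snd c ` fst c) (snd c) (param c)"
  using assms surface unfolding compact_riemann_surface_def holomorphic_atlas_def by blast+

lemma chart_exists: "\<exists>c\<in>A. p \<in> fst c"
  using surface unfolding compact_riemann_surface_def holomorphic_atlas_def by blast

lemma param_coord [simp]: "c \<in> A \<Longrightarrow> p \<in> fst c \<Longrightarrow> param c (snd c p) = p"
  using chart_homeo by (auto simp: homeomorphism_def)

lemma coord_param [simp]: "c \<in> A \<Longrightarrow> z \<in> snd c ` fst c \<Longrightarrow> snd c (param c z) = z"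
  by auto

lemma param_in: "c \<in> A \<Longrightarrow> z \<in> snd c ` fst c \<Longrightarrow> param c z \<in> fst c"
  by auto

lemma coord_in_image_iff: "c \<in> A \<Longrightarrow> p \<in> fst c \<Longrightarrow> B \<subseteq> fst c \<Longrightarrow> snd c p \<in> snd c ` B \<longleftrightarrow> p \<in> B"
  by (auto simp: subset_iff image_iff) (metis param_coord)

lemma continuous_on_param: "c \<in> A \<Longrightarrow> continuous_on (snd c ` fst c) (param c)"
  and continuous_on_coord: "c \<in> A \<Longrightarrow> continuous_on (fst c) (snd c)"
  using chart_homeo by (auto simp: homeomorphism_def)

lemma coord_image_eq: "c \<in> A \<Longrightarrow> snd c ` (fst c \<inter> W) = snd c ` fst c \<inter> param c -` W"
  by (auto simp: image_iff)

lemma open_coord_image: "c \<in> A \<Longrightarrow> open W \<Longrightarrow> open (snd c ` (fst c \<inter> W))"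
  unfolding coord_image_eq
  by (rule continuous_open_preimage[OF continuous_on_param open_coord])

lemma transition:
  assumes "c \<in> A" "d \<in> A"
  shows "(\<lambda>z. snd d (param c z)) holomorphic_on (snd c ` (fst c \<inter> fst d))"
proof -
  have "(snd d \<circ> param c) holomorphic_on (snd c ` (fst c \<inter> fst d))"
    using assms surface unfolding compact_riemann_surface_def holomorphic_atlas_def by blast
  thus ?thesis by (simp add: o_def)
qed

lemma compact_param_image:
  assumes "c \<in> A" "compact K" "K \<subseteq> snd c ` fst c"
  shows "compact (param c ` K)"
  by (rule compact_continuous_image[OF continuous_on_subset[OF continuous_on_param[OF assms(1)] assms(3)] assms(2)])

text \<open>The discs of half radius already cover, which leaves room for bump functions equal to 1
  on the half disc and supported in the closed full disc.\<close>

lemma finite_disc_cover: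
  "\<exists>I. finite I \<and> (\<forall>c a r. (c, a, r) \<in> I \<longrightarrow> c \<in> A \<and> r > 0 \<and> cball a r \<subseteq> snd c ` fst c) \<and>
    (\<forall>q. \<exists>c a r. (c, a, r) \<in> I \<and> q \<in> fst c \<and> snd c q \<in> ball a (r / 2))"
proof -
  define J where "J = {(c, a, r :: real). c \<in> A \<and> r > 0 \<and> cball a r \<subseteq> snd c ` fst c}"
  define V :: "'a chart \<times> complex \<times> real \<Rightarrow> 'a set"
    where "V = (\<lambda>(c, a, r). fst c \<inter> snd c -` ball a (r / 2))"
  have cpt: "compact (UNIV :: 'a set)" using surface unfolding compact_riemann_surface_def by blast
  have opn: "open (V i)" if iJ: "i \<in> J" for i
  proof -
    obtain c a r where i: "i = (c, a, r)" by (rule prod_cases3)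
    hence c: "c \<in> A" using iJ by (simp add: J_def)
    show ?thesis unfolding i V_def prod.case
      by (rule continuous_open_preimage[OF continuous_on_coord[OF c] open_chart[OF c] open_ball])
  qed
  have cov: "UNIV \<subseteq> (\<Union>i\<in>J. V i)"
  proof
    fix p :: 'a
    obtain c where c: "c \<in> A" "p \<in> fst c" using chart_exists by blast
    obtain r where r: "r > 0" "cball (snd c p) r \<subseteq> snd c ` fst c"
      using open_coord[OF c(1)] c(2) open_contains_cball by blast
    have "(c, snd c p, r) \<in> J" "p \<in> V (c, snd c p, r)" using c r by (simp_all add: J_def V_def)
    thus "p \<in> (\<Union>i\<in>J. V i)" by blast
  qed
  obtain I where I: "I \<subseteq> J" "finite I" "UNIV \<subseteq> (\<Union>i\<in>I. V i)"
    by (rule compactE_image[OF cpt opn cov])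
  have "c \<in> A \<and> r > 0 \<and> cball a r \<subseteq> snd c ` fst c" if "(c, a, r) \<in> I" for c a r
    using that I(1) by (auto simp: J_def)
  moreover have "\<exists>c a r. (c, a, r) \<in> I \<and> q \<in> fst c \<and> snd c q \<in> ball a (r / 2)" for q
  proof -
    obtain i where i: "i \<in> I" "q \<in> V i" using I(3) by blast
    obtain c a r where "i = (c, a, r)" by (rule prod_cases3)
    with i have "(c, a, r) \<in> I \<and> q \<in> fst c \<and> snd c q \<in> ball a (r / 2)" by (simp add: V_def)
    thus ?thesis by blast
  qed
  ultimately show ?thesis using I(2) by blast
qed

end

section \<open>The measure defined by a continuous metric on the tangent bundle\<close>

locale surface_metric = riemann_surface A for A :: "'a::t2_space chart set" +
  fixes h :: "('a, 'a chart) metric"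
  assumes continuous_metric: "continuous_metric (tangent_bundle A) h"
begin

lemma metric_pos: "c \<in> A \<Longrightarrow> p \<in> fst c \<Longrightarrow> h c p > 0"
  using continuous_metric
  unfolding continuous_metric_def hermitian_metric_def tangent_bundle_sel by blast

lemma metric_transition:
  "c \<in> A \<Longrightarrow> d \<in> A \<Longrightarrow> p \<in> fst c \<Longrightarrow> p \<in> fst d \<Longrightarrow>
    h d p = (cmod (deriv (\<lambda>z. snd c (param d z)) (snd d p)))\<^sup>2 * h c p"
  using continuous_metric
  unfolding continuous_metric_def hermitian_metric_def tangent_bundle_sel o_def by blast

lemma continuous_on_metric: "c \<in> A \<Longrightarrow> continuous_on (fst c) (h c)"
  using continuous_metric unfolding continuous_metric_def tangent_bundle_sel by blast

definition chart_density :: "'a chart \<Rightarrow> complex \<Rightarrow> real" where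
  "chart_density c z = indicator (snd c ` fst c) z * (h c (param c z) / pi)"

definition chart_volume :: "'a chart \<Rightarrow> 'a set \<Rightarrow> ennreal" where
  "chart_volume c B = (\<integral>\<^sup>+ z. ennreal (h c (param c z) / pi) * indicator (snd c ` B) z \<partial>lborel)"

text \<open>A total version of \<open>param\<close>, so that measures can be pushed forward along
  it; \<open>chart_density\<close> vanishes where the value is \<open>undefined\<close>.\<close>

definition total_param :: "'a chart \<Rightarrow> complex \<Rightarrow> 'a" where
  "total_param c z = (if z \<in> snd c ` fst c then param c z else undefined)"

text \<open>The restriction of the future volume measure to one chart, built in the coordinate and
  carried to the surface.\<close>

definition chart_measure :: "'a chart \<Rightarrow> 'a measure" where
  "chart_measure c = distr (density lborel (\<lambda>z. ennreal (chart_density c z))) borel (total_param c)"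

lemma chart_density_nonneg: "c \<in> A \<Longrightarrow> chart_density c z \<ge> 0"
  using metric_pos[of c "param c z"] param_in[of c z]
  by (cases "z \<in> snd c ` fst c") (auto simp: chart_density_def intro!: less_imp_le)

lemma continuous_on_chart_density:
  "c \<in> A \<Longrightarrow> continuous_on (snd c ` fst c) (\<lambda>z. h c (param c z) / pi)"
  by (intro continuous_intros continuous_on_compose2[OF continuous_on_metric continuous_on_param])
    (auto simp: param_in)

lemma borel_measurable_chart_density: "c \<in> A \<Longrightarrow> chart_density c \<in> borel_measurable borel"
  using borel_measurable_continuous_on_indicator[OF _ continuous_on_chart_density[of c]] open_coord[of c]
  by (simp add: chart_density_def[abs_def])

lemma measurable_total_param:
  assumes "c \<in> A" shows "total_param c \<in> borel \<rightarrow>\<^sub>M borel"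
proof (rule borel_measurableI)
  fix W :: "'a set" assume W: "open W"
  have "total_param c -` W \<inter> space borel
      = (snd c ` fst c \<inter> param c -` W) \<union> (if undefined \<in> W then - (snd c ` fst c) else {})"
    by (auto simp: total_param_def split: if_splits)
  thus "total_param c -` W \<inter> space borel \<in> sets borel"
    using continuous_open_preimage[OF continuous_on_param[OF assms] open_coord[OF assms] W] open_coord[OF assms]
    by auto
qed

lemma sets_chart_measure [simp]: "sets (chart_measure c) = sets borel"
  by (simp add: chart_measure_def)

lemma emeasure_chart_measure:
  assumes c: "c \<in> A" and B: "B \<in> sets borel"
  shows "emeasure (chart_measure c) B = chart_volume c (fst c \<inter> B)"
proof -
  have "emeasure (chart_measure c) B
      = (\<integral>\<^sup>+z. ennreal (chart_density c z) * indicator (total_param c -` B) z \<partial>lborel)"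
    using measurable_total_param[OF c] borel_measurable_chart_density[OF c] B measurable_sets[OF measurable_total_param[OF c] B]
    by (simp add: chart_measure_def emeasure_distr emeasure_density)
  also have "\<dots> = chart_volume c (fst c \<inter> B)"
    unfolding chart_volume_def coord_image_eq[OF c]
    by (intro nn_integral_cong) (auto simp: indicator_def chart_density_def total_param_def)
  finally show ?thesis .
qed

text \<open>The factor by which the metric changes between two charts is exactly the Jacobian of the
  holomorphic coordinate change.\<close>

lemma chart_volume_transition:
  assumes c: "c \<in> A" and d: "d \<in> A" and B: "B \<in> sets borel" "B \<subseteq> fst c" "B \<subseteq> fst d"
  shows "chart_volume c B = chart_volume d B"
proof -
  define \<phi> where "\<phi> = (\<lambda>z. snd c (param d z))"
  define T where "T = snd d ` (fst d \<inter> fst c)"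
  define w where "w = (\<lambda>y. ennreal (chart_density c y) * indicator (total_param c -` B) y)"
  have T: "open T" unfolding T_def by (rule open_coord_image[OF d open_chart[OF c]])
  have hol: "\<phi> holomorphic_on T" unfolding \<phi>_def T_def by (rule transition[OF d c])
  have inj: "inj_on \<phi> T"
  proof (rule inj_onI)
    fix z z' assume "z \<in> T" "z' \<in> T" and eq: "\<phi> z = \<phi> z'"
    then obtain p p' where p: "p \<in> fst c" "p \<in> fst d" "z = snd d p" "p' \<in> fst c" "p' \<in> fst d" "z' = snd d p'"
      by (auto simp: T_def)
    hence "snd c p = snd c p'" using eq d by (simp add: \<phi>_def)
    hence "p = p'" using param_coord[OF c p(1)] param_coord[OF c p(4)] by metis
    thus "z = z'" using p by simp
  qed
  have w: "w \<in> borel_measurable borel"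
    unfolding w_def using measurable_sets[OF measurable_total_param[OF c] B(1)]
      borel_measurable_chart_density[OF c] by auto
  have "chart_volume c B = (\<integral>\<^sup>+y. w y * indicator (\<phi> ` T) y \<partial>lborel)"
    unfolding chart_volume_def
  proof (intro nn_integral_cong)
    fix y
    have "\<phi> ` T = snd c ` (fst d \<inter> fst c)"
      unfolding T_def \<phi>_def image_image using d by (intro image_cong) auto
    hence T': "y \<in> \<phi> ` T" if "y \<in> snd c ` B" using that B by blast
    have iff: "y \<in> snd c ` fst c \<and> param c y \<in> B \<longleftrightarrow> y \<in> snd c ` B"
      using coord_image_eq[OF c, of B] B(2) by (auto simp: Int_absorb1)
    show "ennreal (h c (param c y) / pi) * indicator (snd c ` B) y = w y * indicator (\<phi> ` T) y"
    proof (cases "y \<in> snd c ` B")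
      case True
      thus ?thesis using T' iff by (simp add: w_def chart_density_def total_param_def)
    next
      case False
      hence "w y = 0" using iff by (auto simp: w_def chart_density_def total_param_def indicator_def)
      thus ?thesis using False by simp
    qed
  qed
  also have "\<dots> = (\<integral>\<^sup>+z. ennreal ((cmod (deriv \<phi> z))\<^sup>2) * w (\<phi> z) * indicator T z \<partial>lborel)"
    by (rule nn_integral_holomorphic_substitution[OF T hol inj w])
  also have "\<dots> = chart_volume d B"
    unfolding chart_volume_def
  proof (intro nn_integral_cong)
    fix z
    show "ennreal ((cmod (deriv \<phi> z))\<^sup>2) * w (\<phi> z) * indicator T z
        = ennreal (h d (param d z) / pi) * indicator (snd d ` B) z"
    proof (cases "z \<in> T")
      case True
      then obtain p where p: "p \<in> fst d" "p \<in> fst c" "z = snd d p" by (auto simp: T_def)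
      have 1: "\<phi> z = snd c p" "param d z = p" using p d by (auto simp: \<phi>_def)
      have 2: "h d p = (cmod (deriv \<phi> z))\<^sup>2 * h c p"
        using metric_transition[OF c d p(2,1)] p(3) by (simp add: \<phi>_def)
      have 3: "total_param c (snd c p) = p" using p c by (simp add: total_param_def)
      have "ennreal ((cmod (deriv \<phi> z))\<^sup>2) * ennreal (h c p / pi) = ennreal (h d p / pi)"
        using metric_pos[OF c p(2)] by (subst ennreal_mult'[symmetric]) (auto simp: 2)
      moreover have "w (\<phi> z) = ennreal (h c p / pi) * indicator B p"
        unfolding w_def 1 using p c 3 by (simp add: chart_density_def indicator_def)
      moreover have "indicator (snd d ` B) z = (indicator B p :: ennreal)"
        using coord_in_image_iff[OF d p(1) B(3)] by (simp add: indicator_def p(3))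
      ultimately show ?thesis using True 1 by (simp add: mult.assoc[symmetric])
    next
      case False
      hence "z \<notin> snd d ` B" using B by (auto simp: T_def)
      thus ?thesis using False by simp
    qed
  qed
  finally show ?thesis .
qed

definition is_volume_measure :: "'a measure \<Rightarrow> bool" where
  "is_volume_measure \<mu> \<longleftrightarrow> sets \<mu> = sets borel \<and>
    (\<forall>c\<in>A. \<forall>B\<in>sets borel. B \<subseteq> fst c \<longrightarrow> emeasure \<mu> B = chart_volume c B)"

text \<open>\<open>volume_measure\<close> is a definite description, so both existence and
  uniqueness are required. Finitely many charts cover the compact surface; cutting their domains
  into disjoint Borel pieces forces the value of the measure on every Borel set and also provides a
  formula for it.\<close>

lemma ex1_volume_measure: "\<exists>!\<mu>. is_volume_measure \<mu>"
proof -
  obtain I where I: "finite I" "\<And>c a r. (c, a, r) \<in> I \<Longrightarrow> c \<in> A \<and> r > 0 \<and> cball a r \<subseteq> snd c ` fst c"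
    "\<And>q. \<exists>c a r. (c, a, r) \<in> I \<and> q \<in> fst c \<and> snd c q \<in> ball a (r / 2)"
    using finite_disc_cover by blast
  obtain cs :: "nat \<Rightarrow> 'a chart" and n where cs: "fst ` I = cs ` {i. i < n}"
    using finite_imp_nat_seg_image_inj_on[OF finite_imageI[OF I(1), of fst]] by metis
  have csA: "cs k \<in> A" if "k < n" for k
  proof -
    have "cs k \<in> fst ` I" using cs that by blast
    thus ?thesis using I(2) by auto
  qed
  \<comment> \<open>\<open>disjointed\<close> acts on infinite sequences, so the finite list of
    chart domains is padded with empty sets.\<close>
  define D where "D = disjointed (\<lambda>k. if k < n then fst (cs k) else {})"
  have D: "D k \<subseteq> fst (cs k)" "D k \<in> sets borel" if "k < n" for k
  proof -
    show "D k \<subseteq> fst (cs k)"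
      using disjointed_subset[of "\<lambda>k. if k < n then fst (cs k) else {}" k] that by (simp add: D_def)
    have "range (\<lambda>k. if k < n then fst (cs k) else {}) \<subseteq> sets (borel :: 'a measure)"
      using open_chart[OF csA] by (auto intro!: borel_open)
    thus "D k \<in> sets borel"
      using sets.range_disjointed_sets unfolding D_def by blast
  qed
  have disj: "disjoint_family D" unfolding D_def by (rule disjoint_family_disjointed)
  have cover: "(\<Union>k<n. D k) = UNIV"
  proof -
    have "p \<in> (\<Union>k<n. D k)" for p
    proof -
      obtain c where "c \<in> fst ` I" "p \<in> fst c" using I(3)[of p] by force
      hence "p \<in> (\<Union>k. if k < n then fst (cs k) else {})" using cs by auto
      hence "p \<in> (\<Union>k. D k)" unfolding D_def UN_disjointed_eq .
      then obtain k where k: "p \<in> D k" by blast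
      have "k < n" using k disjointed_subset[of "\<lambda>k. if k < n then fst (cs k) else {}" k]
        by (auto simp: D_def split: if_splits)
      thus ?thesis using k by blast
    qed
    thus ?thesis by blast
  qed
  define f where "f B = (\<Sum>k<n. emeasure (chart_measure (cs k)) (B \<inter> D k))" for B
  have sum_eq: "emeasure \<mu> B = f B" if \<mu>: "is_volume_measure \<mu>" and B: "B \<in> sets borel" for \<mu> B
  proof -
    have "emeasure \<mu> B = emeasure \<mu> (\<Union>k<n. B \<inter> D k)"
      using cover by (intro arg_cong[where f = "emeasure \<mu>"]) auto
    also have "\<dots> = (\<Sum>k<n. emeasure \<mu> (B \<inter> D k))"
      using \<mu> B D(2) disj
      by (intro sum_emeasure[symmetric]) (auto simp: is_volume_measure_def disjoint_family_on_def)
    also have "\<dots> = f B"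
      unfolding f_def
    proof (intro sum.cong refl)
      fix k assume k: "k \<in> {..<n}"
      have "fst (cs k) \<inter> (B \<inter> D k) = B \<inter> D k" using D k by auto
      moreover have BD: "B \<inter> D k \<in> sets borel" using B D(2) k by auto
      moreover have "emeasure \<mu> (B \<inter> D k) = chart_volume (cs k) (B \<inter> D k)"
        using \<mu> csA[of k] k BD D(1)[of k] unfolding is_volume_measure_def by (metis inf.coboundedI2 lessThan_iff)
      ultimately show "emeasure \<mu> (B \<inter> D k) = emeasure (chart_measure (cs k)) (B \<inter> D k)"
        using emeasure_chart_measure[of "cs k" "B \<inter> D k"] csA[of k] k by simp
    qed
    finally show ?thesis .
  qed
  \<comment> \<open>Every piece of \<open>B\<close> lies in its own chart and in \<open>c\<close>,
    so all of them can be measured in \<open>c\<close> and added up there.\<close>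
  have f_chart: "f B = chart_volume c B" if c: "c \<in> A" and B: "B \<in> sets borel" "B \<subseteq> fst c" for c B
  proof -
    have "f B = (\<Sum>k<n. emeasure (chart_measure c) (B \<inter> D k))"
      unfolding f_def
    proof (intro sum.cong refl)
      fix k assume k: "k \<in> {..<n}"
      have eq: "fst (cs k) \<inter> (B \<inter> D k) = B \<inter> D k" "fst c \<inter> (B \<inter> D k) = B \<inter> D k" using D k B by auto
      have BD: "B \<inter> D k \<in> sets borel" using B D(2) k by auto
      have "chart_volume (cs k) (B \<inter> D k) = chart_volume c (B \<inter> D k)"
        using chart_volume_transition[of "cs k" c, OF _ c BD] csA[of k] D(1)[of k] k B by auto
      thus "emeasure (chart_measure (cs k)) (B \<inter> D k) = emeasure (chart_measure c) (B \<inter> D k)"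
        using emeasure_chart_measure[OF _ BD] csA[of k] c k eq by auto
    qed
    also have "\<dots> = emeasure (chart_measure c) (\<Union>k<n. B \<inter> D k)"
      using B D(2) disj by (intro sum_emeasure) (auto simp: disjoint_family_on_def, blast)
    also have "(\<Union>k<n. B \<inter> D k) = B" using cover by auto
    also have "emeasure (chart_measure c) B = chart_volume c B"
      using emeasure_chart_measure[OF c B(1)] B(2) by (simp add: Int_absorb1)
    finally show ?thesis .
  qed
  define \<mu> where "\<mu> = measure_of UNIV (sets (borel :: 'a measure)) f"
  have em: "emeasure \<mu> B = f B" if "B \<in> sets borel" for B
  proof -
    have sa: "sigma_algebra UNIV (sets (borel :: 'a measure))"
      using sets.sigma_algebra_axioms[of "borel :: 'a measure"] by simp
    have pos: "positive (sets (borel :: 'a measure)) f" by (simp add: positive_def f_def)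
    have ca: "countably_additive (sets (borel :: 'a measure)) f"
    proof (rule countably_additiveI)
      fix X :: "nat \<Rightarrow> 'a set" assume X: "range X \<subseteq> sets borel" "disjoint_family X"
      have "(\<Sum>i. f (X i)) = (\<Sum>k<n. \<Sum>i. emeasure (chart_measure (cs k)) (X i \<inter> D k))"
        unfolding f_def by (intro suminf_sum) auto
      also have "\<dots> = f (\<Union>i. X i)"
        unfolding f_def
      proof (intro sum.cong refl)
        fix k assume k: "k \<in> {..<n}"
        have "(\<Sum>i. emeasure (chart_measure (cs k)) (X i \<inter> D k))
            = emeasure (chart_measure (cs k)) (\<Union>i. X i \<inter> D k)"
          using X D(2)[of k] k by (intro suminf_emeasure) (auto simp: disjoint_family_on_def)
        thus "(\<Sum>i. emeasure (chart_measure (cs k)) (X i \<inter> D k))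
            = emeasure (chart_measure (cs k)) ((\<Union>i. X i) \<inter> D k)" by simp
      qed
      finally show "(\<Sum>i. f (X i)) = f (\<Union>i. X i)" .
    qed
    show ?thesis unfolding \<mu>_def by (rule emeasure_measure_of_sigma[OF sa pos ca that])
  qed
  have sets\<mu>: "sets \<mu> = sets borel"
    unfolding \<mu>_def using sets.sets_measure_of_eq[of "borel :: 'a measure" f] by simp
  have "is_volume_measure \<mu>"
    unfolding is_volume_measure_def using sets\<mu> em f_chart by auto
  moreover have "\<mu>' = \<mu>" if "is_volume_measure \<mu>'" for \<mu>'
  proof (rule measure_eqI)
    show "sets \<mu>' = sets \<mu>" using that sets\<mu> by (simp add: is_volume_measure_def)
    show "emeasure \<mu>' B = emeasure \<mu> B" if "B \<in> sets \<mu>'" for B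
      using sum_eq[OF \<open>is_volume_measure \<mu>'\<close>] em that \<open>sets \<mu>' = sets \<mu>\<close> sets\<mu> by auto
  qed
  ultimately show ?thesis by blast
qed

abbreviation vol :: "'a measure" where "vol \<equiv> volume_measure A h"

lemma is_volume_measure_vol: "is_volume_measure vol"
proof -
  have "volume_measure A h = (THE \<mu>. is_volume_measure \<mu>)"
    unfolding volume_measure_def is_volume_measure_def chart_volume_def ..
  thus ?thesis using theI'[OF ex1_volume_measure] by simp
qed

lemma sets_vol [simp, measurable_cong]: "sets vol = sets borel"
  using is_volume_measure_vol by (simp add: is_volume_measure_def)

lemma space_vol [simp]: "space vol = UNIV"
  using sets_eq_imp_space_eq[OF sets_vol] by simp

lemma emeasure_vol: "c \<in> A \<Longrightarrow> B \<in> sets borel \<Longrightarrow> B \<subseteq> fst c \<Longrightarrow> emeasure vol B = chart_volume c B"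
  using is_volume_measure_vol by (simp add: is_volume_measure_def)

text \<open>Finitely many closed coordinate discs cover the surface, and on each of them the
  continuous density is bounded.\<close>

lemma finite_measure_vol: "finite_measure vol"
proof -
  obtain I where I: "finite I" "\<And>c a r. (c, a, r) \<in> I \<Longrightarrow> c \<in> A \<and> r > 0 \<and> cball a r \<subseteq> snd c ` fst c"
    "\<And>q. \<exists>c a r. (c, a, r) \<in> I \<and> q \<in> fst c \<and> snd c q \<in> ball a (r / 2)"
    using finite_disc_cover by blast
  define W :: "'a chart \<times> complex \<times> real \<Rightarrow> 'a set"
    where "W = (\<lambda>(c, a, r). param c ` cball a r)"
  have W: "emeasure vol (W i) < \<infinity>" "W i \<in> sets borel" if "i \<in> I" for i
  proof -
    obtain c a r where i: "i = (c, a, r)" by (cases i)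
    note c = I(2)[of c a r, folded i, OF that]
    have "compact (W i)" unfolding W_def i prod.case
      by (rule compact_param_image) (use c in auto)
    thus Wb: "W i \<in> sets borel" by (simp add: borel_closed compact_imp_closed)
    have Wc: "W i \<subseteq> fst c" using c by (auto simp: W_def i intro!: param_in)
    have im: "snd c ` W i = cball a r" unfolding W_def i prod.case image_image
      using c by (auto simp: subset_iff image_iff)
    have "bounded ((\<lambda>z. h c (param c z) / pi) ` cball a r)"
      by (intro compact_imp_bounded compact_continuous_image continuous_on_subset[OF continuous_on_chart_density]) (use c in auto)
    then obtain M where M: "\<And>z. z \<in> cball a r \<Longrightarrow> \<bar>h c (param c z) / pi\<bar> \<le> M"
      unfolding bounded_real by blast
    have "emeasure vol (W i) = (\<integral>\<^sup>+ z. ennreal (h c (param c z) / pi) * indicator (cball a r) z \<partial>lborel)"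
      using emeasure_vol[OF _ Wb Wc] c by (simp add: chart_volume_def im)
    also have "\<dots> \<le> (\<integral>\<^sup>+ z. ennreal M * indicator (cball a r) z \<partial>lborel)"
    proof (intro nn_integral_mono)
      fix z
      show "ennreal (h c (param c z) / pi) * indicator (cball a r) z \<le> ennreal M * indicator (cball a r) z"
        using abs_le_D1[OF M[of z]] by (cases "z \<in> cball a r") (simp_all add: ennreal_leI)
    qed
    also have "\<dots> = ennreal M * emeasure lborel (cball a r)"
      by (simp add: nn_integral_cmult_indicator)
    also have "\<dots> < \<infinity>"
      using emeasure_bounded_finite[of "cball a r"] by (simp add: ennreal_mult_less_top)
    finally show "emeasure vol (W i) < \<infinity>" .
  qed
  have "UNIV \<subseteq> (\<Union>i\<in>I. W i)"
  proof
    fix q :: 'a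
    obtain c a r where "(c, a, r) \<in> I" "q \<in> fst c" "snd c q \<in> ball a (r / 2)" using I(3)[of q] by auto
    moreover from this I(2)[of c a r] have "snd c q \<in> cball a r" "c \<in> A" by auto
    ultimately have "q \<in> W (c, a, r)" by (auto simp: W_def image_iff intro!: bexI[of _ "snd c q"])
    with \<open>(c, a, r) \<in> I\<close> show "q \<in> (\<Union>i\<in>I. W i)" by blast
  qed
  hence "emeasure vol UNIV \<le> emeasure vol (\<Union>i\<in>I. W i)"
    using I(1) W(2) by (intro emeasure_mono) auto
  also have "\<dots> \<le> (\<Sum>i\<in>I. emeasure vol (W i))"
    using I(1) W(2) by (intro emeasure_subadditive_finite) auto
  also have "\<dots> < \<infinity>" using I(1) W(1) by (simp add: less_top)
  finally show ?thesis by (intro finite_measureI) auto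
qed

text \<open>Weighting the volume with the indicator of the chart domain gives
  \<open>chart_measure c\<close>, whose integral unfolds to one over the coordinate plane.\<close>

lemma integral_vol_chart:
  fixes f :: "'a \<Rightarrow> 'b::{banach, second_countable_topology}"
  assumes c: "c \<in> A" and f: "f \<in> borel_measurable borel"
  shows "(\<integral>p. indicator (fst c) p *\<^sub>R f p \<partial>vol)
    = (\<integral>z. indicator (snd c ` fst c) z *\<^sub>R ((h c (param c z) / pi) *\<^sub>R f (param c z)) \<partial>lborel)"
proof -
  have U: "fst c \<in> sets borel" using open_chart[OF c] by simp
  have "density vol (\<lambda>p. ennreal (indicator (fst c) p)) = chart_measure c"
  proof (rule measure_eqI)
    fix B assume "B \<in> sets (density vol (\<lambda>p. ennreal (indicator (fst c) p)))"
    hence B: "B \<in> sets borel" by simp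
    have "emeasure (density vol (\<lambda>p. ennreal (indicator (fst c) p))) B
        = (\<integral>\<^sup>+p. ennreal (indicator (fst c) p) * indicator B p \<partial>vol)"
      using U B by (intro emeasure_density) auto
    also have "\<dots> = (\<integral>\<^sup>+p. indicator (fst c \<inter> B) p \<partial>vol)"
      by (intro nn_integral_cong) (simp add: indicator_def)
    also have "\<dots> = emeasure vol (fst c \<inter> B)" using U B by (intro nn_integral_indicator) auto
    also have "\<dots> = emeasure (chart_measure c) B"
      using emeasure_vol[OF c, of "fst c \<inter> B"] emeasure_chart_measure[OF c B] U B by auto
    finally show "emeasure (density vol (\<lambda>p. ennreal (indicator (fst c) p))) B = emeasure (chart_measure c) B" .
  qed simp
  hence "integral\<^sup>L (density vol (\<lambda>p. ennreal (indicator (fst c) p))) f = integral\<^sup>L (chart_measure c) f"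
    by simp
  also have "integral\<^sup>L (density vol (\<lambda>p. ennreal (indicator (fst c) p))) f
      = (\<integral>p. indicator (fst c) p *\<^sub>R f p \<partial>vol)"
    using f U by (intro integral_density) auto
  also have "integral\<^sup>L (chart_measure c) f
      = (\<integral>z. f (total_param c z) \<partial>density lborel (\<lambda>z. ennreal (chart_density c z)))"
    unfolding chart_measure_def using f measurable_total_param[OF c] by (intro integral_distr) auto
  also have "\<dots> = (\<integral>z. chart_density c z *\<^sub>R f (total_param c z) \<partial>lborel)"
    using measurable_compose[OF measurable_total_param[OF c] f] borel_measurable_chart_density[OF c]
      chart_density_nonneg[OF c] by (intro integral_density) auto
  also have "\<dots> = (\<integral>z. indicator (snd c ` fst c) z *\<^sub>R ((h c (param c z) / pi) *\<^sub>R f (param c z)) \<partial>lborel)"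
    by (intro Bochner_Integration.integral_cong) (auto simp: chart_density_def total_param_def indicator_def)
  finally show ?thesis .
qed

end

section \<open>The Laplacian on smooth functions\<close>

lemma (in riemann_surface) continuous_on_charts:
  assumes "\<And>c. c \<in> A \<Longrightarrow> continuous_on (snd c ` fst c) (\<lambda>z. f (param c z))"
  shows "continuous_on UNIV f"
proof -
  have "continuous_on (fst c) f" if c: "c \<in> A" for c
  proof -
    have "continuous_on (fst c) (\<lambda>p. f (param c (snd c p)))"
      by (rule continuous_on_compose2[OF assms[OF c] continuous_on_coord[OF c]]) simp
    thus ?thesis by (rule continuous_on_eq) (simp add: c)
  qed
  hence "isCont f p" for p
    using chart_exists[of p] open_chart continuous_on_eq_continuous_at by blast
  thus ?thesis by (simp add: continuous_at_imp_continuous_on)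
qed

lemma (in riemann_surface) continuous_imp_measurable_bounded:
  fixes f :: "'a \<Rightarrow> complex"
  assumes "continuous_on UNIV f"
  shows "f \<in> borel_measurable borel" "\<exists>B. \<forall>p. cmod (f p) \<le> B"
proof -
  show "f \<in> borel_measurable borel" using assms by (rule borel_measurable_continuous_onI)
  have "compact (UNIV :: 'a set)" using surface unfolding compact_riemann_surface_def by blast
  hence "bounded (range f)" by (intro compact_imp_bounded compact_continuous_image assms)
  thus "\<exists>B. \<forall>p. cmod (f p) \<le> B" by (auto simp: bounded_iff)
qed

context riemann_surface
begin

lemma smooth_functionsD:
  "\<xi> \<in> smooth_functions A \<Longrightarrow> c \<in> A \<Longrightarrow> smooth_on (snd c ` fst c) (\<lambda>z. \<xi> (param c z))"
  by (simp add: smooth_functions_def surface_smooth_on_def o_def)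

lemma smooth_functionsI:
  "(\<And>c. c \<in> A \<Longrightarrow> smooth_on (snd c ` fst c) (\<lambda>z. \<xi> (param c z))) \<Longrightarrow> \<xi> \<in> smooth_functions A"
  by (simp add: smooth_functions_def surface_smooth_on_def o_def)

lemma smooth_functions_const: "(\<lambda>_. a) \<in> smooth_functions A"
  by (rule smooth_functionsI) (rule smooth_on_const)

lemma smooth_functions_add:
  "\<xi> \<in> smooth_functions A \<Longrightarrow> \<eta> \<in> smooth_functions A \<Longrightarrow> (\<lambda>p. \<xi> p + \<eta> p) \<in> smooth_functions A"
  by (rule smooth_functionsI, rule smooth_on_add) (simp_all add: open_coord smooth_functionsD)

lemma smooth_functions_mult:
  "\<xi> \<in> smooth_functions A \<Longrightarrow> \<eta> \<in> smooth_functions A \<Longrightarrow> (\<lambda>p. \<xi> p * \<eta> p) \<in> smooth_functions A"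
  by (rule smooth_functionsI, rule smooth_on_mult) (simp_all add: open_coord smooth_functionsD)

lemma smooth_functions_diff:
  "\<xi> \<in> smooth_functions A \<Longrightarrow> \<eta> \<in> smooth_functions A \<Longrightarrow> (\<lambda>p. \<xi> p - \<eta> p) \<in> smooth_functions A"
  by (rule smooth_functionsI, rule smooth_on_diff) (simp_all add: open_coord smooth_functionsD)

lemma smooth_functions_continuous: "\<xi> \<in> smooth_functions A \<Longrightarrow> continuous_on UNIV \<xi>"
  by (rule continuous_on_charts) (rule smooth_on_imp_continuous_on[OF smooth_functionsD])

text \<open>The definition of \<open>laplacian\<close> picks some chart \<open>d\<close> at
  \<open>p\<close>. Passing from \<open>d\<close> to \<open>c\<close> multiplies the mixed
  derivative and the metric by the same squared modulus, which cancels.\<close>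

lemma laplacian_chart:
  assumes h: "hermitian_metric (tangent_bundle A) h" and \<xi>: "\<xi> \<in> smooth_functions A"
    and c: "c \<in> A" "p \<in> fst c"
  shows "laplacian A h \<xi> p
    = - inverse (complex_of_real (h c p)) * d_z_zbar (\<lambda>z. \<xi> (param c z)) (snd c p)"
proof -
  define d where "d = (SOME d. d \<in> A \<and> p \<in> fst d)"
  have "d \<in> A \<and> p \<in> fst d" unfolding d_def by (rule someI_ex) (use c in blast)
  hence d: "d \<in> A" "p \<in> fst d" by auto
  define \<phi> where "\<phi> = (\<lambda>z. snd d (param c z))"
  define T where "T = snd c ` (fst c \<inter> fst d)"
  have T: "open T" unfolding T_def by (rule open_coord_image[OF c(1) open_chart[OF d(1)]])
  have pT: "snd c p \<in> T" using c d by (auto simp: T_def)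
  have \<phi>p: "\<phi> (snd c p) = snd d p" using c by (simp add: \<phi>_def)
  have "d_z_zbar (\<lambda>z. \<xi> (param c z)) (snd c p) = d_z_zbar (\<lambda>z. \<xi> (param d (\<phi> z))) (snd c p)"
  proof (rule d_z_zbar_cong_open[OF T pT])
    fix z assume "z \<in> T"
    then obtain q where "q \<in> fst c" "q \<in> fst d" "z = snd c q" by (auto simp: T_def)
    thus "\<xi> (param c z) = \<xi> (param d (\<phi> z))" using c d by (simp add: \<phi>_def)
  qed
  also have "\<dots> = complex_of_real ((cmod (deriv \<phi> (snd c p)))\<^sup>2) * d_z_zbar (\<lambda>z. \<xi> (param d z)) (\<phi> (snd c p))"
  proof (rule d_z_zbar_compose_holomorphic[OF open_coord[OF d(1)] smooth_functionsD[OF \<xi> d(1)] T _ _ pT])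
    show "\<phi> holomorphic_on T" unfolding \<phi>_def T_def by (rule transition[OF c(1) d(1)])
    show "\<phi> ` T \<subseteq> snd d ` fst d" unfolding \<phi>_def T_def using c by auto
  qed
  finally have 1: "d_z_zbar (\<lambda>z. \<xi> (param c z)) (snd c p)
      = complex_of_real ((cmod (deriv \<phi> (snd c p)))\<^sup>2) * d_z_zbar (\<lambda>z. \<xi> (param d z)) (snd d p)"
    by (simp only: \<phi>p)
  have 2: "h c p = (cmod (deriv \<phi> (snd c p)))\<^sup>2 * h d p" "h c p > 0"
    using h c d unfolding hermitian_metric_def tangent_bundle_sel o_def \<phi>_def by blast+
  hence nz: "(cmod (deriv \<phi> (snd c p)))\<^sup>2 \<noteq> 0" by auto
  have "laplacian A h \<xi> p = - inverse (complex_of_real (h d p)) * d_z_zbar (\<lambda>z. \<xi> (param d z)) (snd d p)"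
    unfolding laplacian_def d_def[symmetric] by (simp add: o_def)
  also have "\<dots> = - inverse (complex_of_real (h c p)) * d_z_zbar (\<lambda>z. \<xi> (param c z)) (snd c p)"
    unfolding 1 2(1) of_real_mult using nz by (simp add: field_simps del: of_real_power)
  finally show ?thesis .
qed

lemma laplacian_smooth:
  assumes h: "smooth_metric A (tangent_bundle A) h" and \<xi>: "\<xi> \<in> smooth_functions A"
  shows "laplacian A h \<xi> \<in> smooth_functions A"
proof (rule smooth_functionsI)
  fix c assume c: "c \<in> A"
  have herm: "hermitian_metric (tangent_bundle A) h" using h by (simp add: smooth_metric_def)
  have pos: "h c p > 0" if "p \<in> fst c" for p
    using herm c that unfolding hermitian_metric_def tangent_bundle_sel by blast
  hence nz: "complex_of_real (h c (param c z)) \<noteq> 0" if "z \<in> snd c ` fst c" for z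
    using param_in[OF c that] by (metis less_irrefl of_real_eq_0_iff)
  have "surface_smooth_on A (fst c) (h c)"
    using h c unfolding smooth_metric_def tangent_bundle_sel by blast
  hence hs: "smooth_on (snd c ` fst c) (\<lambda>z. h c (param c z))"
    using c unfolding surface_smooth_on_def o_def by auto
  have "smooth_on (snd c ` fst c)
      (\<lambda>z. - inverse (complex_of_real (h c (param c z))) * d_z_zbar (\<lambda>z. \<xi> (param c z)) z)"
    by (intro smooth_on_mult smooth_on_minus smooth_on_inverse smooth_on_d_z_zbar open_coord
        smooth_on_linear[OF bounded_linear_of_real] hs smooth_functionsD[OF \<xi>] c nz)
  thus "smooth_on (snd c ` fst c) (\<lambda>z. laplacian A h \<xi> (param c z))"
    by (subst smooth_on_cong_open[OF open_coord[OF c],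
          of _ "\<lambda>z. - inverse (complex_of_real (h c (param c z))) * d_z_zbar (\<lambda>z. \<xi> (param c z)) z"])
      (simp_all add: laplacian_chart[OF herm \<xi> c param_in[OF c]] c)
qed

text \<open>The cutoff that interpolates the metrics is composed with a smooth function of the
  coordinate and extended by zero off the chart.\<close>

lemma bump_exists:
  assumes \<rho>: "cutoff_function \<rho>" and c: "c \<in> A" and r: "r > 0" "cball a r \<subseteq> snd c ` fst c"
  shows "\<exists>\<beta>\<in>smooth_functions A. (\<forall>p\<in>fst c. snd c p \<in> ball a (r / 2) \<longrightarrow> \<beta> p = 1) \<and>
    (\<forall>p. p \<notin> param c ` cball a r \<longrightarrow> \<beta> p = 0)"
proof -
  \<comment> \<open>The squared modulus keeps the argument smooth at the centre. The argument is at
    most 0 when \<open>cmod (w - a) \<ge> r\<close> and at least \<open>3 / 2\<close> on the half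
    disc, so \<open>\<rho>\<close> takes the values 0 and 1 there.\<close>
  define b where "b w = complex_of_real (\<rho> (2 - 2 / r\<^sup>2 * (cmod (w - a))\<^sup>2))" for w
  define \<beta> where "\<beta> p = (if p \<in> fst c then b (snd c p) else 0)" for p
  define K where "K = param c ` cball a r"
  have K: "closed K" unfolding K_def
    by (rule compact_imp_closed[OF compact_param_image[OF c compact_cball r(2)]])
  have \<rho>': "smooth_on UNIV \<rho>" "\<And>t. t \<le> 0 \<Longrightarrow> \<rho> t = 0" "\<And>t. t \<ge> 1 \<Longrightarrow> \<rho> t = 1"
    using \<rho> by (auto simp: cutoff_function_def)
  have zero: "\<beta> p = 0" if "p \<notin> K" for p
  proof (cases "p \<in> fst c")
    case True
    have "snd c p \<notin> cball a r" using that param_coord[OF c True] unfolding K_def by (metis image_eqI)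
    hence "r \<le> cmod (snd c p - a)" by (simp add: dist_norm norm_minus_commute)
    hence "r\<^sup>2 \<le> (cmod (snd c p - a))\<^sup>2" using r(1) by (simp add: power_mono)
    hence "2 - 2 / r\<^sup>2 * (cmod (snd c p - a))\<^sup>2 \<le> 0" using r(1) by (simp add: field_simps)
    thus ?thesis by (simp add: \<beta>_def b_def \<rho>'(2))
  qed (simp add: \<beta>_def)
  have one: "\<beta> p = 1" if "p \<in> fst c" "snd c p \<in> ball a (r / 2)" for p
  proof -
    have "cmod (snd c p - a) \<le> r / 2" using that(2) by (simp add: dist_norm norm_minus_commute)
    hence "(cmod (snd c p - a))\<^sup>2 \<le> (r / 2)\<^sup>2" by (simp add: power_mono)
    hence "2 / r\<^sup>2 * (cmod (snd c p - a))\<^sup>2 \<le> 2 / r\<^sup>2 * (r / 2)\<^sup>2" by (intro mult_left_mono) auto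
    also have "\<dots> = 1 / 2" using r(1) by (simp add: power2_eq_square)
    finally have "2 - 2 / r\<^sup>2 * (cmod (snd c p - a))\<^sup>2 \<ge> 1" by simp
    thus ?thesis using that(1) by (simp add: \<beta>_def b_def \<rho>'(3))
  qed
  have "\<beta> \<in> smooth_functions A"
  proof (rule smooth_functionsI, rule smooth_on_local)
    fix d z assume d: "d \<in> A" and z: "z \<in> snd d ` fst d"
    define T where "T = snd d ` (fst d \<inter> fst c)"
    \<comment> \<open>In the chart \<open>d\<close>, the set \<open>T\<close> sees
      \<open>\<beta>\<close> through the formula in the coordinate of \<open>c\<close>, while on
      \<open>T'\<close> it is 0. The two cover because \<open>K\<close> lies inside the domain of
      \<open>c\<close>.\<close>
    define T' where "T' = snd d ` (fst d \<inter> - K)"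
    have o: "open T" "open T'"
      unfolding T_def T'_def using open_coord_image[OF d] open_chart[OF c] K by auto
    have "smooth_on T (\<lambda>z. snd c (param d z))"
      unfolding T_def by (rule holomorphic_imp_smooth_on[OF o(1)[unfolded T_def] transition[OF d c]])
    from smooth_on_cmod_power2[OF o(1) smooth_on_diff[OF o(1) this smooth_on_const]]
    have "smooth_on T (\<lambda>z. (cmod (snd c (param d z) - a))\<^sup>2)" .
    from smooth_on_diff[OF o(1) smooth_on_const smooth_on_mult[OF o(1) smooth_on_const this]]
    have "smooth_on T (\<lambda>z. 2 - 2 / r\<^sup>2 * (cmod (snd c (param d z) - a))\<^sup>2)" .
    from smooth_on_linear[OF bounded_linear_of_real o(1) smooth_on_compose_real[OF o(1) this \<rho>'(1)]]
    have "smooth_on T (\<lambda>z. b (snd c (param d z)))" unfolding b_def .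
    moreover have "\<beta> (param d y) = b (snd c (param d y))" if "y \<in> T" for y
      using that d by (auto simp: T_def \<beta>_def)
    ultimately have 1: "smooth_on T (\<lambda>z. \<beta> (param d z))"
      using smooth_on_cong_open[OF o(1), of "\<lambda>z. \<beta> (param d z)" "\<lambda>z. b (snd c (param d z))"] by simp
    have "\<beta> (param d y) = 0" if "y \<in> T'" for y
      using that d zero by (auto simp: T'_def)
    hence 2: "smooth_on T' (\<lambda>z. \<beta> (param d z))"
      using smooth_on_cong_open[OF o(2), of "\<lambda>z. \<beta> (param d z)" "\<lambda>_. 0"] smooth_on_const by simp
    have "K \<subseteq> fst c" unfolding K_def using r(2) param_in[OF c] by blast
    hence "z \<in> T \<or> z \<in> T'" using z by (auto simp: T_def T'_def)
    thus "\<exists>T. open T \<and> z \<in> T \<and> smooth_on T (\<lambda>z. \<beta> (param d z))" using 1 2 o by blast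
  qed
  thus ?thesis using zero one unfolding K_def by blast
qed

end

section \<open>Symmetry of the Laplacian of a continuous metric\<close>

context surface_metric
begin

lemma hermitian: "hermitian_metric (tangent_bundle A) h"
  using continuous_metric by (simp add: continuous_metric_def)

lemma laplacian_continuous:
  assumes \<xi>: "\<xi> \<in> smooth_functions A"
  shows "continuous_on UNIV (laplacian A h \<xi>)"
proof (rule continuous_on_charts)
  fix c assume c: "c \<in> A"
  have nz: "complex_of_real (h c (param c z)) \<noteq> 0" if "z \<in> snd c ` fst c" for z
    using metric_pos[OF c param_in[OF c that]] by (metis less_irrefl of_real_eq_0_iff)
  have "continuous_on (snd c ` fst c)
      (\<lambda>z. - inverse (complex_of_real (h c (param c z))) * d_z_zbar (\<lambda>z. \<xi> (param c z)) z)"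
    by (intro continuous_intros continuous_on_compose2[OF continuous_on_metric[OF c] continuous_on_param[OF c]]
        smooth_on_imp_continuous_on[OF smooth_on_d_z_zbar[OF open_coord[OF c] smooth_functionsD[OF \<xi> c]]])
      (use nz c in auto)
  thus "continuous_on (snd c ` fst c) (\<lambda>z. laplacian A h \<xi> (param c z))"
    by (rule continuous_on_eq) (simp add: laplacian_chart[OF hermitian \<xi> c param_in[OF c]] c)
qed

lemma laplacian_add:
  assumes "\<xi> \<in> smooth_functions A" "\<eta> \<in> smooth_functions A"
  shows "laplacian A h (\<lambda>p. \<xi> p + \<eta> p) p = laplacian A h \<xi> p + laplacian A h \<eta> p"
proof -
  obtain c where c: "c \<in> A" "p \<in> fst c" using chart_exists by blast
  note L = laplacian_chart[OF hermitian _ c]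
  show ?thesis
    unfolding L[OF assms(1)] L[OF assms(2)] L[OF smooth_functions_add[OF assms]]
    using d_z_zbar_add[OF open_coord[OF c(1)] _ smooth_functionsD[OF assms(1) c(1)] smooth_functionsD[OF assms(2) c(1)]] c
    by (simp add: algebra_simps)
qed

lemma laplacian_zero_open:
  assumes \<xi>: "\<xi> \<in> smooth_functions A" and W: "open W" "p \<in> W" and zero: "\<And>q. q \<in> W \<Longrightarrow> \<xi> q = 0"
  shows "laplacian A h \<xi> p = 0"
proof -
  obtain c where c: "c \<in> A" "p \<in> fst c" using chart_exists by blast
  have "d_z_zbar (\<lambda>z. \<xi> (param c z)) (snd c p) = d_z_zbar (\<lambda>_. 0) (snd c p)"
  proof (rule d_z_zbar_cong_open[OF open_coord_image[OF c(1) W(1)]])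
    show "snd c p \<in> snd c ` (fst c \<inter> W)" using c W by blast
    show "\<xi> (param c y) = 0" if "y \<in> snd c ` (fst c \<inter> W)" for y using that c zero by auto
  qed
  also have "d_z_zbar (\<lambda>_. 0) = (\<lambda>_. 0)"
  proof -
    have "d_zbar (\<lambda>_. 0) = (\<lambda>_. 0)" "d_z (\<lambda>_. 0) = (\<lambda>_. 0)" by (simp_all add: fun_eq_iff d_z_def d_zbar_def)
    thus ?thesis by (simp add: d_z_zbar_def)
  qed
  finally show ?thesis by (simp add: laplacian_chart[OF hermitian \<xi> c])
qed

lemma integrable_continuous:
  fixes f :: "'a \<Rightarrow> complex"
  assumes "continuous_on UNIV f"
  shows "integrable vol f"
proof -
  obtain B where "\<forall>p. cmod (f p) \<le> B" using continuous_imp_measurable_bounded(2)[OF assms] by blast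
  thus ?thesis
    using continuous_imp_measurable_bounded(1)[OF assms]
    by (intro finite_measure.integrable_const_bound[OF finite_measure_vol, of _ B]) auto
qed

text \<open>In the coordinate the density \<open>h / pi\<close> cancels the factor
  \<open>1 / h\<close> of the Laplacian. What remains is \<open>- 1 / pi\<close> times an integral
  free of the metric, to which planar integration by parts applies; only \<open>\<theta>\<close> has
  to be supported in the chart.\<close>

lemma laplacian_symmetric_local:
  assumes \<xi>: "\<xi> \<in> smooth_functions A" and \<theta>: "\<theta> \<in> smooth_functions A"
    and c: "c \<in> A" and K: "compact K" "K \<subseteq> snd c ` fst c" and zero: "\<And>p. p \<notin> param c ` K \<Longrightarrow> \<theta> p = 0"
  shows "(\<integral>p. laplacian A h \<xi> p * cnj (\<theta> p) \<partial>vol) = (\<integral>p. \<xi> p * cnj (laplacian A h \<theta> p) \<partial>vol)"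
proof -
  define S where "S = snd c ` fst c"
  define F where "F = (\<lambda>z. \<xi> (param c z))"
  define G where "G = (\<lambda>z. \<theta> (param c z))"
  have KU: "param c ` K \<subseteq> fst c" using K(2) param_in[OF c] by blast
  have Kcl: "closed (param c ` K)"
    by (rule compact_imp_closed[OF compact_param_image[OF c K]])
  have lap0: "laplacian A h \<theta> p = 0" if "p \<notin> param c ` K" for p
    by (rule laplacian_zero_open[OF \<theta>, of "- param c ` K"]) (use that Kcl zero in auto)
  have lapF: "laplacian A h \<xi> (param c z) = - inverse (complex_of_real (h c (param c z))) * d_z_zbar F z"
    and lapG: "laplacian A h \<theta> (param c z) = - inverse (complex_of_real (h c (param c z))) * d_z_zbar G z"
    if "z \<in> S" for z
    using that laplacian_chart[OF hermitian _ c param_in[OF c], of _ z] \<xi> \<theta> c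
    by (auto simp: S_def F_def G_def)
  have out: "\<theta> p = 0" "laplacian A h \<theta> p = 0" if "p \<notin> fst c" for p
    using that KU zero lap0 by blast+
  have cont: "continuous_on UNIV (\<lambda>p. laplacian A h \<xi> p * cnj (\<theta> p))"
    "continuous_on UNIV (\<lambda>p. \<xi> p * cnj (laplacian A h \<theta> p))"
    by (intro continuous_intros laplacian_continuous smooth_functions_continuous \<xi> \<theta>)+
  have pos: "h c (param c z) > 0" if "z \<in> S" for z
    using metric_pos[OF c param_in[OF c]] that by (simp add: S_def)
  have "(\<integral>p. laplacian A h \<xi> p * cnj (\<theta> p) \<partial>vol)
      = (\<integral>p. indicator (fst c) p *\<^sub>R (laplacian A h \<xi> p * cnj (\<theta> p)) \<partial>vol)"
    using out by (intro Bochner_Integration.integral_cong) (simp_all add: indicator_def)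
  also have "\<dots> = (\<integral>z. indicator S z *\<^sub>R ((h c (param c z) / pi) *\<^sub>R
      (laplacian A h \<xi> (param c z) * cnj (\<theta> (param c z)))) \<partial>lborel)"
    unfolding S_def by (rule integral_vol_chart[OF c continuous_imp_measurable_bounded(1)[OF cont(1)]])
  also have "\<dots> = (\<integral>z. (- 1 / pi) *\<^sub>R (indicator S z *\<^sub>R (d_z_zbar F z * cnj (G z))) \<partial>lborel)"
  proof (intro Bochner_Integration.integral_cong refl)
    fix z
    show "indicator S z *\<^sub>R ((h c (param c z) / pi) *\<^sub>R (laplacian A h \<xi> (param c z) * cnj (\<theta> (param c z))))
        = (- 1 / pi) *\<^sub>R (indicator S z *\<^sub>R (d_z_zbar F z * cnj (G z)))"
      using lapF[of z] pos[of z] by (cases "z \<in> S") (simp_all add: G_def scaleR_conv_of_real field_simps)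
  qed
  also have "\<dots> = (- 1 / pi) *\<^sub>R (\<integral>z. indicator S z *\<^sub>R (d_z_zbar F z * cnj (G z)) \<partial>lborel)"
    by (rule integral_scaleR_right)
  also have "(\<integral>z. indicator S z *\<^sub>R (d_z_zbar F z * cnj (G z)) \<partial>lborel)
      = (\<integral>z. indicator S z *\<^sub>R (F z * cnj (d_z_zbar G z)) \<partial>lborel)"
  proof (rule d_z_zbar_by_parts)
    show "open S" unfolding S_def by (rule open_coord[OF c])
    show "smooth_on S F" "smooth_on S G"
      unfolding S_def F_def G_def by (rule smooth_functionsD[OF _ c], fact)+
    show "compact K" "K \<subseteq> S" using K by (auto simp: S_def)
    show "G z = 0" if "z \<in> S" "z \<notin> K" for z
      unfolding G_def
    proof (rule zero)
      show "param c z \<notin> param c ` K"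
      proof
        assume "param c z \<in> param c ` K"
        then obtain y where "y \<in> K" "param c z = param c y" by blast
        hence "snd c (param c z) = snd c (param c y)" by simp
        thus False using that \<open>y \<in> K\<close> K(2) coord_param[OF c, of z] coord_param[OF c, of y]
          unfolding S_def by (metis subsetD)
      qed
    qed
  qed
  also have "(- 1 / pi) *\<^sub>R (\<integral>z. indicator S z *\<^sub>R (F z * cnj (d_z_zbar G z)) \<partial>lborel)
      = (\<integral>z. (- 1 / pi) *\<^sub>R (indicator S z *\<^sub>R (F z * cnj (d_z_zbar G z))) \<partial>lborel)"
    by (rule integral_scaleR_right[symmetric])
  also have "\<dots> = (\<integral>z. indicator S z *\<^sub>R ((h c (param c z) / pi) *\<^sub>R
      (\<xi> (param c z) * cnj (laplacian A h \<theta> (param c z)))) \<partial>lborel)"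
  proof (intro Bochner_Integration.integral_cong refl)
    fix z
    show "(- 1 / pi) *\<^sub>R (indicator S z *\<^sub>R (F z * cnj (d_z_zbar G z)))
      = indicator S z *\<^sub>R ((h c (param c z) / pi) *\<^sub>R (\<xi> (param c z) * cnj (laplacian A h \<theta> (param c z))))"
      using arg_cong[OF lapG[of z], of cnj] pos[of z]
      by (cases "z \<in> S") (simp_all add: F_def scaleR_conv_of_real field_simps)
  qed
  also have "\<dots> = (\<integral>p. indicator (fst c) p *\<^sub>R (\<xi> p * cnj (laplacian A h \<theta> p)) \<partial>vol)"
    unfolding S_def by (rule integral_vol_chart[OF c continuous_imp_measurable_bounded(1)[OF cont(2)], symmetric])
  also have "\<dots> = (\<integral>p. \<xi> p * cnj (laplacian A h \<theta> p) \<partial>vol)"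
    using out by (intro Bochner_Integration.integral_cong) (simp_all add: indicator_def)
  finally show ?thesis .
qed

text \<open>The second argument is peeled disc by disc:
  \<open>\<eta> = \<beta> * \<eta> + (1 - \<beta>) * \<eta>\<close>, where the first summand is
  supported in one chart and the second vanishes on the half disc just treated.\<close>

lemma laplacian_symmetric:
  assumes \<rho>: "cutoff_function \<rho>" and \<xi>: "\<xi> \<in> smooth_functions A" and \<eta>: "\<eta> \<in> smooth_functions A"
  shows "(\<integral>p. laplacian A h \<xi> p * cnj (\<eta> p) \<partial>vol) = (\<integral>p. \<xi> p * cnj (laplacian A h \<eta> p) \<partial>vol)"
proof -
  define sym where "sym \<eta> \<longleftrightarrow>
    (\<integral>p. laplacian A h \<xi> p * cnj (\<eta> p) \<partial>vol) = (\<integral>p. \<xi> p * cnj (laplacian A h \<eta> p) \<partial>vol)" for \<eta>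
  define N :: "('a chart \<times> complex \<times> real) set \<Rightarrow> 'a set"
    where "N J = {p. \<exists>c a r. (c, a, r) \<in> J \<and> p \<in> fst c \<and> snd c p \<in> ball a (r / 2)}" for J
  have sym_add: "sym (\<lambda>p. \<eta> p + \<theta> p)"
    if "\<eta> \<in> smooth_functions A" "\<theta> \<in> smooth_functions A" "sym \<eta>" "sym \<theta>" for \<eta> \<theta>
  proof -
    have int: "integrable vol (\<lambda>p. laplacian A h \<xi> p * cnj (u p))"
      "integrable vol (\<lambda>p. \<xi> p * cnj (laplacian A h u p))" if "u \<in> smooth_functions A" for u
      by (intro integrable_continuous continuous_intros laplacian_continuous smooth_functions_continuous \<xi> that)+
    show ?thesis
      using that(3,4) int[OF that(1)] int[OF that(2)]
      by (simp add: sym_def laplacian_add that distrib_left)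
  qed
  \<comment> \<open>Induction over the discs still needed to contain the points where
    \<open>\<eta>\<close> is nonzero. With no disc left, \<open>\<eta>\<close> is 0; with all discs
    of the cover the condition on \<open>\<eta>\<close> is void.\<close>
  have main: "sym \<eta>" if "finite J" "\<And>c a r. (c, a, r) \<in> J \<Longrightarrow> c \<in> A \<and> r > 0 \<and> cball a r \<subseteq> snd c ` fst c"
    "\<eta> \<in> smooth_functions A" "\<And>p. p \<notin> N J \<Longrightarrow> \<eta> p = 0" for J \<eta>
    using that
  proof (induction J arbitrary: \<eta> rule: finite_induct)
    case empty
    hence "\<eta> = (\<lambda>_. 0)" by (auto simp: N_def)
    moreover have "laplacian A h (\<lambda>_. 0) p = 0" for p
      by (rule laplacian_zero_open[OF smooth_functions_const, of UNIV]) auto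
    ultimately show ?case by (simp add: sym_def)
  next
    case (insert i J)
    obtain c a r where i: "i = (c, a, r)" by (rule prod_cases3)
    have c: "c \<in> A" "r > 0" "cball a r \<subseteq> snd c ` fst c" using insert.prems(1)[of c a r] i by auto
    obtain \<beta> where \<beta>: "\<beta> \<in> smooth_functions A"
      "\<And>p. p \<in> fst c \<Longrightarrow> snd c p \<in> ball a (r / 2) \<Longrightarrow> \<beta> p = 1"
      "\<And>p. p \<notin> param c ` cball a r \<Longrightarrow> \<beta> p = 0"
      using bump_exists[OF \<rho> c] by blast
    define \<theta> where "\<theta> = (\<lambda>p. \<beta> p * \<eta> p)"
    define \<theta>' where "\<theta>' = (\<lambda>p. (1 - \<beta> p) * \<eta> p)"
    have \<theta>: "\<theta> \<in> smooth_functions A" "\<theta>' \<in> smooth_functions A"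
      unfolding \<theta>_def \<theta>'_def
      by (intro smooth_functions_mult smooth_functions_diff smooth_functions_const \<beta>(1) insert.prems(2))+
    have "sym \<theta>" unfolding sym_def
      by (rule laplacian_symmetric_local[OF \<xi> \<theta>(1) c(1) compact_cball c(3)]) (simp add: \<theta>_def \<beta>(3))
    moreover have "sym \<theta>'"
    proof (rule insert.IH)
      show "c \<in> A \<and> r > 0 \<and> cball a r \<subseteq> snd c ` fst c" if "(c, a, r) \<in> J" for c a r
        using insert.prems(1)[of c a r] that by blast
      show "\<theta>' p = 0" if "p \<notin> N J" for p
      proof (cases "p \<in> fst c \<and> snd c p \<in> ball a (r / 2)")
        case True thus ?thesis by (simp add: \<theta>'_def \<beta>(2))
      next
        case False
        have "p \<notin> N (insert i J)" using False that unfolding N_def i by blast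
        from insert.prems(3)[OF this] show ?thesis by (simp add: \<theta>'_def)
      qed
    qed (rule \<theta>)
    ultimately have "sym (\<lambda>p. \<theta> p + \<theta>' p)" by (rule sym_add[OF \<theta>])
    moreover have "(\<lambda>p. \<theta> p + \<theta>' p) = \<eta>" by (simp add: \<theta>_def \<theta>'_def algebra_simps)
    ultimately show ?case by simp
  qed
  obtain I where I: "finite I" "\<And>c a r. (c, a, r) \<in> I \<Longrightarrow> c \<in> A \<and> r > 0 \<and> cball a r \<subseteq> snd c ` fst c"
    "\<And>q. \<exists>c a r. (c, a, r) \<in> I \<and> q \<in> fst c \<and> snd c q \<in> ball a (r / 2)"
    using finite_disc_cover by blast
  have "p \<in> N I" for p unfolding N_def using I(3)[of p] by blast
  hence "sym \<eta>" by (intro main[OF I(1,2) \<eta>]) auto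
  thus ?thesis by (simp only: sym_def)
qed

end

section \<open>Quotient metrics on the tangent bundle\<close>

context riemann_surface
begin

lemma surface_smooth_onD:
  "surface_smooth_on A W f \<Longrightarrow> c \<in> A \<Longrightarrow> smooth_on (snd c ` (fst c \<inter> W)) (\<lambda>z. f (param c z))"
  by (simp add: surface_smooth_on_def o_def)

lemma surface_smooth_onI:
  "(\<And>c. c \<in> A \<Longrightarrow> smooth_on (snd c ` (fst c \<inter> W)) (\<lambda>z. f (param c z))) \<Longrightarrow> surface_smooth_on A W f"
  by (simp add: surface_smooth_on_def o_def)

lemma surface_smooth_on_subset:
  assumes "surface_smooth_on A W f" "W' \<subseteq> W" shows "surface_smooth_on A W' f"
proof (rule surface_smooth_onI)
  fix c assume "c \<in> A"
  thus "smooth_on (snd c ` (fst c \<inter> W')) (\<lambda>z. f (param c z))"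
    by (rule smooth_on_subset[OF surface_smooth_onD[OF assms(1)]]) (use assms(2) in blast)
qed

lemma surface_smooth_on_mult:
  fixes f g :: "'a \<Rightarrow> real"
  assumes "open W" "surface_smooth_on A W f" "surface_smooth_on A W g"
  shows "surface_smooth_on A W (\<lambda>p. f p * g p)"
  by (rule surface_smooth_onI, rule smooth_on_mult)
    (simp_all add: open_coord_image assms surface_smooth_onD)

lemma surface_smooth_on_inverse:
  fixes f :: "'a \<Rightarrow> real"
  assumes "open W" "surface_smooth_on A W f" "\<And>p. p \<in> W \<Longrightarrow> f p \<noteq> 0"
  shows "surface_smooth_on A W (\<lambda>p. inverse (f p))"
proof (rule surface_smooth_onI)
  fix c assume c: "c \<in> A"
  have "f (param c z) \<noteq> 0" if "z \<in> snd c ` (fst c \<inter> W)" for z using that c assms(3) by auto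
  thus "smooth_on (snd c ` (fst c \<inter> W)) (\<lambda>z. inverse (f (param c z)))"
    by (intro smooth_on_inverse open_coord_image[OF c assms(1)] surface_smooth_onD[OF assms(2) c])
qed

lemma surface_smooth_on_cmod_power2:
  assumes "open W" "surface_holomorphic_on A W f"
  shows "surface_smooth_on A W (\<lambda>p. (cmod (f p))\<^sup>2)"
proof (rule surface_smooth_onI)
  fix c assume c: "c \<in> A"
  have "(\<lambda>z. f (param c z)) holomorphic_on (snd c ` (fst c \<inter> W))"
    using assms(2) c by (simp add: surface_holomorphic_on_def o_def)
  thus "smooth_on (snd c ` (fst c \<inter> W)) (\<lambda>z. (cmod (f (param c z)))\<^sup>2)"
    by (intro smooth_on_cmod_power2 holomorphic_imp_smooth_on open_coord_image[OF c assms(1)])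
qed

lemma surface_smooth_on_local:
  fixes f :: "'a \<Rightarrow> real"
  assumes "\<And>p. p \<in> W \<Longrightarrow> \<exists>W' g. open W' \<and> p \<in> W' \<and> surface_smooth_on A W' g \<and> (\<forall>q\<in>W'. f q = g q)"
  shows "surface_smooth_on A W f"
proof (rule surface_smooth_onI, rule smooth_on_local)
  fix c z assume c: "c \<in> A" and "z \<in> snd c ` (fst c \<inter> W)"
  then obtain p where p: "p \<in> fst c" "p \<in> W" "z = snd c p" by blast
  obtain W' g where W': "open W'" "p \<in> W'" "surface_smooth_on A W' g" "\<forall>q\<in>W'. f q = g q"
    using assms[OF p(2)] by blast
  have o: "open (snd c ` (fst c \<inter> W'))" by (rule open_coord_image[OF c W'(1)])
  have "f (param c y) = g (param c y)" if "y \<in> snd c ` (fst c \<inter> W')" for y using that c W'(4) by auto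
  hence "smooth_on (snd c ` (fst c \<inter> W')) (\<lambda>z. f (param c z))"
    using surface_smooth_onD[OF W'(3) c]
      smooth_on_cong_open[OF o, of "\<lambda>z. f (param c z)" "\<lambda>z. g (param c z)"] by simp
  thus "\<exists>T. open T \<and> z \<in> T \<and> smooth_on T (\<lambda>z. f (param c z))" using o p W'(2) by blast
qed

end

text \<open>Changing the frame of \<open>M\<close> moves one squared transition factor from the
  metric to \<open>\<sigma>\<close>, so the frame selected by \<open>SOME\<close> can be replaced by
  any fixed one.\<close>

lemma pullback_metric_frame:
  assumes M: "hermitian_metric M h" and iso: "bundle_isomorphism A L M \<sigma>"
    and ij: "i \<in> lb_index L" "j \<in> lb_index M" "p \<in> lb_dom L i" "p \<in> lb_dom M j"
  shows "pullback_metric M \<sigma> h i p = (cmod (\<sigma> i j p))\<^sup>2 * h j p"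
proof -
  define l where "l = (SOME j. j \<in> lb_index M \<and> p \<in> lb_dom M j)"
  have "l \<in> lb_index M \<and> p \<in> lb_dom M l" unfolding l_def by (rule someI_ex) (use ij in blast)
  hence l: "l \<in> lb_index M" "p \<in> lb_dom M l" by auto
  have "h l p = (cmod (lb_trans M j l p))\<^sup>2 * h j p"
    using M l ij unfolding hermitian_metric_def by blast
  moreover have "\<sigma> i j p = lb_trans M j l p * \<sigma> i l p"
    using iso l ij unfolding bundle_isomorphism_def by blast
  ultimately have "(cmod (\<sigma> i l p))\<^sup>2 * h l p = (cmod (\<sigma> i j p))\<^sup>2 * h j p"
    by (simp add: norm_mult power_mult_distrib)
  thus ?thesis unfolding pullback_metric_def l_def[symmetric] Let_def .
qed

lemma hermitian_pullback_metric:
  assumes M: "hermitian_metric M h" and iso: "bundle_isomorphism A L M \<sigma>"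
    and cover: "(\<Union>j\<in>lb_index M. lb_dom M j) = UNIV"
  shows "hermitian_metric L (pullback_metric M \<sigma> h)"
  unfolding hermitian_metric_def
proof (intro conjI ballI)
  fix i p assume ip: "i \<in> lb_index L" "p \<in> lb_dom L i"
  obtain j where j: "j \<in> lb_index M" "p \<in> lb_dom M j" using cover by blast
  note F = pullback_metric_frame[OF M iso _ j(1) _ j(2)]
  have "h j p > 0" using M j unfolding hermitian_metric_def by blast
  moreover have "\<sigma> i j p \<noteq> 0" using iso ip j unfolding bundle_isomorphism_def by blast
  ultimately show "pullback_metric M \<sigma> h i p > 0" using F[OF ip] by simp
next
  fix i k p assume ik: "i \<in> lb_index L" "k \<in> lb_index L" and p: "p \<in> lb_dom L i \<inter> lb_dom L k"
  obtain j where j: "j \<in> lb_index M" "p \<in> lb_dom M j" using cover by blast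
  note F = pullback_metric_frame[OF M iso _ j(1) _ j(2)]
  have "\<sigma> k j p = lb_trans L i k p * \<sigma> i j p"
    using iso ik p j unfolding bundle_isomorphism_def by blast
  thus "pullback_metric M \<sigma> h k p = (cmod (lb_trans L i k p))\<^sup>2 * pullback_metric M \<sigma> h i p"
    using F[OF ik(1)] F[OF ik(2)] p by (simp add: norm_mult power_mult_distrib)
qed

text \<open>The frame selected by \<open>SOME\<close> may jump from point to point. Near each point
  one fixed frame gives the same values through a smooth formula.\<close>

lemma (in riemann_surface) smooth_pullback_metric:
  assumes M: "smooth_metric A M h" and iso: "bundle_isomorphism A L M \<sigma>"
    and cover: "(\<Union>j\<in>lb_index M. lb_dom M j) = UNIV"
    and opL: "\<And>i. i \<in> lb_index L \<Longrightarrow> open (lb_dom L i)" and opM: "\<And>j. j \<in> lb_index M \<Longrightarrow> open (lb_dom M j)"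
  shows "smooth_metric A L (pullback_metric M \<sigma> h)"
proof -
  have herm: "hermitian_metric M h" and sm: "\<And>j. j \<in> lb_index M \<Longrightarrow> surface_smooth_on A (lb_dom M j) (h j)"
    using M by (simp_all add: smooth_metric_def)
  have "surface_smooth_on A (lb_dom L i) (pullback_metric M \<sigma> h i)" if i: "i \<in> lb_index L" for i
  proof (rule surface_smooth_on_local)
    fix p assume p: "p \<in> lb_dom L i"
    obtain j where j: "j \<in> lb_index M" "p \<in> lb_dom M j" using cover by blast
    let ?W = "lb_dom L i \<inter> lb_dom M j"
    have o: "open ?W" using opL[OF i] opM[OF j(1)] by blast
    have "surface_holomorphic_on A ?W (\<sigma> i j)" using iso i j unfolding bundle_isomorphism_def by blast
    hence "surface_smooth_on A ?W (\<lambda>p. (cmod (\<sigma> i j p))\<^sup>2 * h j p)"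
      by (intro surface_smooth_on_mult surface_smooth_on_cmod_power2 o
          surface_smooth_on_subset[OF sm[OF j(1)]]) auto
    moreover have "\<forall>q\<in>?W. pullback_metric M \<sigma> h i q = (cmod (\<sigma> i j q))\<^sup>2 * h j q"
      using pullback_metric_frame[OF herm iso i j(1)] by blast
    ultimately show "\<exists>W' g. open W' \<and> p \<in> W' \<and> surface_smooth_on A W' g \<and>
        (\<forall>q\<in>W'. pullback_metric M \<sigma> h i q = g q)"
      using o p j(2) by blast
  qed
  thus ?thesis
    using hermitian_pullback_metric[OF herm iso cover] by (simp add: smooth_metric_def)
qed

lemma hermitian_quotient:
  assumes "hermitian_metric L1 h1" "hermitian_metric L2 h2"
  shows "hermitian_metric (tensor_bundle L1 (dual_bundle L2)) (tensor_metric h1 (dual_metric h2))"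
  unfolding hermitian_metric_def
proof (intro conjI ballI)
  fix i p assume "i \<in> lb_index (tensor_bundle L1 (dual_bundle L2))" "p \<in> lb_dom (tensor_bundle L1 (dual_bundle L2)) i"
  moreover obtain i1 i2 where i: "i = (i1, i2)" by fastforce
  ultimately have "i1 \<in> lb_index L1" "i2 \<in> lb_index L2" "p \<in> lb_dom L1 i1" "p \<in> lb_dom L2 i2"
    by (simp_all add: tensor_bundle_def dual_bundle_def)
  hence "h1 i1 p > 0" "h2 i2 p > 0" using assms unfolding hermitian_metric_def by blast+
  thus "tensor_metric h1 (dual_metric h2) i p > 0" by (simp add: i tensor_metric_def dual_metric_def)
next
  fix i j p assume "i \<in> lb_index (tensor_bundle L1 (dual_bundle L2))" "j \<in> lb_index (tensor_bundle L1 (dual_bundle L2))"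
    "p \<in> lb_dom (tensor_bundle L1 (dual_bundle L2)) i \<inter> lb_dom (tensor_bundle L1 (dual_bundle L2)) j"
  moreover obtain i1 i2 j1 j2 where ij: "i = (i1, i2)" "j = (j1, j2)" by fastforce
  ultimately have *: "i1 \<in> lb_index L1" "i2 \<in> lb_index L2" "j1 \<in> lb_index L1" "j2 \<in> lb_index L2"
    "p \<in> lb_dom L1 i1 \<inter> lb_dom L1 j1" "p \<in> lb_dom L2 i2 \<inter> lb_dom L2 j2"
    by (simp_all add: tensor_bundle_def dual_bundle_def)
  have "h1 j1 p = (cmod (lb_trans L1 i1 j1 p))\<^sup>2 * h1 i1 p" "h2 j2 p = (cmod (lb_trans L2 i2 j2 p))\<^sup>2 * h2 i2 p"
    using * assms unfolding hermitian_metric_def by blast+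
  thus "tensor_metric h1 (dual_metric h2) j p
      = (cmod (lb_trans (tensor_bundle L1 (dual_bundle L2)) i j p))\<^sup>2 * tensor_metric h1 (dual_metric h2) i p"
    by (simp add: ij tensor_metric_def dual_metric_def tensor_bundle_def dual_bundle_def norm_mult norm_inverse
        power_mult_distrib power_inverse)
qed

section \<open>Quotient metrics transported to the tangent bundle, and their limits\<close>

locale tangent_quotient = riemann_surface A for A :: "'a::t2_space chart set" +
  fixes L1 :: "('a, 'i) line_bundle" and L2 :: "('a, 'j) line_bundle"
    and \<sigma> :: "'a chart \<Rightarrow> 'i \<times> 'j \<Rightarrow> 'a \<Rightarrow> complex"
  assumes L1: "holomorphic_line_bundle A L1" and L2: "holomorphic_line_bundle A L2"
    and iso: "bundle_isomorphism A (tangent_bundle A) (tensor_bundle L1 (dual_bundle L2)) \<sigma>"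
begin

abbreviation Q :: "('a, 'i \<times> 'j) line_bundle" where "Q \<equiv> tensor_bundle L1 (dual_bundle L2)"

lemma cover_L1: "\<exists>i\<in>lb_index L1. p \<in> lb_dom L1 i"
  using L1 unfolding holomorphic_line_bundle_def by blast

lemma cover_L2: "\<exists>j\<in>lb_index L2. p \<in> lb_dom L2 j"
  using L2 unfolding holomorphic_line_bundle_def by blast

lemma Q_sel: "lb_index Q = lb_index L1 \<times> lb_index L2"
  "lb_dom Q (i, j) = lb_dom L1 i \<inter> lb_dom L2 j"
  by (simp_all add: tensor_bundle_def dual_bundle_def)

lemma cover_Q: "(\<Union>j\<in>lb_index Q. lb_dom Q j) = UNIV"
proof -
  have "p \<in> (\<Union>j\<in>lb_index Q. lb_dom Q j)" for p
  proof -
    obtain i j where "i \<in> lb_index L1" "p \<in> lb_dom L1 i" "j \<in> lb_index L2" "p \<in> lb_dom L2 j"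
      using cover_L1[of p] cover_L2[of p] by blast
    thus ?thesis by (intro UN_I[of "(i, j)"]) (simp_all add: Q_sel)
  qed
  thus ?thesis by blast
qed

lemma smooth_quotient_metric:
  assumes h1: "smooth_metric A L1 h1" and h2: "smooth_metric A L2 h2"
  shows "smooth_metric A (tangent_bundle A) (quotient_metric L1 L2 \<sigma> h1 h2)"
  unfolding quotient_metric_def
proof (rule smooth_pullback_metric[OF _ iso cover_Q])
  have op: "open (lb_dom L1 i)" "open (lb_dom L2 j)" if "i \<in> lb_index L1" "j \<in> lb_index L2" for i j
    using L1 L2 that unfolding holomorphic_line_bundle_def by blast+
  show opQ: "open (lb_dom Q j)" if "j \<in> lb_index Q" for j
    using that op by (cases j) (auto simp: Q_sel)
  show "open (lb_dom (tangent_bundle A) c)" if "c \<in> lb_index (tangent_bundle A)" for c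
    using that open_chart by (simp add: tangent_bundle_sel)
  have "surface_smooth_on A (lb_dom Q k) (tensor_metric h1 (dual_metric h2) k)" if k: "k \<in> lb_index Q" for k
  proof -
    obtain i j where ij: "k = (i, j)" by fastforce
    with k have *: "i \<in> lb_index L1" "j \<in> lb_index L2" by (simp_all add: Q_sel)
    have s: "surface_smooth_on A (lb_dom L1 i) (h1 i)" "surface_smooth_on A (lb_dom L2 j) (h2 j)"
      using h1 h2 * by (simp_all add: smooth_metric_def)
    have "h2 j p > 0" if "p \<in> lb_dom L2 j" for p
      using h2 * that unfolding smooth_metric_def hermitian_metric_def by blast
    hence nz: "h2 j p \<noteq> 0" if "p \<in> lb_dom L2 j" for p using that by (metis less_irrefl)
    have "surface_smooth_on A (lb_dom L1 i \<inter> lb_dom L2 j) (\<lambda>p. h1 i p * inverse (h2 j p))"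
      by (intro surface_smooth_on_mult surface_smooth_on_inverse surface_smooth_on_subset[OF s(1)]
          surface_smooth_on_subset[OF s(2)] open_Int op[OF *] nz) auto
    moreover have "tensor_metric h1 (dual_metric h2) k = (\<lambda>p. h1 i p * inverse (h2 j p))"
      by (simp add: ij tensor_metric_def dual_metric_def)
    ultimately show ?thesis by (simp only: ij Q_sel)
  qed
  moreover have "hermitian_metric Q (tensor_metric h1 (dual_metric h2))"
    using h1 h2 by (intro hermitian_quotient) (simp_all add: smooth_metric_def)
  ultimately show "smooth_metric A Q (tensor_metric h1 (dual_metric h2))"
    by (simp add: smooth_metric_def)
qed

text \<open>The squared modulus of \<open>\<sigma>\<close> cancels in the ratio of two quotient
  metrics, leaving the quotient \<open>a / b\<close> of the ratios on \<open>L1\<close> and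
  \<open>L2\<close>.\<close>

lemma quotient_metric_converge:
  assumes h1: "hermitian_metric L1 h1" and h2: "hermitian_metric L2 h2"
    and h1s: "metrics_converge L1 h1s h1" and h2s: "metrics_converge L2 h2s h2"
  shows "metrics_converge (tangent_bundle A) (\<lambda>n. quotient_metric L1 L2 \<sigma> (h1s n) (h2s n))
    (quotient_metric L1 L2 \<sigma> h1 h2)"
  unfolding metrics_converge_def
proof (rule uniform_limitI)
  fix e :: real assume e: "e > 0"
  \<comment> \<open>If \<open>a\<close> and \<open>b\<close> are within \<open>d\<close> of 1, then
    \<open>\<bar>a - b\<bar> < 2 * d\<close>, and \<open>d \<le> 1 / 2\<close> gives
    \<open>b > 1 / 2\<close>; so the error is at most \<open>4 * d\<close>, which is at most
    \<open>e / 2\<close>.\<close>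
  define d where "d = min (1 / 2) (e / 8)"
  have d: "d > 0" "d \<le> 1 / 2" "4 * d < e" using e by (auto simp: d_def min_def)
  have "\<forall>\<^sub>F n in sequentially. \<forall>x\<in>Sigma (lb_index L1) (lb_dom L1). dist (case x of (i, p) \<Rightarrow> h1s n i p / h1 i p) 1 < d"
    "\<forall>\<^sub>F n in sequentially. \<forall>x\<in>Sigma (lb_index L2) (lb_dom L2). dist (case x of (i, p) \<Rightarrow> h2s n i p / h2 i p) 1 < d"
    using uniform_limitD[OF h1s[unfolded metrics_converge_def] d(1)]
      uniform_limitD[OF h2s[unfolded metrics_converge_def] d(1)] by blast+
  thus "\<forall>\<^sub>F n in sequentially. \<forall>x\<in>Sigma (lb_index (tangent_bundle A)) (lb_dom (tangent_bundle A)).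
      dist (case x of (c, p) \<Rightarrow> quotient_metric L1 L2 \<sigma> (h1s n) (h2s n) c p / quotient_metric L1 L2 \<sigma> h1 h2 c p) 1 < e"
  proof eventually_elim
    case (elim n)
    have "dist (quotient_metric L1 L2 \<sigma> (h1s n) (h2s n) c p / quotient_metric L1 L2 \<sigma> h1 h2 c p) 1 < e"
      if c: "c \<in> A" "p \<in> fst c" for c p
    proof -
      define l where "l = (SOME l. l \<in> lb_index Q \<and> p \<in> lb_dom Q l)"
      have l: "l \<in> lb_index Q \<and> p \<in> lb_dom Q l" unfolding l_def by (rule someI_ex) (use cover_Q in blast)
      obtain i j where ij: "l = (i, j)" by fastforce
      have *: "i \<in> lb_index L1" "j \<in> lb_index L2" "p \<in> lb_dom L1 i" "p \<in> lb_dom L2 j"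
        using l by (simp_all add: ij Q_sel)
      have nz: "\<sigma> c (i, j) p \<noteq> 0"
        using iso c l unfolding bundle_isomorphism_def ij tangent_bundle_sel by blast
      have pos: "h1 i p > 0" "h2 j p > 0" using h1 h2 * unfolding hermitian_metric_def by blast+
      define a where "a = h1s n i p / h1 i p"
      define b where "b = h2s n j p / h2 j p"
      have q: "quotient_metric L1 L2 \<sigma> u v c p = (cmod (\<sigma> c (i, j) p))\<^sup>2 * (u i p * inverse (v j p))" for u v
        unfolding quotient_metric_def pullback_metric_def l_def[symmetric] Let_def ij
        by (simp add: tensor_metric_def dual_metric_def)
      have ratio: "quotient_metric L1 L2 \<sigma> (h1s n) (h2s n) c p / quotient_metric L1 L2 \<sigma> h1 h2 c p = a / b"
        unfolding q a_def b_def using nz pos by (simp add: field_simps)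
      have "\<bar>a - 1\<bar> < d" "\<bar>b - 1\<bar> < d"
        using elim * by (auto simp: a_def b_def dist_real_def)
      hence ab: "\<bar>a - b\<bar> < 2 * d" "b > 1 / 2" using d by linarith+
      hence "\<bar>a / b - 1\<bar> = \<bar>a - b\<bar> / b" by (simp add: field_simps abs_if)
      also have "\<dots> \<le> (2 * d) / (1 / 2)" using ab d by (intro frac_le) auto
      also have "\<dots> < e" using d by simp
      finally show ?thesis using ratio by (simp add: dist_real_def)
    qed
    thus ?case by (auto simp: tangent_bundle_sel simp del: split_paired_All split_paired_Ex)
  qed
qed

end

text \<open>Only ratios converge uniformly, and \<open>h i\<close> may be unbounded on the frame
  domain, so \<open>hs n i\<close> need not converge uniformly to \<open>h i\<close>. Their
  logarithms do, and continuity is taken to the limit there.\<close>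

lemma continuous_metric_limit:
  assumes cont: "\<And>n. continuous_metric L (hs n)" and h: "hermitian_metric L h" and conv: "metrics_converge L hs h"
  shows "continuous_metric L h"
proof -
  have "continuous_on (lb_dom L i) (h i)" if i: "i \<in> lb_index L" for i
  proof -
    have pos: "h i p > 0" "hs n i p > 0" if "p \<in> lb_dom L i" for p n
      using h cont[of n] i that unfolding continuous_metric_def hermitian_metric_def by blast+
    have U: "uniform_limit (lb_dom L i) (\<lambda>n p. hs n i p / h i p) (\<lambda>_. 1) sequentially"
    proof (rule uniform_limitI)
      fix e :: real assume "e > 0"
      from uniform_limitD[OF conv[unfolded metrics_converge_def] this]
      show "\<forall>\<^sub>F n in sequentially. \<forall>p\<in>lb_dom L i. dist (hs n i p / h i p) 1 < e"
        by eventually_elim (use i in auto)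
    qed
    have "uniform_limit (lb_dom L i) (\<lambda>n p. ln (hs n i p / h i p)) (\<lambda>_. ln 1) sequentially"
    proof (rule uniform_limitI)
      fix e :: real assume "e > 0"
      have "isCont ln (1 :: real)" by (simp add: isCont_ln)
      then obtain d where d: "d > 0" "\<And>x :: real. dist x 1 < d \<Longrightarrow> dist (ln x) (ln 1) < e"
        using \<open>e > 0\<close> unfolding continuous_at_eps_delta by blast
      from uniform_limitD[OF U d(1)]
      show "\<forall>\<^sub>F n in sequentially. \<forall>p\<in>lb_dom L i. dist (ln (hs n i p / h i p)) (ln 1) < e"
        by eventually_elim (use d(2) in blast)
    qed
    moreover have "ln (hs n i p / h i p) = ln (hs n i p) - ln (h i p)" if "p \<in> lb_dom L i" for n p
      using pos[OF that] by (simp add: ln_div less_imp_neq[symmetric])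
    ultimately have "uniform_limit (lb_dom L i) (\<lambda>n p. ln (hs n i p)) (\<lambda>p. ln (h i p)) sequentially"
      unfolding uniform_limit_iff dist_real_def by simp
    hence "continuous_on (lb_dom L i) (\<lambda>p. ln (h i p))"
    proof (rule uniform_limit_theorem[rotated])
      have "continuous_on (lb_dom L i) (hs n i)" for n
        using cont[of n] i by (simp add: continuous_metric_def)
      thus "\<forall>\<^sub>F n in sequentially. continuous_on (lb_dom L i) (\<lambda>p. ln (hs n i p))"
        using pos(2) by (intro always_eventually allI continuous_on_ln) (metis less_irrefl)+
    qed simp
    hence "continuous_on (lb_dom L i) (\<lambda>p. exp (ln (h i p)))" by (rule continuous_on_exp)
    thus ?thesis by (rule continuous_on_eq) (simp add: pos)
  qed
  thus ?thesis using h by (simp add: continuous_metric_def)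
qed

lemma (in riemann_surface) smooth_imp_continuous_metric:
  assumes "smooth_metric A (tangent_bundle A) h"
  shows "continuous_metric (tangent_bundle A) h"
proof -
  have "continuous_on (fst c) (h c)" if c: "c \<in> A" for c
  proof -
    have "surface_smooth_on A (fst c) (h c)"
      using assms c unfolding smooth_metric_def tangent_bundle_sel by blast
    from surface_smooth_onD[OF this c]
    have "continuous_on (snd c ` fst c) (\<lambda>z. h c (param c z))" by (simp add: smooth_on_imp_continuous_on)
    hence "continuous_on (fst c) (\<lambda>p. h c (param c (snd c p)))"
      by (rule continuous_on_compose2[OF _ continuous_on_coord[OF c]]) simp
    thus ?thesis by (rule continuous_on_eq) (simp add: c)
  qed
  thus ?thesis using assms by (simp add: continuous_metric_def smooth_metric_def tangent_bundle_sel)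
qed

section \<open>The completion of the smooth functions\<close>

locale metric_completion = surface_metric A h for A :: "'a::t2_space chart set" and h +
  fixes hO :: real and scaleC :: "complex \<Rightarrow> 'h::banach \<Rightarrow> 'h" and ip :: "'h \<Rightarrow> 'h \<Rightarrow> complex"
    and \<iota> :: "('a \<Rightarrow> complex) \<Rightarrow> 'h"
  assumes hO_pos: "hO > 0"
    and completion: "hilbert_completion (smooth_functions A) (L2_inner A hO h) scaleC ip \<iota>"
begin

sublocale complex_hilbert_space scaleC ip
  using completion by (simp add: hilbert_completion_def)

abbreviation V :: "('a \<Rightarrow> complex) set" where "V \<equiv> smooth_functions A"
abbreviation N :: "('a \<Rightarrow> complex) \<Rightarrow> real" where "N \<equiv> L2_norm A hO h"
abbreviation cls :: "('a \<Rightarrow> complex) \<Rightarrow> 'h" where "cls \<equiv> completion_class V N \<iota>"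

lemma ip_\<iota>: "\<xi> \<in> V \<Longrightarrow> \<eta> \<in> V \<Longrightarrow> ip (\<iota> \<xi>) (\<iota> \<eta>) = L2_inner A hO h \<xi> \<eta>"
  using completion by (simp add: hilbert_completion_def)

lemma dense_\<iota>: "closure (\<iota> ` V) = UNIV"
  using completion by (simp add: hilbert_completion_def)

lemma \<iota>_diff:
  assumes "\<xi> \<in> V" "\<eta> \<in> V" shows "\<iota> (\<lambda>p. \<xi> p - \<eta> p) = \<iota> \<xi> - \<iota> \<eta>"
proof -
  have "\<forall>\<xi>\<in>V. \<forall>\<eta>\<in>V. \<iota> (\<lambda>p. \<xi> p + \<eta> p) = \<iota> \<xi> + \<iota> \<eta>"
    using completion by (simp add: hilbert_completion_def)
  hence "\<iota> (\<lambda>p. (\<xi> p - \<eta> p) + \<eta> p) = \<iota> (\<lambda>p. \<xi> p - \<eta> p) + \<iota> \<eta>"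
    by (rule bspec[OF bspec[OF _ smooth_functions_diff[OF assms]] assms(2)])
  thus ?thesis by simp
qed

lemma L2_norm_eq:
  "N f = sqrt (hO * (\<integral>p. (cmod (f p))\<^sup>2 \<partial>vol))"
proof -
  have "L2_inner A hO h f f = (\<integral>p. complex_of_real (hO * (cmod (f p))\<^sup>2) \<partial>vol)"
    unfolding L2_inner_def
    by (intro Bochner_Integration.integral_cong refl) (simp add: complex_norm_square mult.commute del: of_real_power)
  thus ?thesis unfolding L2_norm_def by (simp del: of_real_power of_real_mult)
qed

lemma norm_\<iota>:
  assumes "\<xi> \<in> V" shows "norm (\<iota> \<xi>) = N \<xi>"
proof -
  have "complex_of_real ((norm (\<iota> \<xi>))\<^sup>2) = L2_inner A hO h \<xi> \<xi>"
    using ip_\<iota>[OF assms assms] ip_norm by simp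
  hence "(norm (\<iota> \<xi>))\<^sup>2 = Re (L2_inner A hO h \<xi> \<xi>)" by (metis Re_complex_of_real)
  thus ?thesis unfolding L2_norm_def by (metis norm_ge_zero real_sqrt_unique)
qed

lemma norm_\<iota>_diff: "\<xi> \<in> V \<Longrightarrow> \<eta> \<in> V \<Longrightarrow> norm (\<iota> \<xi> - \<iota> \<eta>) = N (\<lambda>p. \<xi> p - \<eta> p)"
  using norm_\<iota>[OF smooth_functions_diff] \<iota>_diff by metis

lemma integrable_square: "continuous_on UNIV f \<Longrightarrow> integrable vol (\<lambda>p. (cmod (f p))\<^sup>2)"
proof -
  assume f: "continuous_on UNIV f"
  have "integrable vol (\<lambda>p. cmod (f p * f p))"
    by (intro integrable_norm integrable_continuous continuous_intros f)
  thus ?thesis by (simp add: norm_mult power2_eq_square)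
qed

text \<open>A squared triangle inequality, obtained by integrating
  \<open>(a + b)\<^sup>2 \<le> 2 * a\<^sup>2 + 2 * b\<^sup>2\<close>. It serves only for comparisons
  in which the right-hand side can be made small.\<close>

lemma L2_norm_triangle:
  assumes "continuous_on UNIV f" "continuous_on UNIV g" "continuous_on UNIV k"
  shows "(N (\<lambda>p. f p - g p))\<^sup>2 \<le> 2 * (N (\<lambda>p. f p - k p))\<^sup>2 + 2 * (N (\<lambda>p. g p - k p))\<^sup>2"
proof -
  have sq: "(N u)\<^sup>2 = hO * (\<integral>p. (cmod (u p))\<^sup>2 \<partial>vol)" for u
    unfolding L2_norm_eq using hO_pos by (simp add: integral_nonneg_AE)
  have "(\<integral>p. (cmod (f p - g p))\<^sup>2 \<partial>vol)
      \<le> (\<integral>p. 2 * (cmod (f p - k p))\<^sup>2 + 2 * (cmod (g p - k p))\<^sup>2 \<partial>vol)"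
  proof (rule integral_mono)
    fix p
    have "cmod (f p - g p) \<le> cmod (f p - k p) + cmod (g p - k p)"
      using norm_triangle_ineq4[of "f p - k p" "g p - k p"] by simp
    hence "(cmod (f p - g p))\<^sup>2 \<le> (cmod (f p - k p) + cmod (g p - k p))\<^sup>2" by (intro power_mono) auto
    also have "\<dots> \<le> 2 * (cmod (f p - k p))\<^sup>2 + 2 * (cmod (g p - k p))\<^sup>2"
      using sum_squares_bound[of "cmod (f p - k p)" "cmod (g p - k p)"] by (simp add: power2_sum)
    finally show "(cmod (f p - g p))\<^sup>2 \<le> 2 * (cmod (f p - k p))\<^sup>2 + 2 * (cmod (g p - k p))\<^sup>2" .
  qed (intro Bochner_Integration.integrable_add integrable_mult_right integrable_square continuous_intros assms)+
  also have "\<dots> = 2 * (\<integral>p. (cmod (f p - k p))\<^sup>2 \<partial>vol) + 2 * (\<integral>p. (cmod (g p - k p))\<^sup>2 \<partial>vol)"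
    by (simp add: integrable_square continuous_on_diff assms)
  finally show ?thesis unfolding sq using hO_pos
    by (simp add: mult_left_mono algebra_simps) (metis (no_types, lifting) distrib_left mult.left_commute mult_left_mono less_imp_le)
qed

text \<open>The total volume is finite, so a uniform error is an error in the integral.\<close>

lemma integral_uniform_limit:
  fixes F :: "nat \<Rightarrow> 'a \<Rightarrow> complex"
  assumes F: "\<And>m. continuous_on UNIV (F m)" and lim: "uniform_limit UNIV F G sequentially"
  shows "(\<lambda>m. \<integral>p. F m p \<partial>vol) \<longlonglongrightarrow> (\<integral>p. G p \<partial>vol)"
proof (rule metric_LIMSEQ_I)
  fix e :: real assume e: "e > 0"
  define M where "M = measure vol UNIV"
  have M: "M \<ge> 0" by (simp add: M_def)
  have G: "continuous_on UNIV G"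
    by (rule uniform_limit_theorem[OF _ lim]) (simp_all add: F)
  define d where "d = e / (M + 1)"
  have d: "d > 0" "d * M < e" using e M by (auto simp: d_def field_simps)
  obtain m0 where m0: "\<And>m p. m \<ge> m0 \<Longrightarrow> dist (F m p) (G p) < d"
    using uniform_limitD[OF lim d(1)] by (auto simp: eventually_sequentially)
  show "\<exists>m0. \<forall>m\<ge>m0. dist (\<integral>p. F m p \<partial>vol) (\<integral>p. G p \<partial>vol) < e"
  proof (intro exI[of _ m0] allI impI)
    fix m assume m: "m \<ge> m0"
    have "dist (\<integral>p. F m p \<partial>vol) (\<integral>p. G p \<partial>vol) = cmod (\<integral>p. F m p - G p \<partial>vol)"
      by (simp add: dist_norm integrable_continuous F G)
    also have "\<dots> \<le> (\<integral>p. cmod (F m p - G p) \<partial>vol)" by (rule integral_norm_bound)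
    also have "\<dots> \<le> (\<integral>p. d \<partial>vol)"
    proof (rule integral_mono)
      show "integrable vol (\<lambda>p. cmod (F m p - G p))"
        by (intro integrable_norm integrable_continuous continuous_intros F G)
      show "integrable vol (\<lambda>p. d)" by (rule finite_measure.integrable_const[OF finite_measure_vol])
      show "cmod (F m p - G p) \<le> d" for p using m0[OF m, of p] by (simp add: dist_norm)
    qed
    also have "\<dots> = d * M" by (simp add: M_def)
    finally show "dist (\<integral>p. F m p \<partial>vol) (\<integral>p. G p \<partial>vol) < e" using d(2) by simp
  qed
qed

lemma L2_inner_uniform_limit:
  assumes F: "\<And>m. continuous_on UNIV (F m)" "uniform_limit UNIV F f sequentially"
    and G: "\<And>m. continuous_on UNIV (G m)" "uniform_limit UNIV G g sequentially"
  shows "(\<lambda>m. L2_inner A hO h (F m) (G m)) \<longlonglongrightarrow> L2_inner A hO h f g"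
  unfolding L2_inner_def
proof (rule integral_uniform_limit)
  show "continuous_on UNIV (\<lambda>p. F m p * cnj (G m p) * complex_of_real hO)" for m
    by (intro continuous_intros F G)
  have f: "continuous_on UNIV f" by (rule uniform_limit_theorem[OF _ F(2)]) (simp_all add: F)
  have g: "continuous_on UNIV g" by (rule uniform_limit_theorem[OF _ G(2)]) (simp_all add: G)
  have bnd: "bounded (range u)" if "continuous_on UNIV u" for u :: "'a \<Rightarrow> complex"
    using continuous_imp_measurable_bounded(2)[OF that] by (auto simp: bounded_iff)
  have cg: "uniform_limit UNIV (\<lambda>m p. cnj (G m p)) (\<lambda>p. cnj (g p)) sequentially"
    by (rule bounded_linear.uniform_limit[OF bounded_linear_cnj G(2)])
  show "uniform_limit UNIV (\<lambda>m p. F m p * cnj (G m p) * complex_of_real hO)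
      (\<lambda>p. f p * cnj (g p) * complex_of_real hO) sequentially"
    by (intro uniform_lim_mult F(2) cg uniform_limit_const bnd continuous_intros f g)
qed

text \<open>\<open>completion_class\<close> is a definite description. Since \<open>\<iota>\<close>
  preserves the norm, any two sequences of smooth functions approaching \<open>f\<close> in
  \<open>N\<close> have images with vanishing distance, and one such sequence is Cauchy; this makes
  the description meaningful.\<close>

lemma completion_class_tendsto:
  assumes f: "continuous_on UNIV f" and \<xi>: "\<And>n. \<xi> n \<in> V" and lim: "(\<lambda>n. N (\<lambda>p. \<xi> n p - f p)) \<longlonglongrightarrow> 0"
  shows "(\<lambda>n. \<iota> (\<xi> n)) \<longlonglongrightarrow> cls f"
proof -
  have tri: "(norm (\<iota> \<xi> - \<iota> \<eta>))\<^sup>2 \<le> 2 * (N (\<lambda>p. \<xi> p - f p))\<^sup>2 + 2 * (N (\<lambda>p. \<eta> p - f p))\<^sup>2"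
    if "\<xi> \<in> V" "\<eta> \<in> V" for \<xi> \<eta>
    unfolding norm_\<iota>_diff[OF that] by (intro L2_norm_triangle smooth_functions_continuous that f)
  have N0: "N u \<ge> 0" for u unfolding L2_norm_eq using hO_pos by (simp add: integral_nonneg_AE)
  have "Cauchy (\<lambda>n. \<iota> (\<xi> n))"
  proof (rule CauchyI)
    fix e :: real assume e: "e > 0"
    \<comment> \<open>With \<open>e / 2\<close> for both members, the bound \<open>tri\<close>
      yields \<open>2 * (e / 2)\<^sup>2 + 2 * (e / 2)\<^sup>2 = e\<^sup>2\<close>.\<close>
    obtain n0 where n0: "\<And>n. n \<ge> n0 \<Longrightarrow> N (\<lambda>p. \<xi> n p - f p) < e / 2"
      using order_tendstoD(2)[OF lim, of "e / 2"] e by (auto simp: eventually_sequentially)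
    have "norm (\<iota> (\<xi> m) - \<iota> (\<xi> n)) < e" if "m \<ge> n0" "n \<ge> n0" for m n
    proof -
      have sq: "(N (\<lambda>p. \<xi> k p - f p))\<^sup>2 < (e / 2)\<^sup>2" if "k \<ge> n0" for k
        by (rule power_strict_mono[OF n0[OF that] N0]) simp
      have "(norm (\<iota> (\<xi> m) - \<iota> (\<xi> n)))\<^sup>2 < e\<^sup>2"
        using tri[OF \<xi> \<xi>, of m n] sq[OF that(1)] sq[OF that(2)] by (simp add: power_divide)
      thus ?thesis using e by (simp add: power_less_imp_less_base)
    qed
    thus "\<exists>M. \<forall>m\<ge>M. \<forall>n\<ge>M. norm (\<iota> (\<xi> m) - \<iota> (\<xi> n)) < e" by blast
  qed
  then obtain x where x: "(\<lambda>n. \<iota> (\<xi> n)) \<longlonglongrightarrow> x" using Cauchy_convergent convergent_def by blast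
  have "cls f = x"
    unfolding completion_class_def
  proof (rule the_equality)
    show "\<exists>\<xi>. (\<forall>n. \<xi> n \<in> V) \<and> (\<lambda>n. N (\<lambda>p. \<xi> n p - f p)) \<longlonglongrightarrow> 0 \<and> (\<lambda>n. \<iota> (\<xi> n)) \<longlonglongrightarrow> x"
      using \<xi> lim x by blast
    fix y assume "\<exists>\<eta>. (\<forall>n. \<eta> n \<in> V) \<and> (\<lambda>n. N (\<lambda>p. \<eta> n p - f p)) \<longlonglongrightarrow> 0 \<and> (\<lambda>n. \<iota> (\<eta> n)) \<longlonglongrightarrow> y"
    then obtain \<eta> where \<eta>: "\<And>n. \<eta> n \<in> V" "(\<lambda>n. N (\<lambda>p. \<eta> n p - f p)) \<longlonglongrightarrow> 0" "(\<lambda>n. \<iota> (\<eta> n)) \<longlonglongrightarrow> y" by blast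
    have "(norm (x - y))\<^sup>2 \<le> 2 * 0\<^sup>2 + 2 * 0\<^sup>2"
    proof (rule LIMSEQ_le)
      show "(\<lambda>n. (norm (\<iota> (\<xi> n) - \<iota> (\<eta> n)))\<^sup>2) \<longlonglongrightarrow> (norm (x - y))\<^sup>2"
        by (intro tendsto_intros x \<eta>(3))
      show "(\<lambda>n. 2 * (N (\<lambda>p. \<xi> n p - f p))\<^sup>2 + 2 * (N (\<lambda>p. \<eta> n p - f p))\<^sup>2) \<longlonglongrightarrow> 2 * 0\<^sup>2 + 2 * 0\<^sup>2"
        by (intro tendsto_add tendsto_mult tendsto_power tendsto_const lim \<eta>(2))
      show "\<exists>N0. \<forall>n\<ge>N0. (norm (\<iota> (\<xi> n) - \<iota> (\<eta> n)))\<^sup>2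
          \<le> 2 * (N (\<lambda>p. \<xi> n p - f p))\<^sup>2 + 2 * (N (\<lambda>p. \<eta> n p - f p))\<^sup>2"
        using tri[OF \<xi> \<eta>(1)] by blast
    qed
    thus "y = x" by simp
  qed
  with x show ?thesis by simp
qed

lemma L2_norm_zero: "N (\<lambda>p. 0) = 0"
  by (simp add: L2_norm_eq)

lemma completion_class_smooth:
  assumes "\<xi> \<in> V" shows "cls \<xi> = \<iota> \<xi>"
proof -
  have "(\<lambda>n :: nat. \<iota> \<xi>) \<longlonglongrightarrow> cls \<xi>"
    by (rule completion_class_tendsto[OF smooth_functions_continuous[OF assms] assms]) (simp add: L2_norm_zero)
  thus ?thesis by (simp add: LIMSEQ_const_iff)
qed

text \<open>Uniform limits of smooth functions are also limits in \<open>N\<close>, so inner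
  products and distances involving their classes are still given by integrals. It is applied to the
  smooth Laplacians of the approximating metrics, which tend uniformly to the continuous Laplacian
  of the limit.\<close>

lemma completion_class_uniform:
  assumes \<xi>: "\<And>n. \<xi> n \<in> V" and lim: "uniform_limit UNIV \<xi> f sequentially"
  shows "(\<lambda>n. \<iota> (\<xi> n)) \<longlonglongrightarrow> cls f"
    and "\<eta> \<in> V \<Longrightarrow> ip (cls f) (\<iota> \<eta>) = L2_inner A hO h f \<eta>"
    and "\<eta> \<in> V \<Longrightarrow> norm (\<iota> \<eta> - cls f) = N (\<lambda>p. \<eta> p - f p)"
proof -
  note c = smooth_functions_continuous
  have f: "continuous_on UNIV f"
    by (rule uniform_limit_theorem[OF _ lim]) (simp_all add: c \<xi>)
  have "uniform_limit UNIV (\<lambda>n p. \<xi> n p - f p) (\<lambda>p. f p - f p) sequentially"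
    by (intro uniform_limit_intros lim)
  from L2_inner_uniform_limit[OF _ this _ this]
  have "(\<lambda>n. L2_inner A hO h (\<lambda>p. \<xi> n p - f p) (\<lambda>p. \<xi> n p - f p)) \<longlonglongrightarrow> L2_inner A hO h (\<lambda>p. f p - f p) (\<lambda>p. f p - f p)"
    by (simp add: continuous_on_diff c \<xi> f)
  hence "(\<lambda>n. N (\<lambda>p. \<xi> n p - f p)) \<longlonglongrightarrow> N (\<lambda>p. f p - f p)"
    unfolding L2_norm_def by (intro tendsto_real_sqrt tendsto_Re)
  hence "(\<lambda>n. N (\<lambda>p. \<xi> n p - f p)) \<longlonglongrightarrow> 0" by (simp add: L2_norm_zero)
  thus cl: "(\<lambda>n. \<iota> (\<xi> n)) \<longlonglongrightarrow> cls f" by (rule completion_class_tendsto[OF f \<xi>])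
  show "ip (cls f) (\<iota> \<eta>) = L2_inner A hO h f \<eta>" if \<eta>: "\<eta> \<in> V"
  proof -
    have "(\<lambda>n. ip (\<iota> (\<xi> n)) (\<iota> \<eta>)) \<longlonglongrightarrow> ip (cls f) (\<iota> \<eta>)"
      by (intro tendsto_ip cl tendsto_const)
    moreover have "(\<lambda>n. L2_inner A hO h (\<xi> n) \<eta>) \<longlonglongrightarrow> L2_inner A hO h f \<eta>"
      by (rule L2_inner_uniform_limit[OF c[OF \<xi>] lim c[OF \<eta>] uniform_limit_const])
    ultimately show ?thesis using ip_\<iota>[OF \<xi> \<eta>] LIMSEQ_unique by simp
  qed
  show "norm (\<iota> \<eta> - cls f) = N (\<lambda>p. \<eta> p - f p)" if \<eta>: "\<eta> \<in> V"
  proof -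
    have "(\<lambda>n. norm (\<iota> \<eta> - \<iota> (\<xi> n))) \<longlonglongrightarrow> norm (\<iota> \<eta> - cls f)" by (intro tendsto_intros cl)
    moreover have "uniform_limit UNIV (\<lambda>n p. \<eta> p - \<xi> n p) (\<lambda>p. \<eta> p - f p) sequentially"
      by (intro uniform_limit_intros lim)
    from L2_inner_uniform_limit[OF _ this _ this]
    have "(\<lambda>n. L2_inner A hO h (\<lambda>p. \<eta> p - \<xi> n p) (\<lambda>p. \<eta> p - \<xi> n p))
        \<longlonglongrightarrow> L2_inner A hO h (\<lambda>p. \<eta> p - f p) (\<lambda>p. \<eta> p - f p)"
      by (simp add: continuous_on_diff c \<xi> \<eta>)
    hence "(\<lambda>n. N (\<lambda>p. \<eta> p - \<xi> n p)) \<longlonglongrightarrow> N (\<lambda>p. \<eta> p - f p)"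
      unfolding L2_norm_def by (intro tendsto_real_sqrt tendsto_Re)
    ultimately show ?thesis using norm_\<iota>_diff[OF \<eta> \<xi>] LIMSEQ_unique by simp
  qed
qed

lemma L2_norm_le:
  assumes "continuous_on UNIV f" "continuous_on UNIV g" "e \<ge> 0" "\<And>p. cmod (f p) \<le> e * cmod (g p)"
  shows "N f \<le> e * N g"
proof -
  have "(\<integral>p. (cmod (f p))\<^sup>2 \<partial>vol) \<le> (\<integral>p. e\<^sup>2 * (cmod (g p))\<^sup>2 \<partial>vol)"
  proof (rule integral_mono)
    show "(cmod (f p))\<^sup>2 \<le> e\<^sup>2 * (cmod (g p))\<^sup>2" for p
      using power_mono[OF assms(4), of p 2] by (simp add: power_mult_distrib)
  qed (intro integrable_mult_right integrable_square assms)+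
  hence "hO * (\<integral>p. (cmod (f p))\<^sup>2 \<partial>vol) \<le> e\<^sup>2 * (hO * (\<integral>p. (cmod (g p))\<^sup>2 \<partial>vol))"
    using hO_pos by (simp add: mult.left_commute)
  hence "N f \<le> sqrt (e\<^sup>2 * (hO * (\<integral>p. (cmod (g p))\<^sup>2 \<partial>vol)))"
    unfolding L2_norm_eq by (rule real_sqrt_le_mono)
  also have "\<dots> = e * N g" using assms(3) by (simp add: L2_norm_eq real_sqrt_mult)
  finally show ?thesis .
qed

text \<open>Symmetry with the Laplacian kept in the first slot on both sides, where
  \<open>completion_class_uniform\<close> evaluates inner products; the conjugation is undone by
  \<open>ip_commute\<close>.\<close>

lemma laplacian_completion_symmetric:
  assumes \<rho>: "cutoff_function \<rho>" and \<xi>: "\<xi> \<in> V" and \<eta>: "\<eta> \<in> V"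
  shows "L2_inner A hO h (laplacian A h \<xi>) \<eta> = cnj (L2_inner A hO h (laplacian A h \<eta>) \<xi>)"
proof -
  have "L2_inner A hO h (laplacian A h \<xi>) \<eta> = (\<integral>p. laplacian A h \<xi> p * cnj (\<eta> p) \<partial>vol) * hO"
    unfolding L2_inner_def by simp
  also have "\<dots> = (\<integral>p. \<xi> p * cnj (laplacian A h \<eta> p) \<partial>vol) * hO"
    by (simp only: laplacian_symmetric[OF \<rho> \<xi> \<eta>])
  also have "(\<integral>p. \<xi> p * cnj (laplacian A h \<eta> p) \<partial>vol) = (\<integral>p. cnj (laplacian A h \<eta> p * cnj (\<xi> p)) \<partial>vol)"
    by (intro Bochner_Integration.integral_cong refl) simp
  also have "\<dots> = cnj (\<integral>p. laplacian A h \<eta> p * cnj (\<xi> p) \<partial>vol)" by (rule Bochner_Integration.integral_cnj)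
  also have "\<dots> * hO = cnj ((\<integral>p. laplacian A h \<eta> p * cnj (\<xi> p) \<partial>vol) * hO)" by simp
  finally show ?thesis unfolding L2_inner_def by simp
qed

text \<open>In every chart \<open>hs n c p * laplacian (hs n) \<xi> p\<close> is the same number, so the ratio of two Laplacians is
  the inverse ratio of the metrics.\<close>

lemma maximal_selfadjoint_laplacian:
  assumes \<rho>: "cutoff_function \<rho>"
    and hs: "\<And>n. smooth_metric A (tangent_bundle A) (hs n)"
    and conv: "metrics_converge (tangent_bundle A) hs h"
    and res: "\<And>n. is_resolvent (laplacian_graph A N \<iota> (hs n)) (R n)"
    and S: "bounded_linear S" and lim: "(\<lambda>n. onorm (\<lambda>x. R n x - S x)) \<longlonglongrightarrow> 0"
  shows "\<exists>\<Delta>. laplacian_graph A N \<iota> h \<subseteq> op_graph (range S) \<Delta> \<and>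
    maximal_selfadjoint scaleC ip (range S) \<Delta> \<and>
    bij_betw (\<lambda>x. x + \<Delta> x) (range S) UNIV \<and>
    (\<forall>f. S f + \<Delta> (S f) = f) \<and> (\<forall>x\<in>range S. S (x + \<Delta> x) = x)"
proof -
  define L where "L n = laplacian A (hs n)" for n
  have LV: "L n \<xi> \<in> V" if "\<xi> \<in> V" for n \<xi> unfolding L_def by (rule laplacian_smooth[OF hs that])
  have herm: "hermitian_metric (tangent_bundle A) (hs n)" for n using hs by (simp add: smooth_metric_def)
  \<comment> \<open>Two forms of one estimate. The first, relative to \<open>L n \<xi>\<close>, is
    what the almost-symmetry of resolvents uses; the second, relative to the fixed limit function,
    gives uniform convergence. The restriction to \<open>e \<le> 1 / 2\<close> keeps the ratio
    \<open>r\<close> at least \<open>1 / 2\<close>, whence the factor 2.\<close>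
  have ratio: "\<forall>\<^sub>F n in sequentially. \<forall>\<xi>\<in>V. \<forall>p.
      cmod (L n \<xi> p - laplacian A h \<xi> p) \<le> e * cmod (L n \<xi> p) \<and>
      cmod (L n \<xi> p - laplacian A h \<xi> p) \<le> 2 * e * cmod (laplacian A h \<xi> p)"
    if e: "e > 0" "e \<le> 1 / 2" for e
    using uniform_limitD[OF conv[unfolded metrics_converge_def] e(1)]
  proof eventually_elim
    case (elim n)
    have "cmod (L n \<xi> p - laplacian A h \<xi> p) \<le> e * cmod (L n \<xi> p) \<and>
      cmod (L n \<xi> p - laplacian A h \<xi> p) \<le> 2 * e * cmod (laplacian A h \<xi> p)" if \<xi>: "\<xi> \<in> V" for \<xi> p
    proof -
      obtain c where c: "c \<in> A" "p \<in> fst c" using chart_exists by blast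
      define r where "r = hs n c p / h c p"
      have pos: "h c p > 0" "hs n c p > 0"
        using metric_pos[OF c] herm[of n] c unfolding hermitian_metric_def tangent_bundle_sel by blast+
      have "\<bar>r - 1\<bar> < e" using elim c by (auto simp: tangent_bundle_sel r_def dist_real_def)
      hence r: "\<bar>1 - r\<bar> \<le> e" "r \<ge> 1 / 2" using e by linarith+
      have eq: "laplacian A h \<xi> p = complex_of_real r * L n \<xi> p"
        unfolding L_def laplacian_chart[OF herm \<xi> c] laplacian_chart[OF hermitian \<xi> c] r_def
        using pos by (simp add: field_simps)
      have "L n \<xi> p - laplacian A h \<xi> p = complex_of_real (1 - r) * L n \<xi> p"
        unfolding eq by (simp add: algebra_simps)
      hence n1: "cmod (L n \<xi> p - laplacian A h \<xi> p) = \<bar>1 - r\<bar> * cmod (L n \<xi> p)"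
        by (simp only: norm_mult norm_of_real)
      have "cmod (L n \<xi> p) \<le> 2 * cmod (laplacian A h \<xi> p)"
        unfolding eq norm_mult norm_of_real
        using mult_right_mono[of "1 / 2" "\<bar>r\<bar>" "cmod (L n \<xi> p)"] r(2) by simp
      hence "e * cmod (L n \<xi> p) \<le> 2 * e * cmod (laplacian A h \<xi> p)"
        using mult_left_mono[of _ _ e] e(1) by fastforce
      moreover have "\<bar>1 - r\<bar> * cmod (L n \<xi> p) \<le> e * cmod (L n \<xi> p)"
        by (rule mult_right_mono[OF r(1)]) simp
      ultimately show ?thesis unfolding n1 by linarith
    qed
    thus ?case by blast
  qed
  have unif: "uniform_limit UNIV (\<lambda>n. L n \<xi>) (laplacian A h \<xi>) sequentially" if \<xi>: "\<xi> \<in> V" for \<xi>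
  proof (rule uniform_limitI)
    fix e :: real assume e: "e > 0"
    obtain B where B: "\<And>p. cmod (laplacian A h \<xi> p) \<le> B"
      using continuous_imp_measurable_bounded(2)[OF laplacian_continuous[OF \<xi>]] by blast
    have B0: "B \<ge> 0" using B norm_ge_zero order_trans by blast
    \<comment> \<open>Chosen so that \<open>2 * d * B < e\<close>; the summand 1 allows for
      \<open>B = 0\<close>.\<close>
    define d where "d = min (1 / 2) (e / (2 * (B + 1)))"
    have d: "d > 0" "d \<le> 1 / 2" using e B0 unfolding d_def by (simp_all only: min.cobounded1) simp
    have "2 * d * B < e"
    proof -
      have "2 * d * B \<le> 2 * (e / (2 * (B + 1))) * B"
        using B0 by (intro mult_right_mono mult_left_mono) (auto simp: d_def)
      also have "\<dots> < e" using e B0 by (simp add: field_simps)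
      finally show ?thesis .
    qed
    show "\<forall>\<^sub>F n in sequentially. \<forall>p\<in>UNIV. dist (L n \<xi> p) (laplacian A h \<xi> p) < e"
      using ratio[OF d]
    proof eventually_elim
      case (elim n)
      show ?case
      proof
        fix p
        have "dist (L n \<xi> p) (laplacian A h \<xi> p) \<le> 2 * d * cmod (laplacian A h \<xi> p)"
          using elim \<xi> by (simp add: dist_norm)
        also have "\<dots> \<le> 2 * d * B" using B d by (intro mult_left_mono) auto
        finally show "dist (L n \<xi> p) (laplacian A h \<xi> p) < e" using \<open>2 * d * B < e\<close> by simp
      qed
    qed
  qed
  \<comment> \<open>The approximating sequence for the class of \<open>laplacian A h \<xi>\<close>
    is \<open>L n \<xi>\<close> itself.\<close>
  note CU = completion_class_uniform[OF LV unif]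
  have graph: "laplacian_graph A N \<iota> (hs n) = (\<lambda>\<xi>. (\<iota> \<xi>, \<iota> (L n \<xi>))) ` V" for n
    unfolding laplacian_graph_def L_def[symmetric]
    by (intro image_cong refl) (simp add: completion_class_smooth LV)
  have "\<exists>\<Delta>. (\<lambda>\<xi>. (\<iota> \<xi>, cls (laplacian A h \<xi>))) ` V \<subseteq> op_graph (range S) \<Delta> \<and>
    maximal_selfadjoint scaleC ip (range S) \<Delta> \<and>
    bij_betw (\<lambda>x. x + \<Delta> x) (range S) UNIV \<and>
    (\<forall>f. S f + \<Delta> (S f) = f) \<and> (\<forall>x\<in>range S. S (x + \<Delta> x) = x)"
  proof (rule maximal_selfadjoint_resolvent_limit[OF dense_\<iota> _ _ _ _ S lim])
    show "is_resolvent ((\<lambda>\<xi>. (\<iota> \<xi>, \<iota> (L n \<xi>))) ` V) (R n)" for n using res[of n] graph by simp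
    show "(\<lambda>n. \<iota> (L n \<xi>)) \<longlonglongrightarrow> cls (laplacian A h \<xi>)" if "\<xi> \<in> V" for \<xi>
      by (rule CU(1)[OF that that])
    show "ip (cls (laplacian A h \<xi>)) (\<iota> \<eta>) = ip (\<iota> \<xi>) (cls (laplacian A h \<eta>))"
      if \<xi>: "\<xi> \<in> V" and \<eta>: "\<eta> \<in> V" for \<xi> \<eta>
      using CU(2)[OF \<xi> \<xi> \<eta>] CU(2)[OF \<eta> \<eta> \<xi>] laplacian_completion_symmetric[OF \<rho> \<xi> \<eta>]
      by (simp add: ip_commute[of "\<iota> \<xi>"])
    show "\<forall>\<^sub>F n in sequentially. \<forall>\<xi>\<in>V. norm (\<iota> (L n \<xi>) - cls (laplacian A h \<xi>)) \<le> e * norm (\<iota> (L n \<xi>))"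
      if e: "e > 0" for e
    proof -
      have "min e (1 / 2) > 0" "min e (1 / 2) \<le> 1 / 2" using e by auto
      from ratio[OF this] show ?thesis
      proof eventually_elim
        case (elim n)
        show ?case
        proof
          fix \<xi> assume \<xi>: "\<xi> \<in> V"
          have "norm (\<iota> (L n \<xi>) - cls (laplacian A h \<xi>)) = N (\<lambda>p. L n \<xi> p - laplacian A h \<xi> p)"
            by (rule CU(3)[OF \<xi> \<xi> LV[OF \<xi>]])
          also have "\<dots> \<le> min e (1 / 2) * N (L n \<xi>)"
            using elim \<xi> e
            by (intro L2_norm_le continuous_on_diff laplacian_continuous smooth_functions_continuous LV) auto
          also have "\<dots> \<le> e * N (L n \<xi>)"
            using norm_ge_zero[of "\<iota> (L n \<xi>)"] norm_\<iota>[OF LV[OF \<xi>]] by (intro mult_right_mono) auto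
          finally show "norm (\<iota> (L n \<xi>) - cls (laplacian A h \<xi>)) \<le> e * norm (\<iota> (L n \<xi>))"
            by (simp add: norm_\<iota>[OF LV[OF \<xi>]])
        qed
      qed
    qed
  qed
  thus ?thesis by (simp only: laplacian_graph_def)
qed

end

section \<open>Selfadjointness of the limit Laplacian\<close>

theorem theorem1p2:
  fixes A :: "'a::t2_space chart set"
    and L1 :: "('a, 'i) line_bundle" and L2 :: "('a, 'j) line_bundle"
    and \<sigma> :: "'a chart \<Rightarrow> 'i \<times> 'j \<Rightarrow> 'a \<Rightarrow> complex"
    and h1 :: "('a, 'i) metric" and h2 :: "('a, 'j) metric" and hX :: "('a, 'a chart) metric"
    and h1s :: "nat \<Rightarrow> ('a, 'i) metric" and h2s :: "nat \<Rightarrow> ('a, 'j) metric"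
    and \<rho> :: "real \<Rightarrow> real" and hO :: real
    and hXu :: "real \<Rightarrow> ('a, 'a chart) metric"
    and scaleC :: "complex \<Rightarrow> 'h::banach \<Rightarrow> 'h" and ip :: "'h \<Rightarrow> 'h \<Rightarrow> complex"
    and \<iota> :: "('a \<Rightarrow> complex) \<Rightarrow> 'h"
    and R :: "real \<Rightarrow> 'h \<Rightarrow> 'h" and Rinf :: "'h \<Rightarrow> 'h" and H2 :: "'h set"
  assumes "compact_riemann_surface A"
    and "integrable_metric A L1 L2 \<sigma> h1 h2 hX"
    and "hO > 0"
    and "smooth_positive_approximation A L1 h1s h1"
    and "smooth_positive_approximation A L2 h2s h2"
    and "cutoff_function \<rho>"
    and "hXu = interpolated_metric \<rho> (\<lambda>n. quotient_metric L1 L2 \<sigma> (h1s n) (h2s n))"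
    and "hilbert_completion (smooth_functions A) (L2_inner A hO hX) scaleC ip \<iota>"
    and "\<And>u. u \<ge> 1 \<Longrightarrow> is_resolvent (laplacian_graph A (L2_norm A hO hX) \<iota> (hXu u)) (R u)"
    and "bounded_linear Rinf"
    and "((\<lambda>u. onorm (\<lambda>x. R u x - Rinf x)) \<longlongrightarrow> 0) at_top"
    and "H2 = range Rinf"
  shows "\<exists>\<Delta>.
    laplacian_graph A (L2_norm A hO hX) \<iota> hX \<subseteq> op_graph H2 \<Delta> \<and>
    maximal_selfadjoint scaleC ip H2 \<Delta> \<and>
    bij_betw (\<lambda>x. x + \<Delta> x) H2 UNIV \<and>
    (\<forall>f. Rinf f + \<Delta> (Rinf f) = f) \<and>
    (\<forall>x\<in>H2. Rinf (x + \<Delta> x) = x)"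
proof -
  interpret riemann_surface A using assms(1) by unfold_locales
  note I = assms(2)[unfolded integrable_metric_def]
  interpret tangent_quotient A L1 L2 \<sigma> using I by unfold_locales blast+
  define hs where "hs n = quotient_metric L1 L2 \<sigma> (h1s n) (h2s n)" for n
  have herm: "hermitian_metric L1 h1" "hermitian_metric L2 h2"
    using I by (simp_all add: admissible_metric_def)
  have conv: "metrics_converge L1 h1s h1" "metrics_converge L2 h2s h2"
    and smooth: "\<And>n. smooth_metric A L1 (h1s n)" "\<And>n. smooth_metric A L2 (h2s n)"
    using assms(4,5) by (simp_all add: smooth_positive_approximation_def)
  have hs_smooth: "smooth_metric A (tangent_bundle A) (hs n)" for n
    unfolding hs_def by (rule smooth_quotient_metric[OF smooth])
  \<comment> \<open>\<open>hX\<close> is identified with the quotient metric on chart domains only,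
    which are the only points that \<open>metrics_converge\<close> inspects.\<close>
  have "quotient_metric L1 L2 \<sigma> h1 h2 c p = hX c p" if "c \<in> A" "p \<in> fst c" for c p
    using I that by simp
  hence "metrics_converge (tangent_bundle A) hs hX"
    using quotient_metric_converge[OF herm conv]
    unfolding metrics_converge_def uniform_limit_iff hs_def[symmetric] tangent_bundle_sel
    by (simp add: split_beta)
  \<comment> \<open>The resolvents are given for \<open>u \<ge> 1\<close>, so the sequence is
    indexed by \<open>Suc n\<close>.\<close>
  hence hs_conv: "metrics_converge (tangent_bundle A) (\<lambda>n. hs (Suc n)) hX"
    unfolding metrics_converge_def by (rule filterlim_compose[OF _ filterlim_Suc])
  \<comment> \<open>Integrability of \<open>hX\<close> does not state its continuity, on which the
    volume measure and the integrals rest; it is inherited from the smooth approximants.\<close>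
  have "continuous_metric (tangent_bundle A) hX"
    using continuous_metric_limit[OF smooth_imp_continuous_metric[OF hs_smooth] _ hs_conv] I by blast
  then interpret metric_completion A hX hO scaleC ip \<iota>
    using assms(3,8) by unfold_locales
  \<comment> \<open>At an integer parameter the weight is \<open>\<rho> 0 = 0\<close>, so only the
    first of the two interpolated metrics remains.\<close>
  have hXu: "hXu (real n) = hs n" for n
    using assms(6) by (simp add: assms(7) interpolated_metric_def hs_def[abs_def] cutoff_function_def)
  have res: "is_resolvent (laplacian_graph A N \<iota> (hs (Suc n))) (R (real (Suc n)))" for n
    using assms(9)[of "real (Suc n)"] unfolding hXu by simp
  have "filterlim (\<lambda>n. real (Suc n)) at_top sequentially"
    by (rule filterlim_compose[OF filterlim_real_sequentially filterlim_Suc])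
  from filterlim_compose[OF assms(11) this]
  have lim: "(\<lambda>n. onorm (\<lambda>x. R (real (Suc n)) x - Rinf x)) \<longlonglongrightarrow> 0" .
  show ?thesis
    unfolding assms(12)
    by (rule maximal_selfadjoint_laplacian[OF assms(6) hs_smooth hs_conv res assms(10) lim])
qed

end
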